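(* Let $R$ be a commutative ring and let $(V,q)$ be a non-degenerate quadratic space over $R$. Let $A$ be a $\mathbb{Z}/2$-graded associative $R$-algebra and let $\phi: Cl(V,q)\to A$ be a graded algebra homomorphism such that $\ker(\phi)\cap R=\{0\}$. Then $\phi$ is injective.
   Context: A quadratic space $(V,q)$ is a free $R$-module $V$ with a finite basis, equipped with a quadratic form $q$; its bilinear form is $\langle v,w\rangle=q(v+w)-q(v)-q(w)$. It is non-degenerate if $\langle x,v\rangle=0$ for all $v\in V$ only when $x=0$. The Clifford algebra $Cl(V,q)$ is the quotient of the tensor algebra of $V$ by the two-sided ideal generated by all $x\otimes x-q(x)$, $x\in V$. It is $\mathbb{Z}/2$-graded, $Cl=Cl_0\oplus Cl_1$, by the even and odd tensor degrees, so $V\subseteq Cl_1$ and $R\subseteq Cl_0$. A homomorphism between two $\mathbb{Z}/2$-graded algebras is graded if it preserves the grading. Algebras are associative with unit. *)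

theory Defs
  imports "HOL-Algebra.Module" "HOL-Algebra.QuotRing"
begin

section \<open>Quadratic spaces\<close>

definition is_basis :: "('r, 'm) ring_scheme \<Rightarrow> ('r, 'v, 'n) module_scheme \<Rightarrow> 'v set \<Rightarrow> bool" where
  "is_basis R V B \<longleftrightarrow> finite B \<and> B \<subseteq> carrier V \<and>
     (\<forall>v\<in>carrier V. \<exists>!c. c \<in> B \<rightarrow>\<^sub>E carrier R \<and> v = (\<Oplus>\<^bsub>V\<^esub>b\<in>B. c b \<odot>\<^bsub>V\<^esub> b))"

definition polar_form ::
  "('r, 'm) ring_scheme \<Rightarrow> ('r, 'v, 'n) module_scheme \<Rightarrow> ('v \<Rightarrow> 'r) \<Rightarrow> 'v \<Rightarrow> 'v \<Rightarrow> 'r" where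
  "polar_form R V q v w = q (v \<oplus>\<^bsub>V\<^esub> w) \<ominus>\<^bsub>R\<^esub> q v \<ominus>\<^bsub>R\<^esub> q w"

definition bilinear_form ::
  "('r, 'm) ring_scheme \<Rightarrow> ('r, 'v, 'n) module_scheme \<Rightarrow> ('v \<Rightarrow> 'v \<Rightarrow> 'r) \<Rightarrow> bool" where
  "bilinear_form R V b \<longleftrightarrow>
     (\<forall>u\<in>carrier V. \<forall>v\<in>carrier V. b u v \<in> carrier R) \<and>
     (\<forall>u\<in>carrier V. \<forall>v\<in>carrier V. \<forall>w\<in>carrier V.
        b (u \<oplus>\<^bsub>V\<^esub> v) w = b u w \<oplus>\<^bsub>R\<^esub> b v w \<and> b u (v \<oplus>\<^bsub>V\<^esub> w) = b u v \<oplus>\<^bsub>R\<^esub> b u w) \<and>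
     (\<forall>a\<in>carrier R. \<forall>v\<in>carrier V. \<forall>w\<in>carrier V.
        b (a \<odot>\<^bsub>V\<^esub> v) w = a \<otimes>\<^bsub>R\<^esub> b v w \<and> b v (a \<odot>\<^bsub>V\<^esub> w) = a \<otimes>\<^bsub>R\<^esub> b v w)"

definition quadratic_form ::
  "('r, 'm) ring_scheme \<Rightarrow> ('r, 'v, 'n) module_scheme \<Rightarrow> ('v \<Rightarrow> 'r) \<Rightarrow> bool" where
  "quadratic_form R V q \<longleftrightarrow>
     q \<in> carrier V \<rightarrow> carrier R \<and>
     (\<forall>a\<in>carrier R. \<forall>v\<in>carrier V. q (a \<odot>\<^bsub>V\<^esub> v) = (a \<otimes>\<^bsub>R\<^esub> a) \<otimes>\<^bsub>R\<^esub> q v) \<and>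
     bilinear_form R V (polar_form R V q)"

text \<open>The base ring is commutative because the locale \<^locale>\<open>module\<close> assumes it. The ring
  multiplication that the record \<open>V\<close> carries is never used.\<close>

locale quadratic_space = module R V for R (structure) and V (structure) +
  fixes q :: "'c \<Rightarrow> 'a"
  assumes finite_basis: "\<exists>B. is_basis R V B"
    and quadratic_form: "quadratic_form R V q"

definition non_degenerate ::
  "('r, 'm) ring_scheme \<Rightarrow> ('r, 'v, 'n) module_scheme \<Rightarrow> ('v \<Rightarrow> 'r) \<Rightarrow> bool" where
  "non_degenerate R V q \<longleftrightarrow>
     (\<forall>x\<in>carrier V. (\<forall>v\<in>carrier V. polar_form R V q x v = \<zero>\<^bsub>R\<^esub>) \<longrightarrow> x = \<zero>\<^bsub>V\<^esub>)"


section \<open>Associative algebras, gradings and graded homomorphisms\<close>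

text \<open>The library locale \<^locale>\<open>algebra\<close> is restricted to commutative algebras.\<close>

locale assoc_algebra = module R A + ring A for R (structure) and A (structure) +
  assumes smult_mult_left: "\<lbrakk>a \<in> carrier R; x \<in> carrier A; y \<in> carrier A\<rbrakk> \<Longrightarrow>
      (a \<odot>\<^bsub>A\<^esub> x) \<otimes>\<^bsub>A\<^esub> y = a \<odot>\<^bsub>A\<^esub> (x \<otimes>\<^bsub>A\<^esub> y)"
    and smult_mult_right: "\<lbrakk>a \<in> carrier R; x \<in> carrier A; y \<in> carrier A\<rbrakk> \<Longrightarrow>
      x \<otimes>\<^bsub>A\<^esub> (a \<odot>\<^bsub>A\<^esub> y) = a \<odot>\<^bsub>A\<^esub> (x \<otimes>\<^bsub>A\<^esub> y)"

text \<open>Only the values \<open>G 0\<close> and \<open>G 1\<close> of a grading matter. That the unit lies in \<open>G 0\<close> is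
  a consequence.\<close>

locale z2_graded_algebra = assoc_algebra R A for R (structure) and A (structure) +
  fixes G :: "nat \<Rightarrow> 'c set"
  assumes part_submodule: "i < 2 \<Longrightarrow> submodule (G i) R A"
    and parts_span: "G 0 <+>\<^bsub>A\<^esub> G 1 = carrier A"
    and parts_disjoint: "G 0 \<inter> G 1 = {\<zero>\<^bsub>A\<^esub>}"
    and parts_mult: "\<lbrakk>i < 2; j < 2; x \<in> G i; y \<in> G j\<rbrakk> \<Longrightarrow> x \<otimes>\<^bsub>A\<^esub> y \<in> G ((i + j) mod 2)"

definition alg_hom ::
  "('r, 'm) ring_scheme \<Rightarrow> ('r, 'a, 'k) module_scheme \<Rightarrow> ('r, 'b, 'l) module_scheme \<Rightarrow> ('a \<Rightarrow> 'b) set"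
where
  "alg_hom R A B = {h \<in> ring_hom A B.
     \<forall>a\<in>carrier R. \<forall>x\<in>carrier A. h (a \<odot>\<^bsub>A\<^esub> x) = a \<odot>\<^bsub>B\<^esub> h x}"

definition graded_alg_hom ::
  "('r, 'm) ring_scheme \<Rightarrow> ('r, 'a, 'k) module_scheme \<Rightarrow> (nat \<Rightarrow> 'a set) \<Rightarrow>
   ('r, 'b, 'l) module_scheme \<Rightarrow> (nat \<Rightarrow> 'b set) \<Rightarrow> ('a \<Rightarrow> 'b) set" where
  "graded_alg_hom R A G B H = {h \<in> alg_hom R A B. \<forall>i<2. h ` G i \<subseteq> H i}"

text \<open>The image of the base ring in an algebra.\<close>

definition scalars :: "('r, 'm) ring_scheme \<Rightarrow> ('r, 'a, 'k) module_scheme \<Rightarrow> 'a set" where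
  "scalars R A = (\<lambda>r. r \<odot>\<^bsub>A\<^esub> \<one>\<^bsub>A\<^esub>) ` carrier R"

text \<open>The ring \<open>A Quot I\<close> together with the induced scalar multiplication
  \<open>a \<odot> (I + x) = I + a \<odot> x\<close>.\<close>

definition alg_quot :: "('r, 'a, 'k) module_scheme \<Rightarrow> 'a set \<Rightarrow> ('r, 'a set) module" where
  "alg_quot A I = ring.extend (A Quot I) (module.fields (\<lambda>a C. \<Union>x\<in>C. I +>\<^bsub>A\<^esub> (a \<odot>\<^bsub>A\<^esub> x)))"


section \<open>The tensor algebra\<close>

text \<open>The free associative algebra on a set \<open>S\<close> of letters: finitely supported functions from
  words over \<open>S\<close> to \<open>R\<close>, multiplied by convolution over the splittings of a word.\<close>

definition free_algebra :: "('r, 'm) ring_scheme \<Rightarrow> 'v set \<Rightarrow> ('r, 'v list \<Rightarrow> 'r) module" where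
  "free_algebra R S =
     \<lparr>carrier = {f. (\<forall>w. f w \<in> carrier R) \<and> finite {w. f w \<noteq> \<zero>\<^bsub>R\<^esub>} \<and>
                    {w. f w \<noteq> \<zero>\<^bsub>R\<^esub>} \<subseteq> lists S},
      mult = (\<lambda>f g w. \<Oplus>\<^bsub>R\<^esub>k\<in>{..length w}. f (take k w) \<otimes>\<^bsub>R\<^esub> g (drop k w)),
      one = (\<lambda>w. if w = [] then \<one>\<^bsub>R\<^esub> else \<zero>\<^bsub>R\<^esub>),
      zero = (\<lambda>w. \<zero>\<^bsub>R\<^esub>),
      add = (\<lambda>f g w. f w \<oplus>\<^bsub>R\<^esub> g w),
      smult = (\<lambda>a f w. a \<otimes>\<^bsub>R\<^esub> f w)\<rparr>"

definition letter :: "('r, 'm) ring_scheme \<Rightarrow> 'v \<Rightarrow> 'v list \<Rightarrow> 'r" where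
  "letter R v = (\<lambda>w. if w = [v] then \<one>\<^bsub>R\<^esub> else \<zero>\<^bsub>R\<^esub>)"

text \<open>The tensor algebra is the free algebra on the elements of \<open>V\<close> modulo linearity of the letters.
  The two-sided ideal of these relations is spanned by the multilinearity relations between words
  of equal length, so the words of length \<open>n\<close> contribute exactly the \<open>n\<close>-th tensor power of \<open>V\<close>,
  presented by pure tensors \<open>[v1, ..., vn]\<close>.\<close>

definition linearity_ideal ::
  "('r, 'm) ring_scheme \<Rightarrow> ('r, 'v, 'n) module_scheme \<Rightarrow> ('v list \<Rightarrow> 'r) set" where
  "linearity_ideal R V =
     (let F = free_algebra R (carrier V) in
      Idl\<^bsub>F\<^esub> ({letter R (v \<oplus>\<^bsub>V\<^esub> w) \<ominus>\<^bsub>F\<^esub> (letter R v \<oplus>\<^bsub>F\<^esub> letter R w) | v w.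
                 v \<in> carrier V \<and> w \<in> carrier V} \<union>
              {letter R (a \<odot>\<^bsub>V\<^esub> v) \<ominus>\<^bsub>F\<^esub> (a \<odot>\<^bsub>F\<^esub> letter R v) | a v.
                 a \<in> carrier R \<and> v \<in> carrier V}))"

definition tensor_algebra ::
  "('r, 'm) ring_scheme \<Rightarrow> ('r, 'v, 'n) module_scheme \<Rightarrow> ('r, ('v list \<Rightarrow> 'r) set) module" where
  "tensor_algebra R V = alg_quot (free_algebra R (carrier V)) (linearity_ideal R V)"

definition tensor_incl ::
  "('r, 'm) ring_scheme \<Rightarrow> ('r, 'v, 'n) module_scheme \<Rightarrow> 'v \<Rightarrow> ('v list \<Rightarrow> 'r) set" where
  "tensor_incl R V v = linearity_ideal R V +>\<^bsub>free_algebra R (carrier V)\<^esub> letter R v"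

text \<open>The sum of the tensor powers of \<open>V\<close> in all degrees congruent to \<open>i\<close> modulo 2.\<close>

definition tensor_part ::
  "('r, 'm) ring_scheme \<Rightarrow> ('r, 'v, 'n) module_scheme \<Rightarrow> nat \<Rightarrow> ('v list \<Rightarrow> 'r) set set" where
  "tensor_part R V i =
     (let F = free_algebra R (carrier V) in
      (\<lambda>f. linearity_ideal R V +>\<^bsub>F\<^esub> f) `
        {f \<in> carrier F. \<forall>w. f w \<noteq> \<zero>\<^bsub>R\<^esub> \<longrightarrow> length w mod 2 = i})"


section \<open>The Clifford algebra\<close>

definition clifford_ideal ::
  "('r, 'm) ring_scheme \<Rightarrow> ('r, 'v, 'n) module_scheme \<Rightarrow> ('v \<Rightarrow> 'r) \<Rightarrow> ('v list \<Rightarrow> 'r) set set" where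
  "clifford_ideal R V q =
     (let T = tensor_algebra R V in
      Idl\<^bsub>T\<^esub> {(tensor_incl R V x \<otimes>\<^bsub>T\<^esub> tensor_incl R V x) \<ominus>\<^bsub>T\<^esub> (q x \<odot>\<^bsub>T\<^esub> \<one>\<^bsub>T\<^esub>) | x. x \<in> carrier V})"

definition clifford_algebra ::
  "('r, 'm) ring_scheme \<Rightarrow> ('r, 'v, 'n) module_scheme \<Rightarrow> ('v \<Rightarrow> 'r) \<Rightarrow>
   ('r, ('v list \<Rightarrow> 'r) set set) module" where
  "clifford_algebra R V q = alg_quot (tensor_algebra R V) (clifford_ideal R V q)"

definition clifford_part ::
  "('r, 'm) ring_scheme \<Rightarrow> ('r, 'v, 'n) module_scheme \<Rightarrow> ('v \<Rightarrow> 'r) \<Rightarrow> nat \<Rightarrow>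
   ('v list \<Rightarrow> 'r) set set set" where
  "clifford_part R V q i =
     (\<lambda>t. clifford_ideal R V q +>\<^bsub>tensor_algebra R V\<^esub> t) ` tensor_part R V i"

end

theory Submission
  imports Defs
begin

text \<open>For \<open>v \<in> V\<close> the supercommutator \<open>a \<mapsto> v a - (-1)\<^bsup>|a|\<^esup> a v\<close> on the Clifford algebra is contraction
with the linear form \<open>\<langle>v, \<cdot>\<rangle>\<close>: it lowers the degree by one. It also maps every two-sided ideal
\<open>K\<close>, when applied to homogeneous elements of \<open>K\<close>, back into \<open>K\<close>. So if \<open>K\<close> contained a homogeneous
element that is not zero, contracting it repeatedly would produce a nonzero element of \<open>K\<close> that is killed
by all of these contractions, and such an element is a scalar. A kernel that meets the scalars trivially
therefore contains no homogeneous element except zero, and the kernel of a graded homomorphism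
contains the homogeneous parts of its elements.

The point that needs care over a commutative ring is the claim that only scalars are killed by
all contractions with forms \<open>\<langle>v, \<cdot>\<rangle>\<close>, since non-degeneracy only makes \<open>V \<rightarrow> V\<^sup>*\<close> injective and the
forms \<open>\<langle>v, \<cdot>\<rangle>\<close> need not include the coordinate functions of a basis. The argument works with
functionals: for a linear form \<open>\<psi>\<close> on the Clifford algebra, let \<open>\<psi>\<^sub>f\<close> be \<open>\<psi>\<close> composed with the
contraction with \<open>f\<close>. If \<open>a\<close> is killed by all \<open>\<langle>v, \<cdot>\<rangle>\<close>, then with the coordinate functions \<open>b\<^sup>*\<close>
of a basis \<open>0 = \<psi>\<^bsub>\<langle>v,\<cdot>\<rangle>\<^esub>(a) = \<Sum>\<^sub>b \<langle>v, b\<rangle> \<psi>\<^bsub>b*\<^esub>(a) = \<langle>v, \<Sum>\<^sub>b \<psi>\<^bsub>b*\<^esub>(a) b\<rangle>\<close> for all \<open>v\<close>, so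
non-degeneracy gives \<open>\<psi>\<^bsub>b*\<^esub>(a) = 0\<close> for all \<open>b\<close> and \<open>\<psi>\<close> (\<open>scalar_if_supercommutators_vanish\<close>).
Writing \<open>a = a' + b a''\<close> with \<open>a', a''\<close> free of \<open>b\<close>, one has \<open>\<psi>\<^bsub>b*\<^esub>(a) = \<psi>(a'')\<close>; an induction over the
basis shows that \<open>a''\<close> is zero and that \<open>a\<close> is a scalar (\<open>scalar_if_contractions_vanish\<close>).

Linear forms on the Clifford algebra are handled as functions \<open>\<Phi>\<close> on words over \<open>V\<close> that are
multilinear and satisfy \<open>\<Phi>(u x x w) = q(x) \<Phi>(u w)\<close>. Contractions act on such functions by a
recursion over words, which avoids any discussion of well-definedness on a quotient. One functional
is needed to start with, namely one that takes the value 1 at the unit; it exists because \<open>V\<close> is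
free, so that \<open>q(x) = \<beta>(x, x)\<close> for some bilinear form \<open>\<beta>\<close>
(\<open>exists_normalized_clifford_functional\<close>). That every such \<open>\<Phi>\<close> descends to the Clifford algebra is
\<open>clifford_functional_descends\<close>.\<close>


section \<open>Linear spans and linear forms\<close>

inductive_set lin_span ::
  "('r, 'm) ring_scheme \<Rightarrow> ('r, 'v, 'n) module_scheme \<Rightarrow> 'v set \<Rightarrow> 'v set"
  for R M X where
  lin_span_zero: "\<zero>\<^bsub>M\<^esub> \<in> lin_span R M X"
| lin_span_step: "\<lbrakk>r \<in> carrier R; x \<in> X; s \<in> lin_span R M X\<rbrakk> \<Longrightarrow>
    (r \<odot>\<^bsub>M\<^esub> x) \<oplus>\<^bsub>M\<^esub> s \<in> lin_span R M X"

lemma lin_span_mono: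
  assumes "X \<subseteq> Y" shows "lin_span R M X \<subseteq> lin_span R M Y"
proof
  fix s assume "s \<in> lin_span R M X"
  then show "s \<in> lin_span R M Y"
    by induction (use assms in \<open>auto intro: lin_span.intros\<close>)
qed

definition linear_form ::
  "('r, 'm) ring_scheme \<Rightarrow> ('r, 'v, 'n) module_scheme \<Rightarrow> ('v \<Rightarrow> 'r) \<Rightarrow> bool" where
  "linear_form R M f \<longleftrightarrow> f \<in> carrier M \<rightarrow> carrier R \<and>
     (\<forall>x\<in>carrier M. \<forall>y\<in>carrier M. f (x \<oplus>\<^bsub>M\<^esub> y) = f x \<oplus>\<^bsub>R\<^esub> f y) \<and>
     (\<forall>a\<in>carrier R. \<forall>x\<in>carrier M. f (a \<odot>\<^bsub>M\<^esub> x) = a \<otimes>\<^bsub>R\<^esub> f x)"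

lemma linear_formD:
  assumes "linear_form R M f"
  shows "x \<in> carrier M \<Longrightarrow> f x \<in> carrier R"
    and "\<lbrakk>x \<in> carrier M; y \<in> carrier M\<rbrakk> \<Longrightarrow> f (x \<oplus>\<^bsub>M\<^esub> y) = f x \<oplus>\<^bsub>R\<^esub> f y"
    and "\<lbrakk>a \<in> carrier R; x \<in> carrier M\<rbrakk> \<Longrightarrow> f (a \<odot>\<^bsub>M\<^esub> x) = a \<otimes>\<^bsub>R\<^esub> f x"
  using assms unfolding linear_form_def by auto

context module
begin

lemma linear_form_zero:
  assumes "linear_form R M f" shows "f \<zero>\<^bsub>M\<^esub> = \<zero>"
  using linear_formD(3)[OF assms, of \<zero> "\<zero>\<^bsub>M\<^esub>"] linear_formD(1)[OF assms, of "\<zero>\<^bsub>M\<^esub>"]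
  by simp

lemma linear_form_uminus:
  assumes f: "linear_form R M f" and x: "x \<in> carrier M" shows "f (\<ominus>\<^bsub>M\<^esub> x) = \<ominus> f x"
proof -
  have "\<ominus>\<^bsub>M\<^esub> x = (\<ominus> \<one>) \<odot>\<^bsub>M\<^esub> x" using x by (simp add: smult_l_minus)
  then have "f (\<ominus>\<^bsub>M\<^esub> x) = (\<ominus> \<one>) \<otimes> f x" using x by (simp add: linear_formD[OF f])
  then show ?thesis using linear_formD(1)[OF f x] by (simp add: R.l_minus)
qed

lemma lin_span_subset:
  assumes "X \<subseteq> carrier M" shows "lin_span R M X \<subseteq> carrier M"
proof
  fix s assume "s \<in> lin_span R M X"
  then show "s \<in> carrier M"
    by induction (use assms in auto)
qed

lemma lin_span_add:
  assumes X: "X \<subseteq> carrier M" and s: "s \<in> lin_span R M X" and t: "t \<in> lin_span R M X"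
  shows "s \<oplus>\<^bsub>M\<^esub> t \<in> lin_span R M X"
  using s
proof induction
  case lin_span_zero
  then show ?case using t lin_span_subset[OF X] by auto
next
  case (lin_span_step r x s)
  then have "x \<in> carrier M" "s \<in> carrier M" "t \<in> carrier M"
    using X t lin_span_subset[OF X] by auto
  with lin_span_step show ?case
    by (auto simp: M.a_assoc intro: lin_span.lin_span_step)
qed

lemma lin_span_smult:
  assumes X: "X \<subseteq> carrier M" and s: "s \<in> lin_span R M X" and a: "a \<in> carrier R"
  shows "a \<odot>\<^bsub>M\<^esub> s \<in> lin_span R M X"
  using s
proof induction
  case lin_span_zero
  then show ?case using a by (auto intro: lin_span.lin_span_zero)
next
  case (lin_span_step r x s)
  then have "x \<in> carrier M" "s \<in> carrier M"
    using X lin_span_subset[OF X] by auto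
  with lin_span_step a show ?case
    by (auto simp: smult_r_distr smult_assoc1[symmetric] intro: lin_span.lin_span_step)
qed

lemma lin_span_incl:
  assumes X: "X \<subseteq> carrier M" and x: "x \<in> X"
  shows "x \<in> lin_span R M X"
proof -
  have "\<one> \<odot>\<^bsub>M\<^esub> x \<oplus>\<^bsub>M\<^esub> \<zero>\<^bsub>M\<^esub> \<in> lin_span R M X"
    using x by (intro lin_span.intros) auto
  then show ?thesis using X x by auto
qed

lemma lin_span_uminus:
  assumes X: "X \<subseteq> carrier M" and s: "s \<in> lin_span R M X"
  shows "\<ominus>\<^bsub>M\<^esub> s \<in> lin_span R M X"
proof -
  have "(\<ominus> \<one>) \<odot>\<^bsub>M\<^esub> s = \<ominus>\<^bsub>M\<^esub> s"
    using s lin_span_subset[OF X] by (auto simp: smult_l_minus)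
  then show ?thesis using lin_span_smult[OF X s, of "\<ominus> \<one>"] by simp
qed

text \<open>Everything about functionals on the free algebra and on the Clifford algebra is reduced to words by this principle.\<close>

lemma linear_forms_eq_on_span:
  assumes f: "linear_form R M f" and g: "linear_form R M g" and X: "X \<subseteq> carrier M"
    and eq: "\<And>x. x \<in> X \<Longrightarrow> f x = g x" and s: "s \<in> lin_span R M X"
  shows "f s = g s"
  using s
proof induction
  case lin_span_zero
  then show ?case using linear_form_zero[OF f] linear_form_zero[OF g] by simp
next
  case (lin_span_step r x s)
  then have "x \<in> carrier M" "s \<in> carrier M"
    using X lin_span_subset[OF X] by auto
  with lin_span_step show ?case
    by (simp add: linear_formD[OF f] linear_formD[OF g] eq)
qed

end

lemma lin_span_map:
  assumes M: "module R M" and N: "module R N"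
    and X: "X \<subseteq> carrier M" and Y: "Y \<subseteq> carrier N"
    and closed: "\<And>x. x \<in> carrier M \<Longrightarrow> h x \<in> carrier N"
    and add: "\<And>x y. \<lbrakk>x \<in> carrier M; y \<in> carrier M\<rbrakk> \<Longrightarrow> h (x \<oplus>\<^bsub>M\<^esub> y) = h x \<oplus>\<^bsub>N\<^esub> h y"
    and smult: "\<And>r x. \<lbrakk>r \<in> carrier R; x \<in> carrier M\<rbrakk> \<Longrightarrow> h (r \<odot>\<^bsub>M\<^esub> x) = r \<odot>\<^bsub>N\<^esub> h x"
    and img: "\<And>x. x \<in> X \<Longrightarrow> h x \<in> lin_span R N Y"
    and s: "s \<in> lin_span R M X"
  shows "h s \<in> lin_span R N Y"
  using s
proof induction
  interpret M: module R M by fact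
  interpret N: module R N by fact
  {
    case lin_span_zero
    have "h (\<zero>\<^bsub>R\<^esub> \<odot>\<^bsub>M\<^esub> \<zero>\<^bsub>M\<^esub>) = \<zero>\<^bsub>R\<^esub> \<odot>\<^bsub>N\<^esub> h \<zero>\<^bsub>M\<^esub>"
      by (rule smult) simp_all
    then show ?case by (simp add: closed lin_span.lin_span_zero)
  next
    case (lin_span_step r x s)
    have "x \<in> carrier M" "s \<in> carrier M"
      using lin_span_step X M.lin_span_subset[OF X] by auto
    then show ?case
      using lin_span_step Y img[of x]
      by (auto simp: add smult intro!: N.lin_span_add N.lin_span_smult)
  }
qed

lemma (in module) linear_form_finsum:
  assumes "finite S" and "\<And>b. b \<in> S \<Longrightarrow> g b \<in> carrier R" and "\<And>b. b \<in> S \<Longrightarrow> linear_form R M (\<psi> b)"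
  shows "linear_form R M (\<lambda>x. \<Oplus>b\<in>S. g b \<otimes> \<psi> b x)"
  using assms
proof (induction S rule: finite_induct)
  case empty
  then show ?case by (simp add: linear_form_def)
next
  case (insert b S)
  have IH: "linear_form R M (\<lambda>x. \<Oplus>b\<in>S. g b \<otimes> \<psi> b x)" using insert by auto
  have b: "linear_form R M (\<psi> b)" "g b \<in> carrier R" using insert by auto
  have eq: "(\<Oplus>b\<in>insert b S. g b \<otimes> \<psi> b x) = g b \<otimes> \<psi> b x \<oplus> (\<Oplus>b\<in>S. g b \<otimes> \<psi> b x)"
    if "x \<in> carrier M" for x
  proof (rule R.finsum_insert)
    have "g c \<otimes> \<psi> c x \<in> carrier R" if "c \<in> insert b S" for c
      using linear_formD(1)[OF insert.prems(2)[OF that] \<open>x \<in> carrier M\<close>] insert.prems(1)[OF that] by simp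
    then show "(\<lambda>b. g b \<otimes> \<psi> b x) \<in> S \<rightarrow> carrier R" "g b \<otimes> \<psi> b x \<in> carrier R" by auto
  qed (use insert in auto)
  show ?case
    unfolding linear_form_def
    using b
    by (auto simp: eq linear_formD[OF IH] linear_formD[OF b(1)] R.r_distr R.a_ac R.m_ac)
qed


section \<open>The free algebra\<close>

definition word_monomial :: "('r, 'm) ring_scheme \<Rightarrow> 'v list \<Rightarrow> 'v list \<Rightarrow> 'r" where
  "word_monomial R u = (\<lambda>w. if w = u then \<one>\<^bsub>R\<^esub> else \<zero>\<^bsub>R\<^esub>)"

text \<open>The product of the free algebra, isolated so that it can be studied by recursion over the word at which it is evaluated.\<close>

definition convolution ::
  "('r, 'm) ring_scheme \<Rightarrow> ('v list \<Rightarrow> 'r) \<Rightarrow> ('v list \<Rightarrow> 'r) \<Rightarrow> 'v list \<Rightarrow> 'r" where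
  "convolution R f g w = (\<Oplus>\<^bsub>R\<^esub>k\<in>{..length w}. f (take k w) \<otimes>\<^bsub>R\<^esub> g (drop k w))"

context cring
begin

lemma convolution_Nil:
  assumes "\<And>w. f w \<in> carrier R" "\<And>w. g w \<in> carrier R"
  shows "convolution R f g [] = f [] \<otimes> g []"
  unfolding convolution_def using assms by simp

text \<open>The recursion behind all properties of the product: splittings of \<open>x # w\<close> are the splitting
with empty left part and the splittings of \<open>w\<close> with \<open>x\<close> added on the left. It turns associativity
into an induction over words without reindexing double sums.\<close>

lemma convolution_Cons:
  assumes "\<And>w. f w \<in> carrier R" "\<And>w. g w \<in> carrier R"
  shows "convolution R f g (x # w) = f [] \<otimes> g (x # w) \<oplus> convolution R (\<lambda>w. f (x # w)) g w"
proof -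
  have "convolution R f g (x # w) =
      (\<Oplus>k\<in>{..length w}. f (take (Suc k) (x # w)) \<otimes> g (drop (Suc k) (x # w))) \<oplus>
      f (take 0 (x # w)) \<otimes> g (drop 0 (x # w))"
    unfolding convolution_def length_Cons using assms by (intro finsum_Suc2) auto
  moreover have "(\<Oplus>k\<in>{..length w}. f (x # take k w) \<otimes> g (drop k w)) \<in> carrier R"
    using assms by auto
  ultimately show ?thesis
    unfolding convolution_def using assms by (simp add: a_comm)
qed

lemma convolution_closed:
  assumes "\<And>w. f w \<in> carrier R" "\<And>w. g w \<in> carrier R"
  shows "convolution R f g w \<in> carrier R"
  unfolding convolution_def using assms by auto

lemma convolution_linear_left:
  assumes "\<And>w. f w \<in> carrier R" "\<And>w. g w \<in> carrier R" "\<And>w. h w \<in> carrier R"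
    "a \<in> carrier R"
  shows "convolution R (\<lambda>w. a \<otimes> f w \<oplus> g w) h w = a \<otimes> convolution R f h w \<oplus> convolution R g h w"
  using assms
proof (induction w arbitrary: f g)
  case Nil
  then show ?case by (simp add: convolution_Nil l_distr m_assoc)
next
  case (Cons x w)
  note [simp] = Cons.prems convolution_closed
  have "convolution R (\<lambda>w. a \<otimes> f w \<oplus> g w) h (x # w) =
      (a \<otimes> f [] \<oplus> g []) \<otimes> h (x # w) \<oplus>
      (a \<otimes> convolution R (\<lambda>w. f (x # w)) h w \<oplus> convolution R (\<lambda>w. g (x # w)) h w)"
    by (subst convolution_Cons) (simp_all add: Cons.IH)
  also have "\<dots> = a \<otimes> convolution R f h (x # w) \<oplus> convolution R g h (x # w)"
    by (simp add: convolution_Cons l_distr r_distr m_assoc a_ac)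
  finally show ?case .
qed

lemma convolution_linear_right:
  assumes "\<And>w. f w \<in> carrier R" "\<And>w. g w \<in> carrier R" "\<And>w. h w \<in> carrier R"
    "a \<in> carrier R"
  shows "convolution R h (\<lambda>w. a \<otimes> f w \<oplus> g w) w = a \<otimes> convolution R h f w \<oplus> convolution R h g w"
  using assms
proof (induction w arbitrary: h)
  case Nil
  then show ?case by (simp add: convolution_Nil r_distr m_lcomm)
next
  case (Cons x w)
  note [simp] = Cons.prems convolution_closed
  have "convolution R h (\<lambda>w. a \<otimes> f w \<oplus> g w) (x # w) =
      h [] \<otimes> (a \<otimes> f (x # w) \<oplus> g (x # w)) \<oplus>
      (a \<otimes> convolution R (\<lambda>w. h (x # w)) f w \<oplus> convolution R (\<lambda>w. h (x # w)) g w)"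
    by (subst convolution_Cons) (simp_all add: Cons.IH)
  also have "\<dots> = a \<otimes> convolution R h f (x # w) \<oplus> convolution R h g (x # w)"
    by (simp add: convolution_Cons r_distr m_lcomm a_ac)
  finally show ?case .
qed

lemma convolution_assoc:
  assumes "\<And>w. f w \<in> carrier R" "\<And>w. g w \<in> carrier R" "\<And>w. h w \<in> carrier R"
  shows "convolution R (convolution R f g) h w = convolution R f (convolution R g h) w"
  using assms
proof (induction w arbitrary: f)
  case Nil
  then show ?case by (simp add: convolution_Nil convolution_closed m_assoc)
next
  case (Cons x w)
  note [simp] = Cons.prems convolution_closed
  have "convolution R (convolution R f g) h (x # w) =
      f [] \<otimes> g [] \<otimes> h (x # w) \<oplus>
      convolution R (\<lambda>w. f [] \<otimes> g (x # w) \<oplus> convolution R (\<lambda>w. f (x # w)) g w) h w"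
    by (simp add: convolution_Cons convolution_Nil)
  also have "\<dots> = f [] \<otimes> g [] \<otimes> h (x # w) \<oplus>
      (f [] \<otimes> convolution R (\<lambda>w. g (x # w)) h w \<oplus>
       convolution R (\<lambda>w. f (x # w)) (convolution R g h) w)"
    by (simp add: convolution_linear_left Cons.IH)
  also have "\<dots> = convolution R f (convolution R g h) (x # w)"
    by (simp add: convolution_Cons[of f] convolution_Cons[of g] r_distr m_assoc a_assoc)
  finally show ?case .
qed

lemma convolution_word_monomial:
  assumes "\<And>w. g w \<in> carrier R"
  shows "convolution R (word_monomial R u) g w =
    (if take (length u) w = u then g (drop (length u) w) else \<zero>)"
  using assms
proof (induction w arbitrary: u)
  case Nil
  then show ?case by (auto simp: convolution_Nil word_monomial_def)
next
  case (Cons x w)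
  have zero: "convolution R (\<lambda>w. \<zero>) g w = \<zero>"
    unfolding convolution_def using Cons.prems by (simp add: add.finprod_one_eqI)
  have shift: "(\<lambda>w. word_monomial R u (x # w)) =
      (if u \<noteq> [] \<and> hd u = x then word_monomial R (tl u) else (\<lambda>w. \<zero>))"
    by (cases u) (auto simp: word_monomial_def)
  have "convolution R (word_monomial R u) g (x # w) =
      word_monomial R u [] \<otimes> g (x # w) \<oplus> convolution R (\<lambda>w. word_monomial R u (x # w)) g w"
    using Cons.prems by (intro convolution_Cons) (auto simp: word_monomial_def)
  also have "word_monomial R u [] = (if u = [] then \<one> else \<zero>)"
    by (auto simp: word_monomial_def)
  finally show ?case
    using Cons.prems zero unfolding shift by (cases u) (auto simp: Cons.IH)
qed

lemma free_algebra_simps: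
  "mult (free_algebra R S) = convolution R"
  "one (free_algebra R S) = word_monomial R []"
  "zero (free_algebra R S) = (\<lambda>w. \<zero>)"
  "add (free_algebra R S) = (\<lambda>f g w. f w \<oplus> g w)"
  "smult (free_algebra R S) = (\<lambda>a f w. a \<otimes> f w)"
  by (auto simp: free_algebra_def convolution_def[abs_def] word_monomial_def)

lemma free_algebra_carrier:
  "f \<in> carrier (free_algebra R S) \<longleftrightarrow>
     (\<forall>w. f w \<in> carrier R) \<and> finite {w. f w \<noteq> \<zero>} \<and> {w. f w \<noteq> \<zero>} \<subseteq> lists S"
  by (simp add: free_algebra_def)

lemma free_algebra_carrierI:
  assumes "\<And>w. f w \<in> carrier R" "{w. f w \<noteq> \<zero>} \<subseteq> B" "finite B" "B \<subseteq> lists S"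
  shows "f \<in> carrier (free_algebra R S)"
  unfolding free_algebra_carrier using assms finite_subset by blast

lemma word_monomial_carrier:
  "u \<in> lists S \<Longrightarrow> word_monomial R u \<in> carrier (free_algebra R S)"
  by (rule free_algebra_carrierI[where B = "{u}"]) (auto simp: word_monomial_def)

lemma free_algebra_assoc_algebra: "assoc_algebra R (free_algebra R S)"
proof -
  let ?F = "free_algebra R S"
  have mult_closed: "convolution R f g \<in> carrier ?F" if f: "f \<in> carrier ?F" and g: "g \<in> carrier ?F" for f g
  proof (rule free_algebra_carrierI)
    let ?B = "(\<lambda>(u, v). u @ v) ` ({w. f w \<noteq> \<zero>} \<times> {w. g w \<noteq> \<zero>})"
    show "finite ?B" using f g by (auto simp: free_algebra_carrier)
    have "{w. f w \<noteq> \<zero>} \<subseteq> lists S" "{w. g w \<noteq> \<zero>} \<subseteq> lists S"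
      using f g by (simp_all add: free_algebra_carrier)
    then show "?B \<subseteq> lists S" by force
    show "convolution R f g w \<in> carrier R" for w
      using f g by (auto simp: free_algebra_carrier intro: convolution_closed)
    show "{w. convolution R f g w \<noteq> \<zero>} \<subseteq> ?B"
    proof
      fix w assume w: "w \<in> {w. convolution R f g w \<noteq> \<zero>}"
      have "\<exists>k. f (take k w) \<noteq> \<zero> \<and> g (drop k w) \<noteq> \<zero>"
      proof (rule ccontr)
        assume "\<nexists>k. f (take k w) \<noteq> \<zero> \<and> g (drop k w) \<noteq> \<zero>"
        then have "f (take k w) \<otimes> g (drop k w) = \<zero>" for k
          using f g by (metis free_algebra_carrier l_null r_null)
        then have "convolution R f g w = \<zero>"
          unfolding convolution_def by (simp add: add.finprod_one_eqI)
        with w show False by simp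
      qed
      then obtain k where "f (take k w) \<noteq> \<zero>" "g (drop k w) \<noteq> \<zero>" by blast
      then show "w \<in> ?B" by (intro image_eqI[of _ _ "(take k w, drop k w)"]) auto
    qed
  qed
  have add_closed: "(\<lambda>w. f w \<oplus> g w) \<in> carrier ?F"
    if f: "f \<in> carrier ?F" and g: "g \<in> carrier ?F" for f g
    using f g by (intro free_algebra_carrierI[where B = "{w. f w \<noteq> \<zero>} \<union> {w. g w \<noteq> \<zero>}"])
      (auto simp: free_algebra_carrier)
  have smult_closed: "(\<lambda>w. a \<otimes> f w) \<in> carrier ?F"
    if "a \<in> carrier R" and f: "f \<in> carrier ?F" for a f
    using that by (intro free_algebra_carrierI[where B = "{w. f w \<noteq> \<zero>}"])
      (auto simp: free_algebra_carrier)
  note smps = free_algebra_simps free_algebra_carrier fun_eq_iff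
  have agr: "abelian_group ?F"
  proof (rule abelian_groupI)
    fix f assume f: "f \<in> carrier ?F"
    show "\<exists>y\<in>carrier ?F. y \<oplus>\<^bsub>?F\<^esub> f = \<zero>\<^bsub>?F\<^esub>"
    proof
      show "(\<lambda>w. \<ominus> \<one> \<otimes> f w) \<oplus>\<^bsub>?F\<^esub> f = \<zero>\<^bsub>?F\<^esub>"
        using f by (auto simp: smps l_minus l_neg)
      show "(\<lambda>w. \<ominus> \<one> \<otimes> f w) \<in> carrier ?F" by (rule smult_closed) (use f in auto)
    qed
  qed (use add_closed in \<open>auto simp: smps a_ac\<close>)
  have md: "module R ?F"
  proof (rule moduleI[OF is_cring agr])
  qed (use smult_closed in \<open>auto simp: smps l_distr r_distr m_assoc\<close>)
  have one_right: "convolution R f (word_monomial R []) w = f w" if "f \<in> carrier ?F" for f w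
    using that[THEN free_algebra_carrier[THEN iffD1], THEN conjunct1]
  proof (induction w arbitrary: f)
    case (Cons x w)
    have "convolution R f (word_monomial R []) (x # w) =
      f [] \<otimes> word_monomial R [] (x # w) \<oplus> convolution R (\<lambda>w. f (x # w)) (word_monomial R []) w"
      using Cons.prems by (intro convolution_Cons) (auto simp: word_monomial_def)
    then show ?case using Cons by (auto simp: word_monomial_def)
  qed (simp add: convolution_Nil word_monomial_def)
  have mon: "monoid ?F"
  proof (rule monoidI)
    fix x y z assume "x \<in> carrier ?F" "y \<in> carrier ?F" "z \<in> carrier ?F"
    then show "x \<otimes>\<^bsub>?F\<^esub> y \<otimes>\<^bsub>?F\<^esub> z = x \<otimes>\<^bsub>?F\<^esub> (y \<otimes>\<^bsub>?F\<^esub> z)"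
      by (auto simp: smps intro: convolution_assoc)
  next
    fix x assume "x \<in> carrier ?F"
    then show "\<one>\<^bsub>?F\<^esub> \<otimes>\<^bsub>?F\<^esub> x = x" "x \<otimes>\<^bsub>?F\<^esub> \<one>\<^bsub>?F\<^esub> = x"
      by (auto simp: smps one_right convolution_word_monomial)
  qed (simp_all add: free_algebra_simps mult_closed word_monomial_carrier)
  have rg: "ring ?F"
  proof (rule ringI[OF agr mon])
    fix x y z assume *: "x \<in> carrier ?F" "y \<in> carrier ?F" "z \<in> carrier ?F"
    show "(x \<oplus>\<^bsub>?F\<^esub> y) \<otimes>\<^bsub>?F\<^esub> z = x \<otimes>\<^bsub>?F\<^esub> z \<oplus>\<^bsub>?F\<^esub> y \<otimes>\<^bsub>?F\<^esub> z"
      using * convolution_linear_left[of x y z \<one>]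
      by (auto simp: smps convolution_closed)
    show "z \<otimes>\<^bsub>?F\<^esub> (x \<oplus>\<^bsub>?F\<^esub> y) = z \<otimes>\<^bsub>?F\<^esub> x \<oplus>\<^bsub>?F\<^esub> z \<otimes>\<^bsub>?F\<^esub> y"
      using * convolution_linear_right[of x y z \<one>]
      by (auto simp: smps convolution_closed)
  qed
  show ?thesis
  proof (intro assoc_algebra.intro md rg assoc_algebra_axioms.intro)
    fix a x y assume *: "a \<in> carrier R" "x \<in> carrier ?F" "y \<in> carrier ?F"
    have z: "convolution R (\<lambda>w. \<zero>) y w = \<zero>" "convolution R x (\<lambda>w. \<zero>) w = \<zero>" for w
      unfolding convolution_def using * by (simp_all add: add.finprod_one_eqI free_algebra_carrier)
    show "(a \<odot>\<^bsub>?F\<^esub> x) \<otimes>\<^bsub>?F\<^esub> y = a \<odot>\<^bsub>?F\<^esub> (x \<otimes>\<^bsub>?F\<^esub> y)"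
      using * convolution_linear_left[of x "\<lambda>w. \<zero>" y a] by (auto simp: smps z convolution_closed)
    show "x \<otimes>\<^bsub>?F\<^esub> (a \<odot>\<^bsub>?F\<^esub> y) = a \<odot>\<^bsub>?F\<^esub> (x \<otimes>\<^bsub>?F\<^esub> y)"
      using * convolution_linear_right[of y "\<lambda>w. \<zero>" x a] by (auto simp: smps z convolution_closed)
  qed
qed

lemma word_monomial_append:
  "word_monomial R u \<otimes>\<^bsub>free_algebra R S\<^esub> word_monomial R v = word_monomial R (u @ v)"
proof (rule ext)
  fix w
  have "take (length u) w = u \<and> drop (length u) w = v \<longleftrightarrow> w = u @ v"
    by (metis append_eq_conv_conj)
  then show "(word_monomial R u \<otimes>\<^bsub>free_algebra R S\<^esub> word_monomial R v) w = word_monomial R (u @ v) w"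
    by (auto simp: free_algebra_simps convolution_word_monomial word_monomial_def[of R v]
        word_monomial_def[of R "u @ v"])
qed

lemma free_algebra_spanned:
  assumes "f \<in> carrier (free_algebra R S)"
  shows "f \<in> lin_span R (free_algebra R S) (word_monomial R ` {w. f w \<noteq> \<zero>})"
proof -
  let ?F = "free_algebra R S"
  have "f \<in> lin_span R ?F (word_monomial R ` B)"
    if "finite B" "B \<subseteq> lists S" "{w. f w \<noteq> \<zero>} \<subseteq> B" "\<And>w. f w \<in> carrier R" for f B
    using that
  proof (induction B arbitrary: f rule: finite_induct)
    case empty
    then have "f = \<zero>\<^bsub>?F\<^esub>" by (auto simp: free_algebra_simps)
    then show ?case by (simp add: lin_span_zero)
  next
    case (insert u B)
    have "f(u := \<zero>) \<in> lin_span R ?F (word_monomial R ` B)"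
      using insert by (intro insert.IH) auto
    then have "f(u := \<zero>) \<in> lin_span R ?F (word_monomial R ` insert u B)"
      using lin_span_mono[of "word_monomial R ` B" "word_monomial R ` insert u B" R ?F] by blast
    then have "f u \<odot>\<^bsub>?F\<^esub> word_monomial R u \<oplus>\<^bsub>?F\<^esub> f(u := \<zero>) \<in>
        lin_span R ?F (word_monomial R ` insert u B)"
      using insert by (intro lin_span_step) auto
    also have "f u \<odot>\<^bsub>?F\<^esub> word_monomial R u \<oplus>\<^bsub>?F\<^esub> f(u := \<zero>) = f"
      using insert by (auto simp: free_algebra_simps word_monomial_def)
    finally show ?case .
  qed
  then show ?thesis using assms by (auto simp: free_algebra_carrier)
qed

end


section \<open>Quotient algebras\<close>

lemma alg_quot_simps:
  "carrier (alg_quot A I) = a_rcosets\<^bsub>A\<^esub> I"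
  "mult (alg_quot A I) = rcoset_mult A I"
  "one (alg_quot A I) = I +>\<^bsub>A\<^esub> \<one>\<^bsub>A\<^esub>"
  "zero (alg_quot A I) = I"
  "add (alg_quot A I) = set_add A"
  "smult (alg_quot A I) = (\<lambda>a C. \<Union>x\<in>C. I +>\<^bsub>A\<^esub> (a \<odot>\<^bsub>A\<^esub> x))"
  by (simp_all add: alg_quot_def FactRing_def ring.extend_def module.fields_def)

lemma alg_homD:
  assumes "h \<in> alg_hom R A B"
  shows "x \<in> carrier A \<Longrightarrow> h x \<in> carrier B"
    and "\<lbrakk>x \<in> carrier A; y \<in> carrier A\<rbrakk> \<Longrightarrow> h (x \<otimes>\<^bsub>A\<^esub> y) = h x \<otimes>\<^bsub>B\<^esub> h y"
    and "\<lbrakk>x \<in> carrier A; y \<in> carrier A\<rbrakk> \<Longrightarrow> h (x \<oplus>\<^bsub>A\<^esub> y) = h x \<oplus>\<^bsub>B\<^esub> h y"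
    and "h \<one>\<^bsub>A\<^esub> = \<one>\<^bsub>B\<^esub>"
    and "\<lbrakk>a \<in> carrier R; x \<in> carrier A\<rbrakk> \<Longrightarrow> h (a \<odot>\<^bsub>A\<^esub> x) = a \<odot>\<^bsub>B\<^esub> h x"
  using assms unfolding alg_hom_def ring_hom_def by auto

lemma alg_hom_zero:
  assumes "h \<in> alg_hom R A B" "module R A" "module R B"
  shows "h \<zero>\<^bsub>A\<^esub> = \<zero>\<^bsub>B\<^esub>"
proof -
  interpret A: module R A by fact
  interpret B: module R B by fact
  have "h \<zero>\<^bsub>A\<^esub> = h (\<zero>\<^bsub>R\<^esub> \<odot>\<^bsub>A\<^esub> \<zero>\<^bsub>A\<^esub>)" by simp
  also have "\<dots> = \<zero>\<^bsub>R\<^esub> \<odot>\<^bsub>B\<^esub> h \<zero>\<^bsub>A\<^esub>"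
    by (rule alg_homD(5)[OF assms(1)]) simp_all
  also have "\<dots> = \<zero>\<^bsub>B\<^esub>" using alg_homD(1)[OF assms(1)] by simp
  finally show ?thesis .
qed

lemma alg_hom_comp:
  assumes g: "g \<in> alg_hom R A B" and h: "h \<in> alg_hom R B C"
  shows "h \<circ> g \<in> alg_hom R A C"
  using alg_homD[OF g] alg_homD[OF h] unfolding alg_hom_def ring_hom_def by auto

lemma alg_hom_minus:
  assumes h: "h \<in> alg_hom R M N" and M: "module R M" and N: "module R N"
    and x: "x \<in> carrier M" and y: "y \<in> carrier M"
  shows "h (x \<ominus>\<^bsub>M\<^esub> y) = h x \<ominus>\<^bsub>N\<^esub> h y"
proof -
  interpret M: module R M by fact
  interpret N: module R N by fact
  have "\<ominus>\<^bsub>M\<^esub> y = (\<ominus>\<^bsub>R\<^esub> \<one>\<^bsub>R\<^esub>) \<odot>\<^bsub>M\<^esub> y" using y by (simp add: M.smult_l_minus)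
  then have "h (\<ominus>\<^bsub>M\<^esub> y) = (\<ominus>\<^bsub>R\<^esub> \<one>\<^bsub>R\<^esub>) \<odot>\<^bsub>N\<^esub> h y"
    using y by (simp add: alg_homD[OF h])
  then have "h (\<ominus>\<^bsub>M\<^esub> y) = \<ominus>\<^bsub>N\<^esub> h y"
    using y alg_homD(1)[OF h] by (simp add: N.smult_l_minus)
  then show ?thesis using x y by (simp add: a_minus_def alg_homD[OF h])
qed

lemma alg_hom_lin_span:
  assumes h: "h \<in> alg_hom R A B" and A: "module R A" and B: "module R B"
    and X: "X \<subseteq> carrier A" and s: "s \<in> lin_span R A X"
  shows "h s \<in> lin_span R B (h ` X)"
proof (rule lin_span_map[OF A B X _ alg_homD(1)[OF h] alg_homD(3)[OF h] alg_homD(5)[OF h] _ s])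
  show img: "h ` X \<subseteq> carrier B" using X alg_homD(1)[OF h] by blast
  show "h x \<in> lin_span R B (h ` X)" if "x \<in> X" for x
    using module.lin_span_incl[OF B img] that by blast
qed

lemma alg_hom_image_ideal:
  assumes h: "h \<in> alg_hom R A B" and A: "assoc_algebra R A" and B: "assoc_algebra R B"
    and surj: "h ` carrier A = carrier B" and K: "ideal K A"
  shows "ideal (h ` K) B"
proof -
  interpret A: assoc_algebra R A by fact
  interpret B: assoc_algebra R B by fact
  interpret K: ideal K A by fact
  note [simp] = alg_homD[OF h]
  show ?thesis
  proof (rule idealI[OF B.ring_axioms])
    show "subgroup (h ` K) (add_monoid B)"
    proof (rule B.add.subgroupI)
      show "h ` K \<subseteq> carrier B" using K.a_subset by auto
      show "h ` K \<noteq> {}" using K.zero_closed by blast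
      fix a assume "a \<in> h ` K"
      then obtain x where x: "x \<in> K" "a = h x" by blast
      have "h (\<ominus>\<^bsub>A\<^esub> x) \<oplus>\<^bsub>B\<^esub> h x = h (\<ominus>\<^bsub>A\<^esub> x \<oplus>\<^bsub>A\<^esub> x)" using x by simp
      also have "\<dots> = \<zero>\<^bsub>B\<^esub>"
        using x alg_hom_zero[OF h A.module_axioms B.module_axioms] by (simp add: A.M.l_neg)
      finally have "\<ominus>\<^bsub>B\<^esub> a = h (\<ominus>\<^bsub>A\<^esub> x)"
        using x by (simp add: B.minus_equality)
      then show "\<ominus>\<^bsub>B\<^esub> a \<in> h ` K" using x by auto
      fix b assume "b \<in> h ` K"
      then obtain y where y: "y \<in> K" "b = h y" by blast
      then have "a \<oplus>\<^bsub>B\<^esub> b = h (x \<oplus>\<^bsub>A\<^esub> y)" using x by simp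
      moreover have "x \<oplus>\<^bsub>A\<^esub> y \<in> K" using x y by simp
      ultimately show "a \<oplus>\<^bsub>B\<^esub> b \<in> h ` K" by (rule image_eqI)
    qed
    fix a b assume "a \<in> h ` K" "b \<in> carrier B"
    then obtain x y where "x \<in> K" "a = h x" "y \<in> carrier A" "b = h y" using surj by blast
    then have "b \<otimes>\<^bsub>B\<^esub> a = h (y \<otimes>\<^bsub>A\<^esub> x)" "a \<otimes>\<^bsub>B\<^esub> b = h (x \<otimes>\<^bsub>A\<^esub> y)"
      "y \<otimes>\<^bsub>A\<^esub> x \<in> K" "x \<otimes>\<^bsub>A\<^esub> y \<in> K"
      by (auto intro: K.I_l_closed K.I_r_closed)
    then show "b \<otimes>\<^bsub>B\<^esub> a \<in> h ` K" "a \<otimes>\<^bsub>B\<^esub> b \<in> h ` K" by auto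
  qed
qed

context assoc_algebra
begin

text \<open>Scalar multiplication on cosets is well defined because \<open>a \<odot> i = (a \<odot> \<one>) \<otimes> i\<close> lies in the ideal
with \<open>i\<close>. All algebra laws are then inherited along the projection.\<close>

lemma quotient_projection:
  assumes "ideal I A"
  shows alg_quot_assoc_algebra: "assoc_algebra R (alg_quot A I)"
    and alg_quot_proj_hom: "(\<lambda>x. I +>\<^bsub>A\<^esub> x) \<in> alg_hom R A (alg_quot A I)"
    and alg_quot_proj_surj: "(\<lambda>x. I +>\<^bsub>A\<^esub> x) ` carrier A = carrier (alg_quot A I)"
    and alg_quot_proj_kernel:
      "\<And>x. x \<in> carrier A \<Longrightarrow> I +>\<^bsub>A\<^esub> x = \<zero>\<^bsub>alg_quot A I\<^esub> \<longleftrightarrow> x \<in> I"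
proof -
  interpret I: ideal I A by fact
  let ?Q = "alg_quot A I" and ?p = "\<lambda>x. I +>\<^bsub>A\<^esub> x"
  show surj: "?p ` carrier A = carrier ?Q"
    by (auto simp: alg_quot_simps A_RCOSETS_def')
  show "\<And>x. x \<in> carrier A \<Longrightarrow> ?p x = \<zero>\<^bsub>?Q\<^esub> \<longleftrightarrow> x \<in> I"
    using I.a_rcos_const I.a_rcos_self by (auto simp: alg_quot_simps)
  have add: "?p x \<oplus>\<^bsub>?Q\<^esub> ?p y = ?p (x \<oplus>\<^bsub>A\<^esub> y)"
    if "x \<in> carrier A" "y \<in> carrier A" for x y
    using that by (simp add: alg_quot_simps I.a_rcos_sum)
  have mult: "?p x \<otimes>\<^bsub>?Q\<^esub> ?p y = ?p (x \<otimes>\<^bsub>A\<^esub> y)"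
    if "x \<in> carrier A" "y \<in> carrier A" for x y
    using that by (simp add: alg_quot_simps I.rcoset_mult_add)
  have smult: "a \<odot>\<^bsub>?Q\<^esub> ?p x = ?p (a \<odot>\<^bsub>A\<^esub> x)"
    if a: "a \<in> carrier R" and x: "x \<in> carrier A" for a x
  proof -
    have "?p (a \<odot>\<^bsub>A\<^esub> y) = ?p (a \<odot>\<^bsub>A\<^esub> x)" if y: "y \<in> ?p x" for y
    proof -
      obtain i where i: "i \<in> I" "y = i \<oplus>\<^bsub>A\<^esub> x"
        using y by (auto simp: a_r_coset_def')
      have ic: "i \<in> carrier A" using i by simp
      have "(a \<odot>\<^bsub>A\<^esub> \<one>\<^bsub>A\<^esub>) \<otimes>\<^bsub>A\<^esub> i \<in> I"
        using a i by (intro I.I_l_closed) auto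
      then have "a \<odot>\<^bsub>A\<^esub> i \<in> I"
        using a ic by (simp add: smult_mult_left)
      moreover have "a \<odot>\<^bsub>A\<^esub> y = a \<odot>\<^bsub>A\<^esub> i \<oplus>\<^bsub>A\<^esub> a \<odot>\<^bsub>A\<^esub> x"
        using i ic a x by (simp add: smult_r_distr)
      ultimately have "a \<odot>\<^bsub>A\<^esub> y \<in> ?p (a \<odot>\<^bsub>A\<^esub> x)"
        by (auto simp: a_r_coset_def')
      then show ?thesis
        using I.a_repr_independence' a x by (metis smult_closed)
    qed
    moreover have "x \<in> ?p x" using x I.a_rcos_self by simp
    ultimately have "(\<Union>y\<in>?p x. ?p (a \<odot>\<^bsub>A\<^esub> y)) = ?p (a \<odot>\<^bsub>A\<^esub> x)" by blast
    then show ?thesis by (simp only: alg_quot_simps)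
  qed
  have closed: "?p x \<in> carrier ?Q" if "x \<in> carrier A" for x
    using that surj by blast
  have one: "\<one>\<^bsub>?Q\<^esub> = ?p \<one>\<^bsub>A\<^esub>" by (simp add: alg_quot_simps)
  show "?p \<in> alg_hom R A ?Q"
    unfolding alg_hom_def using add mult smult closed one by (auto intro!: ring_hom_memI)
  have zero: "\<zero>\<^bsub>?Q\<^esub> = ?p \<zero>\<^bsub>A\<^esub>"
    using I.a_rcos_const[of "\<zero>\<^bsub>A\<^esub>"] by (simp add: alg_quot_simps)
  note simps = add mult smult one zero surj[symmetric]
  have agr: "abelian_group ?Q"
  proof (rule abelian_groupI)
    fix X assume "X \<in> carrier ?Q"
    then obtain x where x: "x \<in> carrier A" "X = ?p x" using surj by blast
    then show "\<exists>Y\<in>carrier ?Q. Y \<oplus>\<^bsub>?Q\<^esub> X = \<zero>\<^bsub>?Q\<^esub>"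
      by (intro bexI[of _ "?p (\<ominus>\<^bsub>A\<^esub> x)"]) (auto simp: simps M.l_neg)
  qed (auto simp: simps M.a_ac)
  have md: "module R ?Q"
    by (rule moduleI[OF R.is_cring agr])
      (auto simp: simps smult_l_distr smult_r_distr smult_assoc1)
  have rg: "ring ?Q"
    by (rule ringI[OF agr], rule monoidI)
      (auto simp: simps m_assoc l_distr r_distr)
  show "assoc_algebra R ?Q"
    by (intro assoc_algebra.intro md rg assoc_algebra_axioms.intro)
      (auto simp: simps smult_mult_left smult_mult_right)
qed

end


section \<open>Clifford functionals and their contractions\<close>

text \<open>The transpose of the contraction
\<open>v\<^sub>1 \<cdots> v\<^sub>n \<mapsto> \<Sum>\<^sub>k (-1)\<^bsup>k-1\<^esup> f(v\<^sub>k) v\<^sub>1 \<cdots> v\<^bsub>k-1\<^esub> v\<^bsub>k+1\<^esub> \<cdots> v\<^sub>n\<close> on words, acting on functions of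
words. The first letter is either contracted or moved past with a sign.\<close>

primrec contract ::
  "('r, 'm) ring_scheme \<Rightarrow> ('v \<Rightarrow> 'r) \<Rightarrow> ('v list \<Rightarrow> 'r) \<Rightarrow> 'v list \<Rightarrow> 'r" where
  "contract R f \<Phi> [] = \<zero>\<^bsub>R\<^esub>"
| "contract R f \<Phi> (v # w) = f v \<otimes>\<^bsub>R\<^esub> \<Phi> w \<ominus>\<^bsub>R\<^esub> contract R f (\<lambda>u. \<Phi> (v # u)) w"

text \<open>Contraction reads a functional only at shorter words. This is what makes the recursive definition of the vacuum functional below terminate.\<close>

lemma contract_cong [fundef_cong]:
  assumes "w = w'" "\<And>u. length u < length w' \<Longrightarrow> \<Phi> u = \<Psi> u" "f = g"
  shows "contract R f \<Phi> w = contract R g \<Psi> w'"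
proof -
  have "contract R f \<Phi> w = contract R f \<Psi> w" if "\<And>u. length u < length w \<Longrightarrow> \<Phi> u = \<Psi> u" for w
    using that
  proof (induction w arbitrary: \<Phi> \<Psi>)
    case (Cons v w)
    have "contract R f (\<lambda>u. \<Phi> (v # u)) w = contract R f (\<lambda>u. \<Psi> (v # u)) w"
      using Cons.prems by (intro Cons.IH) simp
    then show ?case using Cons.prems by simp
  qed simp
  then show ?thesis using assms by simp
qed

context quadratic_space
begin

abbreviation words :: "'c list set" where
  "words \<equiv> lists (carrier V)"

definition word_functional :: "('c list \<Rightarrow> 'a) \<Rightarrow> bool" where
  "word_functional \<Phi> \<longleftrightarrow> (\<forall>w\<in>words. \<Phi> w \<in> carrier R)"

text \<open>Multilinearity and the Clifford relation, imposed on the first letters of a word only. Prefixing an arbitrary word \<open>u\<close> moves these conditions to an arbitrary position.\<close>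

definition clifford_at_front :: "('c list \<Rightarrow> 'a) \<Rightarrow> bool" where
  "clifford_at_front \<Phi> \<longleftrightarrow> word_functional \<Phi> \<and>
     (\<forall>x\<in>carrier V. \<forall>y\<in>carrier V. \<forall>w\<in>words. \<Phi> ((x \<oplus>\<^bsub>V\<^esub> y) # w) = \<Phi> (x # w) \<oplus> \<Phi> (y # w)) \<and>
     (\<forall>a\<in>carrier R. \<forall>x\<in>carrier V. \<forall>w\<in>words. \<Phi> ((a \<odot>\<^bsub>V\<^esub> x) # w) = a \<otimes> \<Phi> (x # w)) \<and>
     (\<forall>x\<in>carrier V. \<forall>w\<in>words. \<Phi> (x # x # w) = q x \<otimes> \<Phi> w)"

text \<open>The conditions at positions up to \<open>n\<close>. The bound is needed for the vacuum functional, whose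
conditions at one position are derived from those at earlier positions.\<close>

definition clifford_upto :: "nat \<Rightarrow> ('c list \<Rightarrow> 'a) \<Rightarrow> bool" where
  "clifford_upto n \<Phi> \<longleftrightarrow> (\<forall>u\<in>words. length u \<le> n \<longrightarrow> clifford_at_front (\<lambda>w. \<Phi> (u @ w)))"

text \<open>The linear forms on the Clifford algebra, seen through their values on products of vectors.\<close>

definition clifford_functional :: "('c list \<Rightarrow> 'a) \<Rightarrow> bool" where
  "clifford_functional \<Phi> \<longleftrightarrow> (\<forall>u\<in>words. clifford_at_front (\<lambda>w. \<Phi> (u @ w)))"

abbreviation polar :: "'c \<Rightarrow> 'c \<Rightarrow> 'a" where
  "polar \<equiv> polar_form R V q"

lemma q_closed [simp]: "x \<in> carrier V \<Longrightarrow> q x \<in> carrier R"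
  using quadratic_form unfolding quadratic_form_def by auto

lemma q_smult: "\<lbrakk>a \<in> carrier R; x \<in> carrier V\<rbrakk> \<Longrightarrow> q (a \<odot>\<^bsub>V\<^esub> x) = a \<otimes> a \<otimes> q x"
  using quadratic_form unfolding quadratic_form_def by auto

lemma polar_bilinear: "bilinear_form R V polar"
  using quadratic_form unfolding quadratic_form_def by auto

lemma polar_linear_right: "x \<in> carrier V \<Longrightarrow> linear_form R V (polar x)"
  using polar_bilinear unfolding bilinear_form_def linear_form_def by auto

lemma polar_commute:
  "\<lbrakk>x \<in> carrier V; y \<in> carrier V\<rbrakk> \<Longrightarrow> polar x y = polar y x"
  unfolding polar_form_def by (simp add: M.a_comm a_minus_def R.a_ac)

lemma polar_linear_left: "y \<in> carrier V \<Longrightarrow> linear_form R V (\<lambda>x. polar x y)"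
  using polar_bilinear unfolding bilinear_form_def linear_form_def by auto

lemma polar_closed [simp]: "\<lbrakk>x \<in> carrier V; y \<in> carrier V\<rbrakk> \<Longrightarrow> polar x y \<in> carrier R"
  using linear_formD(1)[OF polar_linear_right] .

lemma q_add:
  assumes "x \<in> carrier V" "y \<in> carrier V"
  shows "q (x \<oplus>\<^bsub>V\<^esub> y) = q x \<oplus> q y \<oplus> polar x y"
proof -
  have "q (x \<oplus>\<^bsub>V\<^esub> y) \<in> carrier R" "q x \<in> carrier R" "q y \<in> carrier R" using assms by auto
  then show ?thesis unfolding polar_form_def by algebra
qed

lemma q_zero: "q \<zero>\<^bsub>V\<^esub> = \<zero>"
  using q_smult[of \<zero> "\<zero>\<^bsub>V\<^esub>"] by simp

lemma word_functionalD: "\<lbrakk>word_functional \<Phi>; w \<in> words\<rbrakk> \<Longrightarrow> \<Phi> w \<in> carrier R"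
  unfolding word_functional_def by blast

lemma word_functional_Cons:
  "\<lbrakk>word_functional \<Phi>; x \<in> carrier V\<rbrakk> \<Longrightarrow> word_functional (\<lambda>w. \<Phi> (x # w))"
  unfolding word_functional_def by auto

lemma contract_closed:
  assumes "linear_form R V f" "word_functional \<Phi>" "w \<in> words"
  shows "contract R f \<Phi> w \<in> carrier R"
  using assms(3,2)
proof (induction w arbitrary: \<Phi> rule: lists.induct)
  case (Cons v w)
  then show ?case
    using assms(1) by (auto simp: word_functionalD word_functional_Cons linear_formD)
qed simp

lemma word_functional_contract:
  "\<lbrakk>linear_form R V f; word_functional \<Phi>\<rbrakk> \<Longrightarrow> word_functional (contract R f \<Phi>)"
  using contract_closed unfolding word_functional_def by blast

lemma contract_congr:
  assumes "w \<in> words" "\<And>u. u \<in> words \<Longrightarrow> \<Phi> u = \<Psi> u" "\<And>x. x \<in> carrier V \<Longrightarrow> f x = g x"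
  shows "contract R f \<Phi> w = contract R g \<Psi> w"
  using assms(1,2)
proof (induction w arbitrary: \<Phi> \<Psi> rule: lists.induct)
  case (Cons v w)
  have "contract R f (\<lambda>u. \<Phi> (v # u)) w = contract R g (\<lambda>u. \<Psi> (v # u)) w"
    using Cons.hyps Cons.prems by (intro Cons.IH) auto
  then show ?case using Cons assms(3) by simp
qed simp

lemma contract_linear:
  assumes f: "linear_form R V f" and w: "w \<in> words" and a: "a \<in> carrier R"
    and "word_functional \<Phi>" "word_functional \<Psi>"
  shows "contract R f (\<lambda>u. a \<otimes> \<Phi> u \<oplus> \<Psi> u) w = a \<otimes> contract R f \<Phi> w \<oplus> contract R f \<Psi> w"
  using w assms(4,5)
proof (induction w arbitrary: \<Phi> \<Psi> rule: lists.induct)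
  case Nil
  then show ?case using a by simp
next
  case (Cons v w)
  have "f v \<in> carrier R" "\<Phi> w \<in> carrier R" "\<Psi> w \<in> carrier R"
    "contract R f (\<lambda>u. \<Phi> (v # u)) w \<in> carrier R" "contract R f (\<lambda>u. \<Psi> (v # u)) w \<in> carrier R"
    using Cons f by (auto simp: word_functionalD word_functional_Cons linear_formD contract_closed)
  moreover have "contract R f (\<lambda>u. a \<otimes> \<Phi> (v # u) \<oplus> \<Psi> (v # u)) w =
      a \<otimes> contract R f (\<lambda>u. \<Phi> (v # u)) w \<oplus> contract R f (\<lambda>u. \<Psi> (v # u)) w"
    using Cons by (intro Cons.IH word_functional_Cons)
  moreover have "b \<otimes> (a \<otimes> p \<oplus> s) \<ominus> (a \<otimes> c \<oplus> d) = a \<otimes> (b \<otimes> p \<ominus> c) \<oplus> (b \<otimes> s \<ominus> d)"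
    if "b \<in> carrier R" "p \<in> carrier R" "s \<in> carrier R" "c \<in> carrier R" "d \<in> carrier R"
    for b p s c d
    using that a by algebra
  ultimately show ?case
    unfolding contract.simps by simp
qed

lemma contract_linear_in_form:
  assumes f: "linear_form R V f" and g: "linear_form R V g" and a: "a \<in> carrier R"
    and w: "w \<in> words" and "word_functional \<Phi>"
  shows "contract R (\<lambda>v. a \<otimes> f v \<oplus> g v) \<Phi> w = a \<otimes> contract R f \<Phi> w \<oplus> contract R g \<Phi> w"
  using w assms(5)
proof (induction w arbitrary: \<Phi> rule: lists.induct)
  case Nil
  then show ?case using a by simp
next
  case (Cons v w)
  have "f v \<in> carrier R" "g v \<in> carrier R" "\<Phi> w \<in> carrier R"
    "contract R f (\<lambda>u. \<Phi> (v # u)) w \<in> carrier R" "contract R g (\<lambda>u. \<Phi> (v # u)) w \<in> carrier R"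
    using Cons f g by (auto simp: word_functionalD word_functional_Cons linear_formD contract_closed)
  moreover have "contract R (\<lambda>v. a \<otimes> f v \<oplus> g v) (\<lambda>u. \<Phi> (v # u)) w =
      a \<otimes> contract R f (\<lambda>u. \<Phi> (v # u)) w \<oplus> contract R g (\<lambda>u. \<Phi> (v # u)) w"
    using Cons by (intro Cons.IH word_functional_Cons)
  moreover have "(a \<otimes> b \<oplus> b') \<otimes> p \<ominus> (a \<otimes> c \<oplus> d) = a \<otimes> (b \<otimes> p \<ominus> c) \<oplus> (b' \<otimes> p \<ominus> d)"
    if "b \<in> carrier R" "b' \<in> carrier R" "p \<in> carrier R" "c \<in> carrier R" "d \<in> carrier R"
    for b b' p c d
    using that a by algebra
  ultimately show ?case
    unfolding contract.simps by simp
qed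

lemma contract_smult:
  assumes "linear_form R V f" "w \<in> words" "a \<in> carrier R" "word_functional \<Phi>"
  shows "contract R f (\<lambda>u. a \<otimes> \<Phi> u) w = a \<otimes> contract R f \<Phi> w"
proof -
  have wf0: "word_functional (\<lambda>_. \<zero>)" by (simp add: word_functional_def)
  have "contract R f (\<lambda>u. a \<otimes> \<Phi> u) w = contract R f (\<lambda>u. a \<otimes> \<Phi> u \<oplus> \<zero>) w"
    using assms by (intro contract_congr) (auto simp: word_functionalD)
  also have "\<dots> = a \<otimes> contract R f \<Phi> w \<oplus> contract R f (\<lambda>_. \<zero>) w"
    using assms wf0 by (intro contract_linear)
  also have "contract R f (\<lambda>_. \<zero>) w = \<zero>"
    using assms(2) by (induction rule: lists.induct) (use assms(1) in \<open>auto simp: linear_formD a_minus_def\<close>)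
  finally show ?thesis using assms contract_closed by simp
qed

lemma contract_add:
  assumes "linear_form R V f" "w \<in> words" "word_functional \<Phi>" "word_functional \<Psi>"
  shows "contract R f (\<lambda>u. \<Phi> u \<oplus> \<Psi> u) w = contract R f \<Phi> w \<oplus> contract R f \<Psi> w"
proof -
  have "contract R f (\<lambda>u. \<Phi> u \<oplus> \<Psi> u) w = contract R f (\<lambda>u. \<one> \<otimes> \<Phi> u \<oplus> \<Psi> u) w"
    using assms by (intro contract_congr) (auto simp: word_functionalD)
  also have "\<dots> = contract R f \<Phi> w \<oplus> contract R f \<Psi> w"
    using assms contract_linear[of f w \<one> \<Phi> \<Psi>] by (simp add: contract_closed)
  finally show ?thesis .
qed

lemma contract_minus:
  assumes "linear_form R V f" "w \<in> words" "word_functional \<Phi>" "word_functional \<Psi>" "a \<in> carrier R"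
  shows "contract R f (\<lambda>u. a \<otimes> \<Phi> u \<ominus> \<Psi> u) w = a \<otimes> contract R f \<Phi> w \<ominus> contract R f \<Psi> w"
proof -
  have wf: "word_functional (\<lambda>u. a \<otimes> \<Phi> u)"
    using assms unfolding word_functional_def by auto
  have eq: "(\<ominus> \<one>) \<otimes> s \<oplus> t = t \<ominus> s" if "s \<in> carrier R" "t \<in> carrier R" for s t
    using that by algebra
  have "contract R f (\<lambda>u. a \<otimes> \<Phi> u \<ominus> \<Psi> u) w = contract R f (\<lambda>u. (\<ominus> \<one>) \<otimes> \<Psi> u \<oplus> a \<otimes> \<Phi> u) w"
    using assms by (intro contract_congr) (auto simp: eq word_functionalD)
  also have "\<dots> = (\<ominus> \<one>) \<otimes> contract R f \<Psi> w \<oplus> contract R f (\<lambda>u. a \<otimes> \<Phi> u) w"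
    using assms wf by (intro contract_linear) auto
  finally show ?thesis using assms by (simp add: eq contract_smult contract_closed)
qed

text \<open>Contractions with one form square to zero, since the two ways to remove a given pair of letters come with opposite signs. This gives the Clifford relation for the vacuum functional.\<close>

lemma contract_twice:
  assumes f: "linear_form R V f" and w: "w \<in> words" and "word_functional \<Phi>"
  shows "contract R f (contract R f \<Phi>) w = \<zero>"
  using w assms(3)
proof (induction w arbitrary: \<Phi> rule: lists.induct)
  case (Cons v w)
  have "f v \<in> carrier R" "contract R f \<Phi> w \<in> carrier R"
    using Cons f by (auto simp: linear_formD contract_closed)
  moreover have "contract R f (\<lambda>u. contract R f \<Phi> (v # u)) w =
      f v \<otimes> contract R f \<Phi> w \<ominus> contract R f (contract R f (\<lambda>u. \<Phi> (v # u))) w"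
    unfolding contract.simps using Cons f
    by (intro contract_minus) (auto intro: word_functional_contract word_functional_Cons linear_formD)
  moreover have "contract R f (contract R f (\<lambda>u. \<Phi> (v # u))) w = \<zero>"
    using Cons by (intro Cons.IH word_functional_Cons)
  ultimately show ?case
    by (simp add: a_minus_def R.r_neg)
qed simp

lemma clifford_at_frontD:
  assumes "clifford_at_front \<Phi>"
  shows "word_functional \<Phi>"
    and "\<lbrakk>x \<in> carrier V; y \<in> carrier V; w \<in> words\<rbrakk> \<Longrightarrow>
      \<Phi> ((x \<oplus>\<^bsub>V\<^esub> y) # w) = \<Phi> (x # w) \<oplus> \<Phi> (y # w)"
    and "\<lbrakk>a \<in> carrier R; x \<in> carrier V; w \<in> words\<rbrakk> \<Longrightarrow> \<Phi> ((a \<odot>\<^bsub>V\<^esub> x) # w) = a \<otimes> \<Phi> (x # w)"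
    and "\<lbrakk>x \<in> carrier V; w \<in> words\<rbrakk> \<Longrightarrow> \<Phi> (x # x # w) = q x \<otimes> \<Phi> w"
  using assms unfolding clifford_at_front_def by auto

lemma clifford_at_front_minus:
  assumes \<Phi>: "clifford_at_front \<Phi>" and \<Psi>: "clifford_at_front \<Psi>" and a: "a \<in> carrier R"
  shows "clifford_at_front (\<lambda>w. a \<otimes> \<Phi> w \<ominus> \<Psi> w)"
  unfolding clifford_at_front_def
proof (intro conjI ballI)
  note [simp] = clifford_at_frontD[OF \<Phi>] clifford_at_frontD[OF \<Psi>]
    word_functionalD[OF clifford_at_frontD(1)[OF \<Phi>]] word_functionalD[OF clifford_at_frontD(1)[OF \<Psi>]]
  show "word_functional (\<lambda>w. a \<otimes> \<Phi> w \<ominus> \<Psi> w)"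
    using a by (auto simp: word_functional_def)
  fix x w assume *: "x \<in> carrier V" "w \<in> words"
  have c: "\<Phi> (x # w) \<in> carrier R" "\<Psi> (x # w) \<in> carrier R" "\<Phi> w \<in> carrier R" "\<Psi> w \<in> carrier R"
    "q x \<in> carrier R"
    using * by simp_all
  show "a \<otimes> \<Phi> (x # x # w) \<ominus> \<Psi> (x # x # w) = q x \<otimes> (a \<otimes> \<Phi> w \<ominus> \<Psi> w)"
    using * a c clifford_at_frontD(4)[OF \<Phi> *] clifford_at_frontD(4)[OF \<Psi> *] by algebra
  fix b assume b: "b \<in> carrier R"
  show "a \<otimes> \<Phi> ((b \<odot>\<^bsub>V\<^esub> x) # w) \<ominus> \<Psi> ((b \<odot>\<^bsub>V\<^esub> x) # w) = b \<otimes> (a \<otimes> \<Phi> (x # w) \<ominus> \<Psi> (x # w))"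
    using a b c clifford_at_frontD(3)[OF \<Phi> b *] clifford_at_frontD(3)[OF \<Psi> b *] by algebra
next
  fix x y w assume *: "x \<in> carrier V" "y \<in> carrier V" "w \<in> words"
  have c: "\<Phi> (x # w) \<in> carrier R" "\<Psi> (x # w) \<in> carrier R" "\<Phi> (y # w) \<in> carrier R" "\<Psi> (y # w) \<in> carrier R"
    using * clifford_at_frontD(1)[OF \<Phi>] clifford_at_frontD(1)[OF \<Psi>] by (auto simp: word_functional_def)
  show "a \<otimes> \<Phi> ((x \<oplus>\<^bsub>V\<^esub> y) # w) \<ominus> \<Psi> ((x \<oplus>\<^bsub>V\<^esub> y) # w) =
      (a \<otimes> \<Phi> (x # w) \<ominus> \<Psi> (x # w)) \<oplus> (a \<otimes> \<Phi> (y # w) \<ominus> \<Psi> (y # w))"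
    using a c clifford_at_frontD(2)[OF \<Phi> *] clifford_at_frontD(2)[OF \<Psi> *] by algebra
qed

text \<open>In \<open>\<Phi>(x x w)\<close> the contractions of the first and of the second \<open>x\<close> cancel, so that only letters of
\<open>w\<close> are contracted and the factor \<open>q x\<close> comes out.\<close>

lemma clifford_at_front_contract:
  assumes f: "linear_form R V f" and \<Phi>: "clifford_at_front \<Phi>"
  shows "clifford_at_front (contract R f \<Phi>)"
  unfolding clifford_at_front_def
proof (intro conjI ballI)
  note wf = clifford_at_frontD(1)[OF \<Phi>]
  show "word_functional (contract R f \<Phi>)" using f wf by (rule word_functional_contract)
  note wfC = word_functional_Cons[OF wf]
  fix x w assume *: "x \<in> carrier V" "w \<in> words"
  have c: "f x \<in> carrier R" "\<Phi> w \<in> carrier R" "\<Phi> (x # w) \<in> carrier R"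
    "contract R f (\<lambda>u. \<Phi> (x # u)) w \<in> carrier R" "contract R f \<Phi> w \<in> carrier R" "q x \<in> carrier R"
    using * f wf wfC by (auto simp: word_functional_def linear_formD contract_closed)
  have "contract R f (\<lambda>u. \<Phi> (x # x # u)) w = contract R f (\<lambda>u. q x \<otimes> \<Phi> u) w"
    using * by (intro contract_congr) (auto simp: clifford_at_frontD(4)[OF \<Phi>])
  also have "\<dots> = q x \<otimes> contract R f \<Phi> w"
    using * f wf by (intro contract_smult) auto
  finally show "contract R f \<Phi> (x # x # w) = q x \<otimes> contract R f \<Phi> w"
    unfolding contract.simps using c by algebra
  fix a assume a: "a \<in> carrier R"
  have "contract R f (\<lambda>u. \<Phi> ((a \<odot>\<^bsub>V\<^esub> x) # u)) w = contract R f (\<lambda>u. a \<otimes> \<Phi> (x # u)) w"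
    using * a by (intro contract_congr) (auto simp: clifford_at_frontD(3)[OF \<Phi>])
  also have "\<dots> = a \<otimes> contract R f (\<lambda>u. \<Phi> (x # u)) w"
    using * a f wfC by (intro contract_smult) auto
  finally have eq: "contract R f (\<lambda>u. \<Phi> ((a \<odot>\<^bsub>V\<^esub> x) # u)) w = a \<otimes> contract R f (\<lambda>u. \<Phi> (x # u)) w" .
  have "a \<otimes> b \<otimes> p \<ominus> a \<otimes> d = a \<otimes> (b \<otimes> p \<ominus> d)"
    if "b \<in> carrier R" "p \<in> carrier R" "d \<in> carrier R" for b p d
    using that a by algebra
  then show "contract R f \<Phi> ((a \<odot>\<^bsub>V\<^esub> x) # w) = a \<otimes> contract R f \<Phi> (x # w)"
    unfolding contract.simps linear_formD(3)[OF f a *(1)] eq using c by simp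
next
  note wf = clifford_at_frontD(1)[OF \<Phi>]
  note wfC = word_functional_Cons[OF wf]
  fix x y w assume *: "x \<in> carrier V" "y \<in> carrier V" "w \<in> words"
  have c: "f x \<in> carrier R" "\<Phi> w \<in> carrier R" "contract R f (\<lambda>u. \<Phi> (x # u)) w \<in> carrier R"
    "f y \<in> carrier R" "contract R f (\<lambda>u. \<Phi> (y # u)) w \<in> carrier R"
    using * f wf wfC by (auto simp: word_functional_def linear_formD contract_closed)
  have "contract R f (\<lambda>u. \<Phi> ((x \<oplus>\<^bsub>V\<^esub> y) # u)) w = contract R f (\<lambda>u. \<Phi> (x # u) \<oplus> \<Phi> (y # u)) w"
    using * by (intro contract_congr) (auto simp: clifford_at_frontD(2)[OF \<Phi>])
  also have "\<dots> = contract R f (\<lambda>u. \<Phi> (x # u)) w \<oplus> contract R f (\<lambda>u. \<Phi> (y # u)) w"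
    using * f wfC by (intro contract_add) auto
  finally have eq: "contract R f (\<lambda>u. \<Phi> ((x \<oplus>\<^bsub>V\<^esub> y) # u)) w =
      contract R f (\<lambda>u. \<Phi> (x # u)) w \<oplus> contract R f (\<lambda>u. \<Phi> (y # u)) w" .
  have "(a \<oplus> b) \<otimes> p \<ominus> (d \<oplus> e) = (a \<otimes> p \<ominus> d) \<oplus> (b \<otimes> p \<ominus> e)"
    if "a \<in> carrier R" "b \<in> carrier R" "p \<in> carrier R" "d \<in> carrier R" "e \<in> carrier R"
    for a b p d e
    using that by algebra
  then show "contract R f \<Phi> ((x \<oplus>\<^bsub>V\<^esub> y) # w) = contract R f \<Phi> (x # w) \<oplus> contract R f \<Phi> (y # w)"
    unfolding contract.simps linear_formD(2)[OF f *(1,2)] eq using c by simp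
qed

text \<open>Contraction does not disturb the conditions at position \<open>u\<close>: peeling off a letter of \<open>u\<close> leaves
a multiple of \<open>\<Phi>\<close> at a shorter prefix and a contraction to which the induction hypothesis applies.\<close>

lemma clifford_upto_contract:
  assumes f: "linear_form R V f" and "clifford_upto n \<Phi>"
  shows "clifford_upto n (contract R f \<Phi>)"
proof -
  have "clifford_at_front (\<lambda>w. contract R f \<Phi> (u @ w))"
    if "u \<in> words" "length u \<le> n" "clifford_upto n \<Phi>" for u n \<Phi>
    using that
  proof (induction u arbitrary: n \<Phi> rule: lists.induct)
    case Nil
    from Nil(2)[unfolded clifford_upto_def, rule_format, of "[]"] have "clifford_at_front \<Phi>"
      by simp
    then show ?case using f by (simp add: clifford_at_front_contract)
  next
    case (Cons v u)
    then obtain m where n: "n = Suc m" by (cases n) auto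
    have "clifford_at_front (\<lambda>w. \<Phi> (u @ w))"
      using Cons unfolding clifford_upto_def by simp
    moreover have "clifford_upto m (\<lambda>w. \<Phi> (v # w))"
      unfolding clifford_upto_def
    proof (intro ballI impI)
      fix u' assume "u' \<in> words" "length u' \<le> m"
      then show "clifford_at_front (\<lambda>w. \<Phi> (v # u' @ w))"
        using Cons.prems(2) Cons.hyps n unfolding clifford_upto_def
        by (elim ballE[of _ _ "v # u'"]) auto
    qed
    then have "clifford_at_front (\<lambda>w. contract R f (\<lambda>w. \<Phi> (v # w)) (u @ w))"
      using Cons.prems n by (intro Cons.IH) auto
    ultimately show ?case
      using Cons.hyps f by (auto intro: clifford_at_front_minus linear_formD)
  qed
  then show ?thesis using assms(2) unfolding clifford_upto_def[of n "contract R f \<Phi>"] by blast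
qed

lemma clifford_functional_iff_upto: "clifford_functional \<Phi> \<longleftrightarrow> (\<forall>n. clifford_upto n \<Phi>)"
  unfolding clifford_functional_def clifford_upto_def by auto

lemma clifford_functional_contract:
  "\<lbrakk>linear_form R V f; clifford_functional \<Phi>\<rbrakk> \<Longrightarrow> clifford_functional (contract R f \<Phi>)"
  unfolding clifford_functional_iff_upto using clifford_upto_contract by blast

lemma clifford_functional_at_front: "clifford_functional \<Phi> \<Longrightarrow> clifford_at_front \<Phi>"
  unfolding clifford_functional_def by (drule bspec[of _ _ "[]"]) simp_all

lemma clifford_functional_word_functional: "clifford_functional \<Phi> \<Longrightarrow> word_functional \<Phi>"
  using clifford_functional_at_front clifford_at_frontD(1) by blast

lemma clifford_functional_append:
  assumes "clifford_functional \<Phi>" "u \<in> words"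
  shows "clifford_functional (\<lambda>w. \<Phi> (u @ w))"
  unfolding clifford_functional_def
proof
  fix u' assume "u' \<in> words"
  then have "clifford_at_front (\<lambda>w. \<Phi> ((u @ u') @ w))"
    using assms unfolding clifford_functional_def by (metis append_in_lists_conv)
  then show "clifford_at_front (\<lambda>w. \<Phi> (u @ u' @ w))" by simp
qed

lemma clifford_functional_Cons:
  "\<lbrakk>clifford_functional \<Phi>; v \<in> carrier V\<rbrakk> \<Longrightarrow> clifford_functional (\<lambda>w. \<Phi> (v # w))"
  using clifford_functional_append[of \<Phi> "[v]"] by simp

lemma clifford_functional_append_right:
  assumes "clifford_functional \<Phi>" "u \<in> words"
  shows "clifford_functional (\<lambda>w. \<Phi> (w @ u))"
  unfolding clifford_functional_def
proof
  fix u' assume u': "u' \<in> words"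
  then have *: "clifford_at_front (\<lambda>w. \<Phi> (u' @ w))"
    using assms unfolding clifford_functional_def by blast
  then show "clifford_at_front (\<lambda>w. \<Phi> ((u' @ w) @ u))"
    using assms(2) unfolding clifford_at_front_def word_functional_def by simp
qed

text \<open>The polarization of \<open>\<Phi>(x x w) = q(x) \<Phi>(w)\<close>.\<close>

lemma clifford_functional_swap:
  assumes \<Phi>: "clifford_functional \<Phi>" and x: "x \<in> carrier V" and y: "y \<in> carrier V" and w: "w \<in> words"
  shows "\<Phi> (x # y # w) \<oplus> \<Phi> (y # x # w) = polar x y \<otimes> \<Phi> w"
proof -
  note D = clifford_at_frontD[OF clifford_functional_at_front[OF \<Phi>]]
  note Dx = clifford_at_frontD[OF clifford_functional_at_front[OF clifford_functional_Cons[OF \<Phi> x]]]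
  note Dy = clifford_at_frontD[OF clifford_functional_at_front[OF clifford_functional_Cons[OF \<Phi> y]]]
  have c: "\<Phi> (x # y # w) \<in> carrier R" "\<Phi> (y # x # w) \<in> carrier R" "\<Phi> w \<in> carrier R"
    "q x \<in> carrier R" "q y \<in> carrier R" "polar x y \<in> carrier R"
    using x y w by (auto intro!: word_functionalD[OF D(1)])
  have "(q x \<oplus> q y \<oplus> polar x y) \<otimes> \<Phi> w = \<Phi> ((x \<oplus>\<^bsub>V\<^esub> y) # (x \<oplus>\<^bsub>V\<^esub> y) # w)"
    using x y w by (simp add: D(4) q_add)
  also have "\<dots> = (\<Phi> (x # x # w) \<oplus> \<Phi> (x # y # w)) \<oplus> (\<Phi> (y # x # w) \<oplus> \<Phi> (y # y # w))"
    using x y w by (simp add: D(2) Dx(2) Dy(2))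
  also have "\<dots> = (q x \<otimes> \<Phi> w \<oplus> \<Phi> (x # y # w)) \<oplus> (\<Phi> (y # x # w) \<oplus> q y \<otimes> \<Phi> w)"
    using x y w by (simp add: D(4))
  finally have eq: "(q x \<oplus> q y \<oplus> polar x y) \<otimes> \<Phi> w =
      (q x \<otimes> \<Phi> w \<oplus> \<Phi> (x # y # w)) \<oplus> (\<Phi> (y # x # w) \<oplus> q y \<otimes> \<Phi> w)" .
  have "s \<oplus> t = r \<otimes> p"
    if "(a \<oplus> b \<oplus> r) \<otimes> p = (a \<otimes> p \<oplus> s) \<oplus> (t \<oplus> b \<otimes> p)"
      "a \<in> carrier R" "b \<in> carrier R" "r \<in> carrier R" "p \<in> carrier R" "s \<in> carrier R" "t \<in> carrier R"
    for a b r p s t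
  proof -
    have "s \<oplus> t = ((a \<otimes> p \<oplus> s) \<oplus> (t \<oplus> b \<otimes> p)) \<ominus> a \<otimes> p \<ominus> b \<otimes> p"
      using that(2-) by algebra
    also have "\<dots> = r \<otimes> p"
      unfolding that(1)[symmetric] using that(2-) by algebra
    finally show ?thesis .
  qed
  from this[OF eq] show ?thesis using c by simp
qed

end


section \<open>The vacuum functional and supercommutators of functionals\<close>

definition signed :: "('r, 'm) ring_scheme \<Rightarrow> nat \<Rightarrow> 'r \<Rightarrow> 'r" where
  "signed R n x = (if even n then x else \<ominus>\<^bsub>R\<^esub> x)"

text \<open>Let vectors act on the exterior algebra by \<open>v \<mapsto> v \<and> \<cdot> + \<iota>\<^bsub>\<beta>(v,\<cdot>)\<^esub>\<close>, a representation of the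
Clifford algebra when \<open>\<beta>(x, x) = q(x)\<close>. The vacuum functional is the scalar part of the result of letting
a word act on 1. The recursion computes it without the exterior algebra: the first letter has to be
contracted with some later letter.\<close>

fun vacuum_functional ::
  "('r, 'm) ring_scheme \<Rightarrow> ('v \<Rightarrow> 'v \<Rightarrow> 'r) \<Rightarrow> 'v list \<Rightarrow> 'r" where
  "vacuum_functional R \<beta> [] = \<one>\<^bsub>R\<^esub>"
| "vacuum_functional R \<beta> (v # w) = contract R (\<beta> v) (vacuum_functional R \<beta>) w"

context quadratic_space
begin

lemma contract_zero_form:
  assumes "w \<in> words" "word_functional \<Phi>"
  shows "contract R (\<lambda>_. \<zero>) \<Phi> w = \<zero>"
  using assms
  by (induction arbitrary: \<Phi> rule: lists.induct)
    (auto simp: word_functionalD word_functional_Cons a_minus_def)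

lemma linear_form_zero_form: "linear_form R V (\<lambda>_. \<zero>)"
  by (simp add: linear_form_def)

lemma contract_smult_form:
  assumes f: "linear_form R V f" and a: "a \<in> carrier R" and w: "w \<in> words"
    and \<Phi>: "word_functional \<Phi>"
  shows "contract R (\<lambda>x. a \<otimes> f x) \<Phi> w = a \<otimes> contract R f \<Phi> w"
proof -
  have "contract R (\<lambda>x. a \<otimes> f x) \<Phi> w = contract R (\<lambda>x. a \<otimes> f x \<oplus> \<zero>) \<Phi> w"
    using assms by (intro contract_congr) (auto simp: linear_formD)
  then show ?thesis
    using contract_linear_in_form[OF f linear_form_zero_form a w \<Phi>] assms
    by (simp add: contract_zero_form contract_closed)
qed

lemma contract_add_form:
  assumes f: "linear_form R V f" and g: "linear_form R V g" and w: "w \<in> words"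
    and \<Phi>: "word_functional \<Phi>"
  shows "contract R (\<lambda>x. f x \<oplus> g x) \<Phi> w = contract R f \<Phi> w \<oplus> contract R g \<Phi> w"
proof -
  have "contract R (\<lambda>x. f x \<oplus> g x) \<Phi> w = contract R (\<lambda>x. \<one> \<otimes> f x \<oplus> g x) \<Phi> w"
    using assms by (intro contract_congr) (auto simp: linear_formD)
  then show ?thesis
    using contract_linear_in_form[OF f g R.one_closed w \<Phi>] assms
    by (simp add: contract_closed)
qed

lemma bilinear_form_right: "\<lbrakk>bilinear_form R V \<beta>; x \<in> carrier V\<rbrakk> \<Longrightarrow> linear_form R V (\<beta> x)"
  unfolding bilinear_form_def linear_form_def by auto

lemma vacuum_functional_closed:
  assumes \<beta>: "bilinear_form R V \<beta>"
  shows "word_functional (vacuum_functional R \<beta>)"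
proof -
  have "vacuum_functional R \<beta> w \<in> carrier R" if "w \<in> words" for w
    using that
  proof (induction w rule: length_induct)
    case (1 w)
    show ?case
    proof (cases w)
      case (Cons v u)
      \<comment> \<open>Only shorter words are known to have values in \<open>R\<close>, so the functional is cut off before contracting.\<close>
      define \<Phi> where "\<Phi> u' = (if length u' < length u then vacuum_functional R \<beta> u' else \<zero>)" for u'
      have v: "v \<in> carrier V" "u \<in> words" using 1(2) Cons by auto
      have "word_functional \<Phi>"
        using 1(1) Cons unfolding word_functional_def \<Phi>_def by auto
      then have "contract R (\<beta> v) \<Phi> u \<in> carrier R"
        using \<beta> v by (intro contract_closed bilinear_form_right)
      also have "contract R (\<beta> v) \<Phi> u = contract R (\<beta> v) (vacuum_functional R \<beta>) u"
        by (intro contract_cong) (auto simp: \<Phi>_def)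
      finally show ?thesis using Cons by simp
    qed simp
  qed
  then show ?thesis unfolding word_functional_def by blast
qed

text \<open>At the front, the Clifford relation holds since
\<open>\<Omega>(x x w) = \<beta>(x, x) \<Omega>(w) - (\<Omega> contracted twice with \<beta>(x, \<cdot>))(w)\<close>. A prefix that begins with \<open>v\<close> turns
\<open>\<Omega>\<close> into its contraction with \<open>\<beta>(v, \<cdot>)\<close>, evaluated at a shorter prefix, and contraction preserves
the conditions.\<close>

lemma vacuum_functional_clifford:
  assumes \<beta>: "bilinear_form R V \<beta>" and diag: "\<And>x. x \<in> carrier V \<Longrightarrow> \<beta> x x = q x"
  shows "clifford_functional (vacuum_functional R \<beta>)"
proof -
  let ?\<Omega> = "vacuum_functional R \<beta>"
  note wf = vacuum_functional_closed[OF \<beta>]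
  have front: "clifford_at_front ?\<Omega>"
    unfolding clifford_at_front_def
  proof (intro conjI ballI wf)
    fix x w assume *: "x \<in> carrier V" "w \<in> words"
    have "?\<Omega> (x # x # w) = \<beta> x x \<otimes> ?\<Omega> w \<ominus> contract R (\<beta> x) (contract R (\<beta> x) ?\<Omega>) w"
      by simp
    also have "\<dots> = q x \<otimes> ?\<Omega> w"
      using * \<beta> wf by (simp add: contract_twice bilinear_form_right diag a_minus_def word_functionalD)
    finally show "?\<Omega> (x # x # w) = q x \<otimes> ?\<Omega> w" .
    fix a assume a: "a \<in> carrier R"
    have "contract R (\<beta> (a \<odot>\<^bsub>V\<^esub> x)) ?\<Omega> w = contract R (\<lambda>z. a \<otimes> \<beta> x z) ?\<Omega> w"
      using * a \<beta> by (intro contract_congr) (auto simp: bilinear_form_def)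
    then show "?\<Omega> ((a \<odot>\<^bsub>V\<^esub> x) # w) = a \<otimes> ?\<Omega> (x # w)"
      using * a \<beta> wf by (simp add: contract_smult_form bilinear_form_right)
  next
    fix x y w assume *: "x \<in> carrier V" "y \<in> carrier V" "w \<in> words"
    have "contract R (\<beta> (x \<oplus>\<^bsub>V\<^esub> y)) ?\<Omega> w = contract R (\<lambda>z. \<beta> x z \<oplus> \<beta> y z) ?\<Omega> w"
      using * \<beta> by (intro contract_congr) (auto simp: bilinear_form_def)
    then show "?\<Omega> ((x \<oplus>\<^bsub>V\<^esub> y) # w) = ?\<Omega> (x # w) \<oplus> ?\<Omega> (y # w)"
      using * \<beta> wf by (simp add: contract_add_form bilinear_form_right)
  qed
  have "clifford_upto n ?\<Omega>" for n
  proof (induction n)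
    case 0
    then show ?case using front by (auto simp: clifford_upto_def)
  next
    case (Suc n)
    show ?case
      unfolding clifford_upto_def
    proof (intro ballI impI)
      fix u assume u: "u \<in> words" "length u \<le> Suc n"
      show "clifford_at_front (\<lambda>w. ?\<Omega> (u @ w))"
      proof (cases u)
        case Nil
        then show ?thesis using front by simp
      next
        case (Cons v u')
        then have "clifford_upto n (contract R (\<beta> v) ?\<Omega>)"
          using u \<beta> Suc by (intro clifford_upto_contract bilinear_form_right) auto
        then show ?thesis using u Cons unfolding clifford_upto_def by simp
      qed
    qed
  qed
  then show ?thesis by (simp add: clifford_functional_iff_upto)
qed

text \<open>Moving \<open>v\<close> from the left end of a word to the right end, one swap at a time, picks up the term
\<open>\<langle>v, x\<rangle>\<close> with alternating sign at every letter \<open>x\<close> that is passed; these terms add up to the contraction.\<close>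

lemma clifford_functional_supercommutator:
  assumes "clifford_functional \<Phi>" and v: "v \<in> carrier V" and w: "w \<in> words"
  shows "\<Phi> (v # w) \<ominus> signed R (length w) (\<Phi> (w @ [v])) = contract R (polar v) \<Phi> w"
  using w assms(1)
proof (induction w arbitrary: \<Phi> rule: lists.induct)
  case Nil
  then have "\<Phi> [v] \<in> carrier R"
    using v by (intro word_functionalD clifford_functional_word_functional) auto
  then show ?case by (simp add: signed_def a_minus_def R.r_neg)
next
  case (Cons x w)
  have c: "u \<in> words \<Longrightarrow> \<Phi> u \<in> carrier R" for u
    using Cons.prems by (intro word_functionalD clifford_functional_word_functional)
  have IH: "\<Phi> (x # v # w) \<ominus> signed R (length w) (\<Phi> (x # w @ [v])) =
      contract R (polar v) (\<lambda>u. \<Phi> (x # u)) w"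
    using Cons by (intro Cons.IH clifford_functional_Cons)
  have swap: "\<Phi> (v # x # w) \<oplus> \<Phi> (x # v # w) = polar v x \<otimes> \<Phi> w"
    using Cons v by (intro clifford_functional_swap)
  have "s \<ominus> \<ominus> r = (s \<oplus> t) \<ominus> (t \<ominus> r)" "s \<ominus> r = (s \<oplus> t) \<ominus> (t \<ominus> \<ominus> r)"
    if "s \<in> carrier R" "t \<in> carrier R" "r \<in> carrier R" for s t r
    using that by algebra+
  from this[of "\<Phi> (v # x # w)" "\<Phi> (x # v # w)" "\<Phi> (x # w @ [v])"] show ?case
    using Cons.hyps v c unfolding contract.simps IH[symmetric] swap[symmetric]
    by (simp add: signed_def)
qed

end


section \<open>Coordinates and the normalized functional\<close>

locale based_quadratic_space = quadratic_space R V q for R (structure) and V (structure) and q +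
  fixes B
  assumes basis: "is_basis R V B"
begin

lemma finite_B: "finite B" and B_carrier: "B \<subseteq> carrier V"
  using basis unfolding is_basis_def by auto

lemma B_closed [simp]: "b \<in> B \<Longrightarrow> b \<in> carrier V"
  using B_carrier by blast

definition coords :: "'c \<Rightarrow> 'c \<Rightarrow> 'a" where
  "coords v = (THE c. c \<in> B \<rightarrow>\<^sub>E carrier R \<and> v = (\<Oplus>\<^bsub>V\<^esub>b\<in>B. c b \<odot>\<^bsub>V\<^esub> b))"

abbreviation coord :: "'c \<Rightarrow> 'c \<Rightarrow> 'a" where
  "coord b \<equiv> (\<lambda>v. coords v b)"

lemma coords:
  assumes "v \<in> carrier V"
  shows "coords v \<in> B \<rightarrow>\<^sub>E carrier R" and "v = (\<Oplus>\<^bsub>V\<^esub>b\<in>B. coords v b \<odot>\<^bsub>V\<^esub> b)"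
proof -
  have "\<exists>!c. c \<in> B \<rightarrow>\<^sub>E carrier R \<and> v = (\<Oplus>\<^bsub>V\<^esub>b\<in>B. c b \<odot>\<^bsub>V\<^esub> b)"
    using basis assms unfolding is_basis_def by blast
  from theI'[OF this] show "coords v \<in> B \<rightarrow>\<^sub>E carrier R" "v = (\<Oplus>\<^bsub>V\<^esub>b\<in>B. coords v b \<odot>\<^bsub>V\<^esub> b)"
    unfolding coords_def by auto
qed

lemma coords_closed [simp]: "\<lbrakk>v \<in> carrier V; b \<in> B\<rbrakk> \<Longrightarrow> coords v b \<in> carrier R"
  using coords(1) by blast

lemma coords_eqI:
  assumes c: "\<And>b. b \<in> B \<Longrightarrow> c b \<in> carrier R" and v: "v = (\<Oplus>\<^bsub>V\<^esub>b\<in>B. c b \<odot>\<^bsub>V\<^esub> b)" and b: "b \<in> B"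
  shows "coords v b = c b"
proof -
  have vc: "v \<in> carrier V" unfolding v using c by (intro M.finsum_closed) auto
  have "\<exists>!c. c \<in> B \<rightarrow>\<^sub>E carrier R \<and> v = (\<Oplus>\<^bsub>V\<^esub>b\<in>B. c b \<odot>\<^bsub>V\<^esub> b)"
    using basis vc unfolding is_basis_def by blast
  moreover have "(\<Oplus>\<^bsub>V\<^esub>b\<in>B. restrict c B b \<odot>\<^bsub>V\<^esub> b) = v"
    unfolding v using c by (intro M.finsum_cong') auto
  moreover have "restrict c B \<in> B \<rightarrow>\<^sub>E carrier R" using c by auto
  ultimately have "coords v = restrict c B"
    using coords[OF vc] by metis
  then show ?thesis using b by simp
qed

lemma coord_linear: "b \<in> B \<Longrightarrow> linear_form R V (coord b)"
  unfolding linear_form_def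
proof (intro conjI ballI)
  assume b: "b \<in> B"
  then show "coord b \<in> carrier V \<rightarrow> carrier R" by auto
  fix x y assume *: "x \<in> carrier V" "y \<in> carrier V"
  have "(\<Oplus>\<^bsub>V\<^esub>b\<in>B. (coords x b \<oplus> coords y b) \<odot>\<^bsub>V\<^esub> b) =
      (\<Oplus>\<^bsub>V\<^esub>b\<in>B. coords x b \<odot>\<^bsub>V\<^esub> b \<oplus>\<^bsub>V\<^esub> coords y b \<odot>\<^bsub>V\<^esub> b)"
    using * by (intro M.finsum_cong') (auto simp: smult_l_distr)
  also have "\<dots> = x \<oplus>\<^bsub>V\<^esub> y"
    using * by (subst M.finsum_addf) (auto simp flip: coords(2))
  finally show "coords (x \<oplus>\<^bsub>V\<^esub> y) b = coords x b \<oplus> coords y b"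
    using * b by (intro coords_eqI) auto
next
  fix a x assume b: "b \<in> B" and *: "a \<in> carrier R" "x \<in> carrier V"
  have "(\<Oplus>\<^bsub>V\<^esub>b\<in>B. (a \<otimes> coords x b) \<odot>\<^bsub>V\<^esub> b) = (\<Oplus>\<^bsub>V\<^esub>b\<in>B. a \<odot>\<^bsub>V\<^esub> (coords x b \<odot>\<^bsub>V\<^esub> b))"
    using * by (intro M.finsum_cong') (auto simp: smult_assoc1)
  also have "\<dots> = a \<odot>\<^bsub>V\<^esub> x"
    using * finite_B by (subst finsum_smult_ldistr[symmetric]) (auto simp flip: coords(2))
  finally show "coords (a \<odot>\<^bsub>V\<^esub> x) b = a \<otimes> coords x b"
    using * b by (intro coords_eqI) auto
qed

lemma coords_basis:
  assumes "b \<in> B" "c \<in> B" shows "coords b c = (if c = b then \<one> else \<zero>)"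
proof (rule coords_eqI)
  have "(\<Oplus>\<^bsub>V\<^esub>c\<in>B. (if c = b then \<one> else \<zero>) \<odot>\<^bsub>V\<^esub> c) = (\<Oplus>\<^bsub>V\<^esub>c\<in>B. if b = c then c else \<zero>\<^bsub>V\<^esub>)"
    using assms by (intro M.finsum_cong') auto
  also have "\<dots> = b"
    using assms finite_B by (intro M.finsum_singleton) auto
  finally show "b = (\<Oplus>\<^bsub>V\<^esub>c\<in>B. (if c = b then \<one> else \<zero>) \<odot>\<^bsub>V\<^esub> c)" by simp
qed (use assms in auto)

lemma basis_independent:
  assumes "\<And>b. b \<in> B \<Longrightarrow> c b \<in> carrier R" and "(\<Oplus>\<^bsub>V\<^esub>b\<in>B. c b \<odot>\<^bsub>V\<^esub> b) = \<zero>\<^bsub>V\<^esub>" and "b \<in> B"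
  shows "c b = \<zero>"
proof -
  have "coords \<zero>\<^bsub>V\<^esub> b = c b" using assms by (intro coords_eqI) auto
  moreover have "coords \<zero>\<^bsub>V\<^esub> b = \<zero>" using linear_form_zero[OF coord_linear] assms by simp
  ultimately show ?thesis by simp
qed

lemma linear_form_sum:
  assumes f: "linear_form R V f" and S: "finite S"
    and c: "\<And>b. b \<in> S \<Longrightarrow> c b \<in> carrier R" "S \<subseteq> carrier V"
  shows "f (\<Oplus>\<^bsub>V\<^esub>b\<in>S. c b \<odot>\<^bsub>V\<^esub> b) = (\<Oplus>b\<in>S. c b \<otimes> f b)"
  using S c
proof (induction S rule: finite_induct)
  case empty
  then show ?case using linear_form_zero[OF f] by simp
next
  case (insert b S)
  have "(\<Oplus>\<^bsub>V\<^esub>b\<in>S. c b \<odot>\<^bsub>V\<^esub> b) \<in> carrier V" using insert by (intro M.finsum_closed) auto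
  moreover have "(\<Oplus>\<^bsub>V\<^esub>b\<in>insert b S. c b \<odot>\<^bsub>V\<^esub> b) = c b \<odot>\<^bsub>V\<^esub> b \<oplus>\<^bsub>V\<^esub> (\<Oplus>\<^bsub>V\<^esub>b\<in>S. c b \<odot>\<^bsub>V\<^esub> b)"
    using insert by (intro M.finsum_insert) auto
  moreover have "(\<Oplus>b\<in>insert b S. c b \<otimes> f b) = c b \<otimes> f b \<oplus> (\<Oplus>b\<in>S. c b \<otimes> f b)"
    using insert f by (intro R.finsum_insert) (auto simp: linear_formD)
  ultimately show ?case using insert f by (simp add: linear_formD)
qed

text \<open>Contraction is linear in the form, and a form is determined by its values on the basis.\<close>

lemma contract_expand:
  assumes f: "linear_form R V f" and w: "w \<in> words" and \<Phi>: "word_functional \<Phi>"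
  shows "contract R f \<Phi> w = (\<Oplus>b\<in>B. f b \<otimes> contract R (coord b) \<Phi> w)"
proof -
  have lin: "linear_form R V (\<lambda>x. \<Oplus>b\<in>S. f b \<otimes> coords x b) \<and>
      contract R (\<lambda>x. \<Oplus>b\<in>S. f b \<otimes> coords x b) \<Phi> w = (\<Oplus>b\<in>S. f b \<otimes> contract R (coord b) \<Phi> w)"
    if "finite S" "S \<subseteq> B" for S
    using that
  proof (induction S rule: finite_induct)
    case empty
    then show ?case using w \<Phi> by (simp add: contract_zero_form linear_form_zero_form)
  next
    case (insert b S)
    let ?g = "\<lambda>x. \<Oplus>b\<in>S. f b \<otimes> coords x b" and ?h = "\<lambda>x. \<Oplus>b\<in>insert b S. f b \<otimes> coords x b"
    have IH: "linear_form R V ?g" "contract R ?g \<Phi> w = (\<Oplus>b\<in>S. f b \<otimes> contract R (coord b) \<Phi> w)"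
      using insert by auto
    have B: "b \<in> B" "S \<subseteq> B" "f b \<in> carrier R" using insert f by (auto simp: linear_formD)
    have fS: "f c \<in> carrier R" if "c \<in> insert b S" for c
      using that insert.prems by (intro linear_formD(1)[OF f]) auto
    have h: "?h x = f b \<otimes> coords x b \<oplus> ?g x" if "x \<in> carrier V" for x
      using that insert B fS by (intro R.finsum_insert) auto
    have "linear_form R V ?h"
      using insert.hyps fS insert.prems coord_linear by (intro linear_form_finsum) auto
    moreover have "contract R ?h \<Phi> w = contract R (\<lambda>x. f b \<otimes> coords x b \<oplus> ?g x) \<Phi> w"
      using w h by (intro contract_congr) auto
    then have "contract R ?h \<Phi> w = f b \<otimes> contract R (coord b) \<Phi> w \<oplus> contract R ?g \<Phi> w"
      using contract_linear_in_form[OF coord_linear IH(1) B(3) w \<Phi>, OF B(1)] by simp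
    moreover have "(\<Oplus>b\<in>insert b S. f b \<otimes> contract R (coord b) \<Phi> w) =
        f b \<otimes> contract R (coord b) \<Phi> w \<oplus> (\<Oplus>b\<in>S. f b \<otimes> contract R (coord b) \<Phi> w)"
      using insert B fS w \<Phi> by (intro R.finsum_insert) (auto intro!: contract_closed coord_linear)
    ultimately show ?case using IH(2) by simp
  qed
  have "f x = (\<Oplus>b\<in>B. f b \<otimes> coords x b)" if x: "x \<in> carrier V" for x
  proof -
    have "f x = f (\<Oplus>\<^bsub>V\<^esub>b\<in>B. coords x b \<odot>\<^bsub>V\<^esub> b)" using coords(2)[OF x] by simp
    also have "\<dots> = (\<Oplus>b\<in>B. coords x b \<otimes> f b)"
      using f x finite_B B_carrier by (intro linear_form_sum) auto
    also have "\<dots> = (\<Oplus>b\<in>B. f b \<otimes> coords x b)"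
      using f x by (intro R.finsum_cong') (auto simp: linear_formD R.m_comm)
    finally show ?thesis .
  qed
  then have "contract R f \<Phi> w = contract R (\<lambda>x. \<Oplus>b\<in>B. f b \<otimes> coords x b) \<Phi> w"
    using w by (intro contract_congr) auto
  also have "\<dots> = (\<Oplus>b\<in>B. f b \<otimes> contract R (coord b) \<Phi> w)"
    using lin finite_B by blast
  finally show ?thesis .
qed

text \<open>A quadratic form on a free module is the diagonal of a bilinear form that need not be symmetric; no
division by 2 takes place. The basis vectors are added one at a time: if \<open>\<beta>\<close> serves for
the projection \<open>p\<close> onto the span of \<open>S\<close>, then
\<open>c\<^sup>*(x) (c\<^sup>*(y) q(c) + \<langle>c, p(y)\<rangle>) + \<beta>(x, y)\<close> serves for the span of \<open>S \<union> {c}\<close>.\<close>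

lemma exists_diagonal_bilinear_form:
  "\<exists>\<beta>. bilinear_form R V \<beta> \<and> (\<forall>x\<in>carrier V. \<beta> x x = q x)"
proof -
  let ?p = "\<lambda>S x. \<Oplus>\<^bsub>V\<^esub>b\<in>S. coords x b \<odot>\<^bsub>V\<^esub> b"
  have p_closed: "?p S x \<in> carrier V" if "S \<subseteq> B" "x \<in> carrier V" for S x
    using that by (intro M.finsum_closed) auto
  have p_add: "?p S (x \<oplus>\<^bsub>V\<^esub> y) = ?p S x \<oplus>\<^bsub>V\<^esub> ?p S y"
    if "S \<subseteq> B" "x \<in> carrier V" "y \<in> carrier V" for S x y
  proof -
    have "?p S (x \<oplus>\<^bsub>V\<^esub> y) = (\<Oplus>\<^bsub>V\<^esub>b\<in>S. coords x b \<odot>\<^bsub>V\<^esub> b \<oplus>\<^bsub>V\<^esub> coords y b \<odot>\<^bsub>V\<^esub> b)"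
      using that by (intro M.finsum_cong') (auto simp: linear_formD(2)[OF coord_linear] smult_l_distr subset_iff)
    then show ?thesis using that by (subst (asm) M.finsum_addf) auto
  qed
  have p_smult: "?p S (a \<odot>\<^bsub>V\<^esub> x) = a \<odot>\<^bsub>V\<^esub> ?p S x"
    if "S \<subseteq> B" "a \<in> carrier R" "x \<in> carrier V" for S a x
  proof -
    have "?p S (a \<odot>\<^bsub>V\<^esub> x) = (\<Oplus>\<^bsub>V\<^esub>b\<in>S. a \<odot>\<^bsub>V\<^esub> (coords x b \<odot>\<^bsub>V\<^esub> b))"
      using that by (intro M.finsum_cong') (auto simp: linear_formD(3)[OF coord_linear] smult_assoc1 subset_iff)
    then show ?thesis
      using that finite_B finite_subset[of S B] by (subst finsum_smult_ldistr) auto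
  qed
  have "\<exists>\<beta>. bilinear_form R V \<beta> \<and> (\<forall>x\<in>carrier V. \<beta> x x = q (?p S x))"
    if "finite S" "S \<subseteq> B" for S
    using that
  proof (induction S rule: finite_induct)
    case empty
    have "bilinear_form R V (\<lambda>_ _. \<zero>)" by (simp add: bilinear_form_def)
    then show ?case using q_zero by auto
  next
    case (insert c S)
    then obtain \<beta> where \<beta>: "bilinear_form R V \<beta>" "\<And>x. x \<in> carrier V \<Longrightarrow> \<beta> x x = q (?p S x)"
      by auto
    have c: "c \<in> B" "c \<in> carrier V" and S: "S \<subseteq> B" using insert by auto
    let ?\<gamma> = "\<lambda>x y. coords x c \<otimes> (coords y c \<otimes> q c \<oplus> polar c (?p S y)) \<oplus> \<beta> x y"
    note pol = linear_formD[OF polar_linear_right[OF c(2)]]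
    note cl = linear_formD[OF coord_linear[OF c(1)]]
    note bl = \<beta>(1)[unfolded bilinear_form_def]
    have "bilinear_form R V ?\<gamma>"
      unfolding bilinear_form_def
    proof (intro conjI ballI)
      fix u v assume uv: "u \<in> carrier V" "v \<in> carrier V"
      have cc: "coords u c \<in> carrier R" "coords v c \<in> carrier R" "q c \<in> carrier R"
        "polar c (?p S v) \<in> carrier R" "\<beta> u v \<in> carrier R"
        using uv c S p_closed bl by auto
      then show "?\<gamma> u v \<in> carrier R" by simp
      have e1: "a \<otimes> s \<otimes> (t \<otimes> r \<oplus> p) \<oplus> a \<otimes> z = a \<otimes> (s \<otimes> (t \<otimes> r \<oplus> p) \<oplus> z)"
        "s \<otimes> (a \<otimes> t \<otimes> r \<oplus> a \<otimes> p) \<oplus> a \<otimes> z = a \<otimes> (s \<otimes> (t \<otimes> r \<oplus> p) \<oplus> z)"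
        if "a \<in> carrier R" "s \<in> carrier R" "t \<in> carrier R" "r \<in> carrier R" "p \<in> carrier R" "z \<in> carrier R"
        for a s t r p z
        using that by algebra+
      fix a assume a: "a \<in> carrier R"
      show "?\<gamma> (a \<odot>\<^bsub>V\<^esub> u) v = a \<otimes> ?\<gamma> u v" "?\<gamma> u (a \<odot>\<^bsub>V\<^esub> v) = a \<otimes> ?\<gamma> u v"
        using e1 cc uv a S bl by (simp_all add: cl p_smult pol p_closed)
    next
      fix u v w assume uv: "u \<in> carrier V" "v \<in> carrier V" "w \<in> carrier V"
      have cc: "coords u c \<in> carrier R" "coords v c \<in> carrier R" "coords w c \<in> carrier R" "q c \<in> carrier R"
        "polar c (?p S v) \<in> carrier R" "polar c (?p S w) \<in> carrier R" "\<beta> u v \<in> carrier R"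
        "\<beta> u w \<in> carrier R" "\<beta> v w \<in> carrier R"
        using uv c S p_closed bl by auto
      have e1: "(s \<oplus> s') \<otimes> (t \<otimes> r \<oplus> p) \<oplus> (z \<oplus> z') =
          (s \<otimes> (t \<otimes> r \<oplus> p) \<oplus> z) \<oplus> (s' \<otimes> (t \<otimes> r \<oplus> p) \<oplus> z')"
        if "s \<in> carrier R" "s' \<in> carrier R" "t \<in> carrier R" "r \<in> carrier R" "p \<in> carrier R"
          "z \<in> carrier R" "z' \<in> carrier R" for s s' t r p z z'
        using that by algebra
      have e2: "s \<otimes> ((t \<oplus> t') \<otimes> r \<oplus> (p \<oplus> p')) \<oplus> (z \<oplus> z') =
          (s \<otimes> (t \<otimes> r \<oplus> p) \<oplus> z) \<oplus> (s \<otimes> (t' \<otimes> r \<oplus> p') \<oplus> z')"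
        if "s \<in> carrier R" "t \<in> carrier R" "t' \<in> carrier R" "r \<in> carrier R" "p \<in> carrier R"
          "p' \<in> carrier R" "z \<in> carrier R" "z' \<in> carrier R" for s t t' r p p' z z'
        using that by algebra
      show "?\<gamma> (u \<oplus>\<^bsub>V\<^esub> v) w = ?\<gamma> u w \<oplus> ?\<gamma> v w"
        using cc uv S bl by (simp only: cl e1)
      show "?\<gamma> u (v \<oplus>\<^bsub>V\<^esub> w) = ?\<gamma> u v \<oplus> ?\<gamma> u w"
        using cc uv S bl by (simp only: cl p_add pol p_closed e2)
    qed
    moreover have "?\<gamma> x x = q (?p (insert c S) x)" if x: "x \<in> carrier V" for x
    proof -
      have cc: "coords x c \<in> carrier R" "q c \<in> carrier R" "polar c (?p S x) \<in> carrier R"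
        "q (?p S x) \<in> carrier R"
        using x c S p_closed by auto
      have e: "s \<otimes> (s \<otimes> r \<oplus> p) \<oplus> z = s \<otimes> s \<otimes> r \<oplus> z \<oplus> s \<otimes> p"
        if "s \<in> carrier R" "r \<in> carrier R" "p \<in> carrier R" "z \<in> carrier R" for s r p z
        using that by algebra
      have "?p (insert c S) x = coords x c \<odot>\<^bsub>V\<^esub> c \<oplus>\<^bsub>V\<^esub> ?p S x"
        using insert x by (intro M.finsum_insert) auto
      then have "q (?p (insert c S) x) =
          coords x c \<otimes> coords x c \<otimes> q c \<oplus> q (?p S x) \<oplus> coords x c \<otimes> polar c (?p S x)"
        using x c S cc p_closed linear_formD(3)[OF polar_linear_left[of "?p S x"]]
        by (simp add: q_add q_smult)
      also have "\<dots> = ?\<gamma> x x"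
        using e[OF cc] \<beta>(2)[OF x] by simp
      finally show ?thesis by simp
    qed
    ultimately show ?case by blast
  qed
  from this[OF finite_B] obtain \<beta> where \<beta>: "bilinear_form R V \<beta>"
    "\<And>x. x \<in> carrier V \<Longrightarrow> \<beta> x x = q (?p B x)" by auto
  then show ?thesis using coords(2) by auto
qed

lemma exists_normalized_clifford_functional: "\<exists>\<Phi>. clifford_functional \<Phi> \<and> \<Phi> [] = \<one>"
proof -
  obtain \<beta> where \<beta>: "bilinear_form R V \<beta>" "\<And>x. x \<in> carrier V \<Longrightarrow> \<beta> x x = q x"
    using exists_diagonal_bilinear_form by auto
  show ?thesis
    using vacuum_functional_clifford[OF \<beta>] vacuum_functional.simps(1) by blast
qed

end


section \<open>Detecting scalars by contractions\<close>

abbreviation word_product ::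
  "('r, 'a, 'k) module_scheme \<Rightarrow> ('v \<Rightarrow> 'a) \<Rightarrow> 'v list \<Rightarrow> 'a" where
  "word_product C \<iota> w \<equiv> foldr (\<lambda>x a. \<iota> x \<otimes>\<^bsub>C\<^esub> a) w \<one>\<^bsub>C\<^esub>"

text \<open>What the main argument uses of the Clifford algebra: it is spanned by products of vectors that
obey the Clifford relation, and every function on words compatible with the relations extends to a
linear form.\<close>

locale clifford_presentation = based_quadratic_space R V q B + Cl: assoc_algebra R C
  for R (structure) and V (structure) and q and B and C (structure) +
  fixes \<iota> :: "'c \<Rightarrow> 'e"
  assumes \<iota>_closed [simp]: "x \<in> carrier V \<Longrightarrow> \<iota> x \<in> carrier C"
    and \<iota>_add: "\<lbrakk>x \<in> carrier V; y \<in> carrier V\<rbrakk> \<Longrightarrow> \<iota> (x \<oplus>\<^bsub>V\<^esub> y) = \<iota> x \<oplus>\<^bsub>C\<^esub> \<iota> y"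
    and \<iota>_smult: "\<lbrakk>a \<in> carrier R; x \<in> carrier V\<rbrakk> \<Longrightarrow> \<iota> (a \<odot>\<^bsub>V\<^esub> x) = a \<odot>\<^bsub>C\<^esub> \<iota> x"
    and \<iota>_square: "x \<in> carrier V \<Longrightarrow> \<iota> x \<otimes>\<^bsub>C\<^esub> \<iota> x = q x \<odot>\<^bsub>C\<^esub> \<one>\<^bsub>C\<^esub>"
    and spanned: "carrier C = lin_span R C ((\<lambda>w. word_product C \<iota> w) ` words)"
    and functional_extends: "clifford_functional \<Phi> \<Longrightarrow>
      \<exists>\<psi>. linear_form R C \<psi> \<and> (\<forall>w\<in>words. \<psi> (word_product C \<iota> w) = \<Phi> w)"
begin

abbreviation wd :: "'c list \<Rightarrow> 'e" where
  "wd w \<equiv> word_product C \<iota> w"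

text \<open>Determined by its values on words, because the products of vectors span the algebra.\<close>

definition induced :: "('c list \<Rightarrow> 'a) \<Rightarrow> 'e \<Rightarrow> 'a" where
  "induced \<Phi> = (SOME \<psi>. linear_form R C \<psi> \<and> (\<forall>w\<in>words. \<psi> (wd w) = \<Phi> w))"

lemma induced_linear: "clifford_functional \<Phi> \<Longrightarrow> linear_form R C (induced \<Phi>)"
  and induced_wd: "\<lbrakk>clifford_functional \<Phi>; w \<in> words\<rbrakk> \<Longrightarrow> induced \<Phi> (wd w) = \<Phi> w"
  using someI_ex[OF functional_extends] unfolding induced_def by auto

lemma wd_closed [simp]: "w \<in> words \<Longrightarrow> wd w \<in> carrier C"
  by (induction rule: lists.induct) auto

lemma wd_image_carrier: "X \<subseteq> words \<Longrightarrow> wd ` X \<subseteq> carrier C"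
  using wd_closed by blast

lemma wd_snoc: "\<lbrakk>w \<in> words; v \<in> carrier V\<rbrakk> \<Longrightarrow> wd (w @ [v]) = wd w \<otimes>\<^bsub>C\<^esub> \<iota> v"
  by (induction rule: lists.induct) (auto simp: Cl.m_assoc simp del: foldr_append)

lemma \<iota>_swap:
  assumes x: "x \<in> carrier V" and y: "y \<in> carrier V" and a: "a \<in> carrier C"
  shows "\<iota> x \<otimes>\<^bsub>C\<^esub> (\<iota> y \<otimes>\<^bsub>C\<^esub> a) = (polar x y \<odot>\<^bsub>C\<^esub> a) \<ominus>\<^bsub>C\<^esub> \<iota> y \<otimes>\<^bsub>C\<^esub> (\<iota> x \<otimes>\<^bsub>C\<^esub> a)"
proof -
  have ixy: "\<iota> x \<in> carrier C" "\<iota> y \<in> carrier C" using x y by auto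
  define s where "s = q x \<odot>\<^bsub>C\<^esub> \<one>\<^bsub>C\<^esub>"
  define t where "t = q y \<odot>\<^bsub>C\<^esub> \<one>\<^bsub>C\<^esub>"
  define p where "p = polar x y \<odot>\<^bsub>C\<^esub> \<one>\<^bsub>C\<^esub>"
  have c: "s \<in> carrier C" "t \<in> carrier C" "p \<in> carrier C"
    using x y by (auto simp: s_def t_def p_def)
  have sq: "\<iota> x \<otimes>\<^bsub>C\<^esub> \<iota> x = s" "\<iota> y \<otimes>\<^bsub>C\<^esub> \<iota> y = t" using x y by (auto simp: s_def t_def \<iota>_square)
  have "(\<iota> x \<oplus>\<^bsub>C\<^esub> \<iota> y) \<otimes>\<^bsub>C\<^esub> (\<iota> x \<oplus>\<^bsub>C\<^esub> \<iota> y) = s \<oplus>\<^bsub>C\<^esub> t \<oplus>\<^bsub>C\<^esub> p"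
    using \<iota>_square[of "x \<oplus>\<^bsub>V\<^esub> y"] x y
    by (simp add: \<iota>_add q_add Cl.smult_l_distr s_def t_def p_def)
  then have main: "s \<oplus>\<^bsub>C\<^esub> \<iota> x \<otimes>\<^bsub>C\<^esub> \<iota> y \<oplus>\<^bsub>C\<^esub> (\<iota> y \<otimes>\<^bsub>C\<^esub> \<iota> x \<oplus>\<^bsub>C\<^esub> t) = s \<oplus>\<^bsub>C\<^esub> t \<oplus>\<^bsub>C\<^esub> p"
    using ixy c by (simp add: Cl.l_distr Cl.r_distr sq Cl.M.a_ac)
  have "\<iota> x \<otimes>\<^bsub>C\<^esub> \<iota> y =
      (s \<oplus>\<^bsub>C\<^esub> \<iota> x \<otimes>\<^bsub>C\<^esub> \<iota> y \<oplus>\<^bsub>C\<^esub> (\<iota> y \<otimes>\<^bsub>C\<^esub> \<iota> x \<oplus>\<^bsub>C\<^esub> t)) \<ominus>\<^bsub>C\<^esub> s \<ominus>\<^bsub>C\<^esub> t \<ominus>\<^bsub>C\<^esub> \<iota> y \<otimes>\<^bsub>C\<^esub> \<iota> x"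
    using ixy c by algebra
  also have "\<dots> = p \<ominus>\<^bsub>C\<^esub> \<iota> y \<otimes>\<^bsub>C\<^esub> \<iota> x"
    unfolding main using ixy c by algebra
  finally have "\<iota> x \<otimes>\<^bsub>C\<^esub> \<iota> y = p \<ominus>\<^bsub>C\<^esub> \<iota> y \<otimes>\<^bsub>C\<^esub> \<iota> x" .
  then have "\<iota> x \<otimes>\<^bsub>C\<^esub> (\<iota> y \<otimes>\<^bsub>C\<^esub> a) = (p \<ominus>\<^bsub>C\<^esub> \<iota> y \<otimes>\<^bsub>C\<^esub> \<iota> x) \<otimes>\<^bsub>C\<^esub> a"
    using ixy a by (simp flip: Cl.m_assoc)
  also have "\<dots> = p \<otimes>\<^bsub>C\<^esub> a \<ominus>\<^bsub>C\<^esub> \<iota> y \<otimes>\<^bsub>C\<^esub> (\<iota> x \<otimes>\<^bsub>C\<^esub> a)"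
    using ixy c a by algebra
  also have "p \<otimes>\<^bsub>C\<^esub> a = polar x y \<odot>\<^bsub>C\<^esub> a"
    using x y a by (simp add: p_def Cl.smult_mult_left)
  finally show ?thesis .
qed

definition word_span :: "'c set \<Rightarrow> 'e set" where
  "word_span S = lin_span R C (wd ` lists S)"

lemma word_span_carrier: "S \<subseteq> carrier V \<Longrightarrow> word_span S \<subseteq> carrier C"
  unfolding word_span_def by (intro Cl.lin_span_subset wd_image_carrier lists_mono)

lemma word_span_closed:
  assumes "S \<subseteq> carrier V"
  shows "\<lbrakk>a \<in> word_span S; b \<in> word_span S\<rbrakk> \<Longrightarrow> a \<oplus>\<^bsub>C\<^esub> b \<in> word_span S"
    and "\<lbrakk>r \<in> carrier R; a \<in> word_span S\<rbrakk> \<Longrightarrow> r \<odot>\<^bsub>C\<^esub> a \<in> word_span S"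
    and "a \<in> word_span S \<Longrightarrow> \<ominus>\<^bsub>C\<^esub> a \<in> word_span S"
    and "\<zero>\<^bsub>C\<^esub> \<in> word_span S"
    and "w \<in> lists S \<Longrightarrow> wd w \<in> word_span S"
proof -
  have "wd ` lists S \<subseteq> carrier C" using assms by (intro wd_image_carrier lists_mono)
  then show "\<lbrakk>a \<in> word_span S; b \<in> word_span S\<rbrakk> \<Longrightarrow> a \<oplus>\<^bsub>C\<^esub> b \<in> word_span S"
    and "\<lbrakk>r \<in> carrier R; a \<in> word_span S\<rbrakk> \<Longrightarrow> r \<odot>\<^bsub>C\<^esub> a \<in> word_span S"
    and "a \<in> word_span S \<Longrightarrow> \<ominus>\<^bsub>C\<^esub> a \<in> word_span S"
    and "\<zero>\<^bsub>C\<^esub> \<in> word_span S"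
    and "w \<in> lists S \<Longrightarrow> wd w \<in> word_span S"
    unfolding word_span_def
    by (auto intro: Cl.lin_span_add Cl.lin_span_smult Cl.lin_span_uminus Cl.lin_span_incl lin_span_zero)
qed

lemma \<iota>_mult_lin_span:
  assumes X: "X \<subseteq> words" and Y: "Y \<subseteq> words" and x: "x \<in> carrier V"
    and img: "\<And>w. w \<in> X \<Longrightarrow> x # w \<in> Y" and a: "a \<in> lin_span R C (wd ` X)"
  shows "\<iota> x \<otimes>\<^bsub>C\<^esub> a \<in> lin_span R C (wd ` Y)"
proof (rule lin_span_map[where h = "\<lambda>a. \<iota> x \<otimes>\<^bsub>C\<^esub> a", OF Cl.module_axioms Cl.module_axioms _ _ _ _ _ _ a])
  fix b assume "b \<in> wd ` X"
  then obtain w where w: "w \<in> X" "b = wd w" by auto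
  have "wd (x # w) \<in> lin_span R C (wd ` Y)"
    using wd_image_carrier[OF Y] imageI[OF img[OF w(1)]] by (rule Cl.lin_span_incl)
  then show "\<iota> x \<otimes>\<^bsub>C\<^esub> b \<in> lin_span R C (wd ` Y)" using w by simp
qed (use x X Y wd_image_carrier in \<open>auto simp: Cl.r_distr Cl.smult_mult_right\<close>)

lemma word_span_\<iota>_mult:
  "\<lbrakk>S \<subseteq> carrier V; c \<in> S; a \<in> word_span S\<rbrakk> \<Longrightarrow> \<iota> c \<otimes>\<^bsub>C\<^esub> a \<in> word_span S"
  unfolding word_span_def
  by (rule \<iota>_mult_lin_span[where X = "lists S"]) auto

text \<open>The elements \<open>a' + b a''\<close> are stable under left multiplication by \<open>b\<close>, since \<open>b b = q b\<close>, and by the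
other letters \<open>c\<close>, since \<open>c b = \<langle>c, b\<rangle> - b c\<close>.\<close>

lemma word_span_insert:
  assumes S: "insert b S \<subseteq> carrier V" and a: "a \<in> word_span (insert b S)"
  obtains a' a'' where "a' \<in> word_span S" "a'' \<in> word_span S" "a = a' \<oplus>\<^bsub>C\<^esub> \<iota> b \<otimes>\<^bsub>C\<^esub> a''"
proof -
  let ?D = "{a' \<oplus>\<^bsub>C\<^esub> \<iota> b \<otimes>\<^bsub>C\<^esub> a'' | a' a''. a' \<in> word_span S \<and> a'' \<in> word_span S}"
  have S': "S \<subseteq> carrier V" "b \<in> carrier V" using S by auto
  note [simp] = subsetD[OF word_span_carrier[OF S'(1)]]
  note W = word_span_closed[OF S'(1)]
  have add: "x \<oplus>\<^bsub>C\<^esub> y \<in> ?D" if xy: "x \<in> ?D" "y \<in> ?D" for x y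
  proof -
    obtain x' x'' y' y'' where *: "x = x' \<oplus>\<^bsub>C\<^esub> \<iota> b \<otimes>\<^bsub>C\<^esub> x''" "y = y' \<oplus>\<^bsub>C\<^esub> \<iota> b \<otimes>\<^bsub>C\<^esub> y''"
      "x' \<in> word_span S" "x'' \<in> word_span S" "y' \<in> word_span S" "y'' \<in> word_span S"
      using xy by auto
    then have "x \<oplus>\<^bsub>C\<^esub> y = (x' \<oplus>\<^bsub>C\<^esub> y') \<oplus>\<^bsub>C\<^esub> \<iota> b \<otimes>\<^bsub>C\<^esub> (x'' \<oplus>\<^bsub>C\<^esub> y'')"
      using S' by (simp add: Cl.r_distr Cl.M.a_ac)
    then show ?thesis using * W(1) by blast
  qed
  have smult: "r \<odot>\<^bsub>C\<^esub> x \<in> ?D" if r: "r \<in> carrier R" and x: "x \<in> ?D" for r x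
  proof -
    obtain x' x'' where *: "x = x' \<oplus>\<^bsub>C\<^esub> \<iota> b \<otimes>\<^bsub>C\<^esub> x''" "x' \<in> word_span S" "x'' \<in> word_span S"
      using x by auto
    then have "r \<odot>\<^bsub>C\<^esub> x = (r \<odot>\<^bsub>C\<^esub> x') \<oplus>\<^bsub>C\<^esub> \<iota> b \<otimes>\<^bsub>C\<^esub> (r \<odot>\<^bsub>C\<^esub> x'')"
      using S' r by (simp add: Cl.smult_r_distr Cl.smult_mult_right)
    then show ?thesis using * W(2) r by blast
  qed
  have wordD: "wd w \<in> ?D" if "w \<in> lists (insert b S)" for w
    using that
  proof (induction w rule: lists.induct)
    case Nil
    have "\<one>\<^bsub>C\<^esub> = \<one>\<^bsub>C\<^esub> \<oplus>\<^bsub>C\<^esub> \<iota> b \<otimes>\<^bsub>C\<^esub> \<zero>\<^bsub>C\<^esub>" using S' by simp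
    then show ?case using W(4) W(5)[of "[]"] by auto
  next
    case (Cons c w)
    then obtain x' x'' where *: "wd w = x' \<oplus>\<^bsub>C\<^esub> \<iota> b \<otimes>\<^bsub>C\<^esub> x''" "x' \<in> word_span S" "x'' \<in> word_span S"
      by auto
    show ?case
    proof (cases "c = b")
      case True
      have "wd (c # w) = (q b \<odot>\<^bsub>C\<^esub> x'') \<oplus>\<^bsub>C\<^esub> \<iota> b \<otimes>\<^bsub>C\<^esub> x'"
        using * S' True
        by (simp add: Cl.r_distr Cl.m_assoc[symmetric] \<iota>_square Cl.smult_mult_left Cl.M.a_comm)
      then show ?thesis using * W(2)[of "q b" x''] S' by auto
    next
      case False
      then have c: "c \<in> S" "c \<in> carrier V" using Cons S' by auto
      have "wd (c # w) = (\<iota> c \<otimes>\<^bsub>C\<^esub> x' \<oplus>\<^bsub>C\<^esub> polar c b \<odot>\<^bsub>C\<^esub> x'') \<oplus>\<^bsub>C\<^esub> \<iota> b \<otimes>\<^bsub>C\<^esub> (\<ominus>\<^bsub>C\<^esub> (\<iota> c \<otimes>\<^bsub>C\<^esub> x''))"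
        using * S' c by (simp add: Cl.r_distr \<iota>_swap[OF c(2) S'(2)] a_minus_def Cl.r_minus Cl.M.a_assoc)
      moreover have "\<iota> c \<otimes>\<^bsub>C\<^esub> x' \<oplus>\<^bsub>C\<^esub> polar c b \<odot>\<^bsub>C\<^esub> x'' \<in> word_span S"
        "\<ominus>\<^bsub>C\<^esub> (\<iota> c \<otimes>\<^bsub>C\<^esub> x'') \<in> word_span S"
        using * c S' by (auto intro!: W(1-3) word_span_\<iota>_mult)
      ultimately show ?thesis by blast
    qed
  qed
  have "a \<in> ?D"
    using a unfolding word_span_def[of "insert b S"]
  proof induction
    case lin_span_zero
    have "\<zero>\<^bsub>C\<^esub> = \<zero>\<^bsub>C\<^esub> \<oplus>\<^bsub>C\<^esub> \<iota> b \<otimes>\<^bsub>C\<^esub> \<zero>\<^bsub>C\<^esub>" using S' by simp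
    then show ?case using W(4) by blast
  next
    case (lin_span_step r x s)
    then show ?case using wordD by (intro add smult) auto
  qed
  then show ?thesis using that by blast
qed

lemma contract_vanishes:
  assumes f: "linear_form R V f" and S: "S \<subseteq> carrier V" and f0: "\<And>c. c \<in> S \<Longrightarrow> f c = \<zero>"
    and w: "w \<in> lists S" and \<Phi>: "word_functional \<Phi>"
  shows "contract R f \<Phi> w = \<zero>"
  using w \<Phi>
proof (induction w arbitrary: \<Phi> rule: lists.induct)
  case (Cons c w)
  then have "contract R f (\<lambda>u. \<Phi> (c # u)) w = \<zero>"
    using S by (intro Cons.IH word_functional_Cons) auto
  moreover have "w \<in> words" using Cons S lists_mono by blast
  ultimately show ?case using Cons f0 by (simp add: a_minus_def word_functionalD)
qed simp

lemma induced_contract_zero: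
  assumes f: "linear_form R V f" and S: "S \<subseteq> carrier V" and f0: "\<And>c. c \<in> S \<Longrightarrow> f c = \<zero>"
    and \<Phi>: "clifford_functional \<Phi>" and a: "a \<in> word_span S"
  shows "induced (contract R f \<Phi>) a = \<zero>"
proof (rule Cl.linear_forms_eq_on_span[where X = "wd ` lists S"])
  show "linear_form R C (induced (contract R f \<Phi>))"
    using f \<Phi> by (intro induced_linear clifford_functional_contract)
  show "linear_form R C (\<lambda>_. \<zero>)" by (simp add: linear_form_def)
  show "wd ` lists S \<subseteq> carrier C" using S by (intro wd_image_carrier lists_mono)
  fix x assume "x \<in> wd ` lists S"
  then obtain w where w: "w \<in> lists S" "x = wd w" by auto
  then have "w \<in> words" using S lists_mono by blast
  then show "induced (contract R f \<Phi>) x = \<zero>"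
    using w f \<Phi> contract_vanishes[OF f S f0 w(1)]
    by (simp add: induced_wd clifford_functional_contract clifford_functional_word_functional)
qed (use a in \<open>simp add: word_span_def\<close>)

text \<open>If \<open>f\<close> is 1 on \<open>b\<close> and vanishes on the letters of \<open>a\<close>, contraction of \<open>b a\<close> with \<open>f\<close> just removes \<open>b\<close>.\<close>

lemma induced_contract_\<iota>_mult:
  assumes f: "linear_form R V f" and S: "S \<subseteq> carrier V" and f0: "\<And>c. c \<in> S \<Longrightarrow> f c = \<zero>"
    and b: "b \<in> carrier V" "f b = \<one>"
    and \<Phi>: "clifford_functional \<Phi>" and a: "a \<in> word_span S"
  shows "induced (contract R f \<Phi>) (\<iota> b \<otimes>\<^bsub>C\<^esub> a) = induced \<Phi> a"
proof (rule Cl.linear_forms_eq_on_span[where X = "wd ` lists S"])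
  note cf = clifford_functional_contract[OF f \<Phi>]
  note wf = clifford_functional_word_functional[OF \<Phi>]
  note lin = linear_formD[OF induced_linear[OF cf]]
  show "linear_form R C (\<lambda>a. induced (contract R f \<Phi>) (\<iota> b \<otimes>\<^bsub>C\<^esub> a))"
    using b by (auto simp: linear_form_def Cl.r_distr Cl.smult_mult_right lin)
  show "linear_form R C (induced \<Phi>)" using \<Phi> by (rule induced_linear)
  show "wd ` lists S \<subseteq> carrier C" using S by (intro wd_image_carrier lists_mono)
  fix x assume "x \<in> wd ` lists S"
  then obtain w where w: "w \<in> lists S" "x = wd w" by auto
  then have ww: "w \<in> words" using S lists_mono by blast
  have "induced (contract R f \<Phi>) (wd (b # w)) = contract R f \<Phi> (b # w)"
    using b ww by (intro induced_wd cf) auto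
  also have "\<dots> = \<Phi> w"
    using b ww contract_vanishes[OF f S f0 w(1) word_functional_Cons[OF wf b(1)]] wf
    by (simp add: a_minus_def word_functionalD)
  also have "\<dots> = induced \<Phi> x" using ww w \<Phi> by (simp add: induced_wd)
  finally show "induced (contract R f \<Phi>) (\<iota> b \<otimes>\<^bsub>C\<^esub> x) = induced \<Phi> x" using w by simp
qed (use a in \<open>simp add: word_span_def\<close>)

text \<open>Induction over \<open>S\<close>. In \<open>a = a' + b a''\<close> the contraction with the coordinate function of \<open>b\<close> yields
\<open>a''\<close>, so all functionals vanish on \<open>a''\<close>. By the induction hypothesis \<open>a''\<close> is a scalar, and the normalized
functional shows that this scalar is zero. Then \<open>a = a'\<close> involves fewer basis vectors.\<close>

lemma scalar_if_contractions_vanish: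
  assumes "S \<subseteq> B" and "a \<in> word_span S"
    and "\<And>\<Phi> c. \<lbrakk>clifford_functional \<Phi>; c \<in> S\<rbrakk> \<Longrightarrow> induced (contract R (coord c) \<Phi>) a = \<zero>"
  shows "\<exists>r\<in>carrier R. a = r \<odot>\<^bsub>C\<^esub> \<one>\<^bsub>C\<^esub>"
proof -
  have "finite S" using assms(1) finite_B finite_subset by blast
  then show ?thesis
    using assms
  proof (induction S arbitrary: a rule: finite_induct)
    case empty
    have "a \<in> lin_span R C {\<one>\<^bsub>C\<^esub>}" using empty(2) by (simp add: word_span_def)
    then show ?case
    proof induction
      case lin_span_zero
      then show ?case by (intro bexI[of _ \<zero>]) auto
    next
      case (lin_span_step r x s)
      then obtain t where "t \<in> carrier R" "s = t \<odot>\<^bsub>C\<^esub> \<one>\<^bsub>C\<^esub>" by blast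
      then show ?case
        using lin_span_step by (intro bexI[of _ "r \<oplus> t"]) (auto simp: Cl.smult_l_distr)
    qed
  next
    case (insert b S)
    have b: "b \<in> B" "b \<in> carrier V" and S: "S \<subseteq> B" "S \<subseteq> carrier V" using insert B_carrier by auto
    then have bS: "insert b S \<subseteq> carrier V" by simp
    obtain a' a'' where a: "a' \<in> word_span S" "a'' \<in> word_span S"
      "a = a' \<oplus>\<^bsub>C\<^esub> \<iota> b \<otimes>\<^bsub>C\<^esub> a''"
      by (rule word_span_insert[OF bS insert.prems(2)])
    have ac: "a' \<in> carrier C" "a'' \<in> carrier C" using a word_span_carrier[OF S(2)] by auto
    have b0: "coord b c = \<zero>" if "c \<in> S" for c
      using that insert S b by (subst coords_basis) auto
    have b1: "coord b b = \<one>" using b by (simp add: coords_basis)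
    note bl = coord_linear[OF b(1)]
    have zero: "induced \<Phi> a'' = \<zero>" if \<Phi>: "clifford_functional \<Phi>" for \<Phi>
    proof -
      note lin = linear_formD[OF induced_linear[OF clifford_functional_contract[OF bl \<Phi>]]]
      have "\<zero> = induced (contract R (coord b) \<Phi>) a"
        using insert.prems(3)[OF \<Phi>, of b] by simp
      also have "\<dots> = induced (contract R (coord b) \<Phi>) a' \<oplus> induced (contract R (coord b) \<Phi>) (\<iota> b \<otimes>\<^bsub>C\<^esub> a'')"
        using a(3) ac b by (simp add: lin)
      also have "induced (contract R (coord b) \<Phi>) a' = \<zero>"
        using induced_contract_zero[OF bl S(2) b0 \<Phi> a(1)] .
      also have "induced (contract R (coord b) \<Phi>) (\<iota> b \<otimes>\<^bsub>C\<^esub> a'') = induced \<Phi> a''"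
        using induced_contract_\<iota>_mult[OF bl S(2) b0 b(2) b1 \<Phi> a(2)] .
      finally show ?thesis using ac linear_formD(1)[OF induced_linear[OF \<Phi>]] by simp
    qed
    obtain r where r: "r \<in> carrier R" "a'' = r \<odot>\<^bsub>C\<^esub> \<one>\<^bsub>C\<^esub>"
      using insert.IH[OF S(1) a(2)] zero S coord_linear clifford_functional_contract by blast
    obtain \<Omega> where \<Omega>: "clifford_functional \<Omega>" "\<Omega> [] = \<one>"
      using exists_normalized_clifford_functional by blast
    have "r = induced \<Omega> a''"
      using r \<Omega> induced_wd[OF \<Omega>(1), of "[]"] linear_formD(3)[OF induced_linear[OF \<Omega>(1)], of r "\<one>\<^bsub>C\<^esub>"] by simp
    then have "a'' = \<zero>\<^bsub>C\<^esub>" using zero[OF \<Omega>(1)] r by simp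
    then have "a = a'" using a(3) ac b by simp
    then show ?case using insert.IH[OF S(1) a(1)] insert.prems(3) by auto
  qed
qed

lemma carrier_word_span: "carrier C = word_span B"
proof
  note W = word_span_closed[OF B_carrier]
  show "word_span B \<subseteq> carrier C" using B_carrier by (rule word_span_carrier)
  have mult: "\<iota> x \<otimes>\<^bsub>C\<^esub> a \<in> word_span B" if x: "x \<in> carrier V" and a: "a \<in> word_span B" for x a
  proof -
    have ac: "a \<in> carrier C" using a word_span_carrier[OF B_carrier] by auto
    have "\<iota> (\<Oplus>\<^bsub>V\<^esub>b\<in>S. coords x b \<odot>\<^bsub>V\<^esub> b) \<otimes>\<^bsub>C\<^esub> a \<in> word_span B" if "finite S" "S \<subseteq> B" for S
      using that
    proof (induction S rule: finite_induct)
      case empty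
      have "\<iota> \<zero>\<^bsub>V\<^esub> = \<iota> (\<zero> \<odot>\<^bsub>V\<^esub> \<zero>\<^bsub>V\<^esub>)" by simp
      also have "\<dots> = \<zero>\<^bsub>C\<^esub>" by (subst \<iota>_smult) simp_all
      finally show ?case using ac W(4) by simp
    next
      case (insert b S)
      have s: "(\<Oplus>\<^bsub>V\<^esub>b\<in>S. coords x b \<odot>\<^bsub>V\<^esub> b) \<in> carrier V"
        using insert x by (intro M.finsum_closed) auto
      have b: "b \<in> B" "coords x b \<in> carrier R" using insert x by auto
      have "(\<Oplus>\<^bsub>V\<^esub>b\<in>insert b S. coords x b \<odot>\<^bsub>V\<^esub> b) =
          coords x b \<odot>\<^bsub>V\<^esub> b \<oplus>\<^bsub>V\<^esub> (\<Oplus>\<^bsub>V\<^esub>b\<in>S. coords x b \<odot>\<^bsub>V\<^esub> b)"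
        using insert x by (intro M.finsum_insert) auto
      then have "\<iota> (\<Oplus>\<^bsub>V\<^esub>b\<in>insert b S. coords x b \<odot>\<^bsub>V\<^esub> b) \<otimes>\<^bsub>C\<^esub> a =
          coords x b \<odot>\<^bsub>C\<^esub> (\<iota> b \<otimes>\<^bsub>C\<^esub> a) \<oplus>\<^bsub>C\<^esub> \<iota> (\<Oplus>\<^bsub>V\<^esub>b\<in>S. coords x b \<odot>\<^bsub>V\<^esub> b) \<otimes>\<^bsub>C\<^esub> a"
        using s b ac by (simp add: \<iota>_add \<iota>_smult Cl.l_distr Cl.smult_mult_left)
      then show ?case
        using insert a b by (auto intro!: W(1) W(2) word_span_\<iota>_mult[OF B_carrier])
    qed
    from this[OF finite_B] show ?thesis using coords(2)[OF x] by simp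
  qed
  have wdB: "wd w \<in> word_span B" if "w \<in> words" for w
    using that
  proof (induction rule: lists.induct)
    case Nil
    then show ?case using W(5)[of "[]"] by simp
  next
    case (Cons x w)
    then show ?case using mult by simp
  qed
  show "carrier C \<subseteq> word_span B"
  proof
    fix a assume "a \<in> carrier C"
    then have "a \<in> lin_span R C (wd ` words)" using spanned by simp
    then show "a \<in> word_span B"
      by induction (use wdB in \<open>auto intro!: W(1,2,4) simp del: in_lists_conv_set\<close>)
  qed
qed

lemma induced_contract_expand:
  assumes f: "linear_form R V f" and \<Phi>: "clifford_functional \<Phi>" and a: "a \<in> carrier C"
  shows "induced (contract R f \<Phi>) a = (\<Oplus>b\<in>B. f b \<otimes> induced (contract R (coord b) \<Phi>) a)"
proof (rule Cl.linear_forms_eq_on_span[where X = "wd ` words"])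
  note cf = clifford_functional_contract[OF _ \<Phi>]
  show "linear_form R C (induced (contract R f \<Phi>))" using f by (intro induced_linear cf)
  show "linear_form R C (\<lambda>a. \<Oplus>b\<in>B. f b \<otimes> induced (contract R (coord b) \<Phi>) a)"
    using finite_B linear_formD(1)[OF f] coord_linear
    by (intro Cl.linear_form_finsum induced_linear cf) auto
  show "wd ` words \<subseteq> carrier C" by (rule wd_image_carrier) simp
  show "a \<in> lin_span R C (wd ` words)" using a spanned by simp
  fix x assume "x \<in> wd ` words"
  then obtain w where w: "w \<in> words" "x = wd w" by auto
  note wf = clifford_functional_word_functional[OF \<Phi>]
  have "(\<Oplus>b\<in>B. f b \<otimes> contract R (coord b) \<Phi> w) = (\<Oplus>b\<in>B. f b \<otimes> induced (contract R (coord b) \<Phi>) x)"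
  proof (rule R.finsum_cong'[OF refl])
    show "(\<lambda>b. f b \<otimes> induced (contract R (coord b) \<Phi>) x) \<in> B \<rightarrow> carrier R"
      using w(1) linear_formD(1)[OF f] linear_formD(1)[OF induced_linear[OF cf[OF coord_linear]]]
      unfolding w(2) by (intro funcsetI R.m_closed) (simp_all del: in_lists_conv_set)
  qed (use w in \<open>simp add: induced_wd cf coord_linear del: in_lists_conv_set\<close>)
  then show "induced (contract R f \<Phi>) x = (\<Oplus>b\<in>B. f b \<otimes> induced (contract R (coord b) \<Phi>) x)"
    using w f contract_expand[OF f w(1) wf] by (simp add: induced_wd cf)
qed


section \<open>Supercommutators and ideals\<close>

text \<open>Words of length at most \<open>m - 1\<close> whose length has the parity of \<open>m - 1\<close>. The shift makes the part for
\<open>m = 0\<close> trivial, where the induction on \<open>m\<close> starts, and the part for \<open>m = 1\<close> consists of the scalars.\<close>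

definition filtered_part :: "nat \<Rightarrow> 'e set" where
  "filtered_part m = lin_span R C (wd ` {w \<in> words. length w < m \<and> odd (length w + m)})"

text \<open>The number \<open>n\<close> stands for the parity of \<open>a\<close>; that of a word is given by its length.\<close>

definition supercommutator :: "'c \<Rightarrow> nat \<Rightarrow> 'e \<Rightarrow> 'e" where
  "supercommutator v n a = \<iota> v \<otimes>\<^bsub>C\<^esub> a \<ominus>\<^bsub>C\<^esub> signed C n (a \<otimes>\<^bsub>C\<^esub> \<iota> v)"

lemma supercommutator_linear:
  assumes "v \<in> carrier V"
  shows "a \<in> carrier C \<Longrightarrow> supercommutator v n a \<in> carrier C"
    and "\<lbrakk>a \<in> carrier C; b \<in> carrier C\<rbrakk> \<Longrightarrow>
      supercommutator v n (a \<oplus>\<^bsub>C\<^esub> b) = supercommutator v n a \<oplus>\<^bsub>C\<^esub> supercommutator v n b"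
    and "\<lbrakk>r \<in> carrier R; a \<in> carrier C\<rbrakk> \<Longrightarrow>
      supercommutator v n (r \<odot>\<^bsub>C\<^esub> a) = r \<odot>\<^bsub>C\<^esub> supercommutator v n a"
proof -
  have i: "\<iota> v \<in> carrier C" using assms by simp
  then show "a \<in> carrier C \<Longrightarrow> supercommutator v n a \<in> carrier C"
    by (simp add: supercommutator_def signed_def)
  have "i \<otimes>\<^bsub>C\<^esub> (a \<oplus>\<^bsub>C\<^esub> b) \<ominus>\<^bsub>C\<^esub> (a \<oplus>\<^bsub>C\<^esub> b) \<otimes>\<^bsub>C\<^esub> i =
      (i \<otimes>\<^bsub>C\<^esub> a \<ominus>\<^bsub>C\<^esub> a \<otimes>\<^bsub>C\<^esub> i) \<oplus>\<^bsub>C\<^esub> (i \<otimes>\<^bsub>C\<^esub> b \<ominus>\<^bsub>C\<^esub> b \<otimes>\<^bsub>C\<^esub> i)"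
    "i \<otimes>\<^bsub>C\<^esub> (a \<oplus>\<^bsub>C\<^esub> b) \<ominus>\<^bsub>C\<^esub> \<ominus>\<^bsub>C\<^esub> ((a \<oplus>\<^bsub>C\<^esub> b) \<otimes>\<^bsub>C\<^esub> i) =
      (i \<otimes>\<^bsub>C\<^esub> a \<ominus>\<^bsub>C\<^esub> \<ominus>\<^bsub>C\<^esub> (a \<otimes>\<^bsub>C\<^esub> i)) \<oplus>\<^bsub>C\<^esub> (i \<otimes>\<^bsub>C\<^esub> b \<ominus>\<^bsub>C\<^esub> \<ominus>\<^bsub>C\<^esub> (b \<otimes>\<^bsub>C\<^esub> i))"
    if "i \<in> carrier C" "a \<in> carrier C" "b \<in> carrier C" for i a b
    using that by algebra+
  from this[OF i] show "\<lbrakk>a \<in> carrier C; b \<in> carrier C\<rbrakk> \<Longrightarrow>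
      supercommutator v n (a \<oplus>\<^bsub>C\<^esub> b) = supercommutator v n a \<oplus>\<^bsub>C\<^esub> supercommutator v n b"
    by (cases "even n") (simp_all only: supercommutator_def signed_def if_True if_False)
  show "\<lbrakk>r \<in> carrier R; a \<in> carrier C\<rbrakk> \<Longrightarrow>
      supercommutator v n (r \<odot>\<^bsub>C\<^esub> a) = r \<odot>\<^bsub>C\<^esub> supercommutator v n a"
    using i by (cases "even n")
      (simp_all add: supercommutator_def signed_def a_minus_def Cl.smult_r_distr
        Cl.smult_mult_left Cl.smult_mult_right Cl.smult_r_minus)
qed

lemma filtered_part_mono:
  assumes "m \<le> n" "even (m + n)" shows "filtered_part m \<subseteq> filtered_part n"
  unfolding filtered_part_def using assms by (intro lin_span_mono) auto

lemma filtered_words: "wd ` {w \<in> words. length w < m \<and> odd (length w + m)} \<subseteq> carrier C"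
  by (rule wd_image_carrier) blast

text \<open>By \<open>v x w = \<langle>v, x\<rangle> w - x v w\<close>, the supercommutator with \<open>x w\<close> is \<open>\<langle>v, x\<rangle> w\<close> minus \<open>x\<close> times the
supercommutator with \<open>w\<close>, so one letter is lost.\<close>

lemma supercommutator_wd:
  assumes v: "v \<in> carrier V" and w: "w \<in> words"
  shows "supercommutator v (length w) (wd w) \<in> filtered_part (length w)"
  using w
proof (induction w rule: lists.induct)
  case Nil
  have "supercommutator v 0 \<one>\<^bsub>C\<^esub> = \<zero>\<^bsub>C\<^esub>"
    using v by (simp add: supercommutator_def signed_def a_minus_def Cl.M.r_neg)
  then show ?case by (simp add: filtered_part_def lin_span_zero)
next
  case (Cons x w)
  let ?n = "length w"
  have c: "\<iota> v \<in> carrier C" "\<iota> x \<in> carrier C" "wd w \<in> carrier C" "x \<in> carrier V"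
    using Cons v by auto
  have "(s \<ominus>\<^bsub>C\<^esub> x \<otimes>\<^bsub>C\<^esub> (v \<otimes>\<^bsub>C\<^esub> a)) \<ominus>\<^bsub>C\<^esub> \<ominus>\<^bsub>C\<^esub> ((x \<otimes>\<^bsub>C\<^esub> a) \<otimes>\<^bsub>C\<^esub> v) =
        s \<ominus>\<^bsub>C\<^esub> x \<otimes>\<^bsub>C\<^esub> (v \<otimes>\<^bsub>C\<^esub> a \<ominus>\<^bsub>C\<^esub> a \<otimes>\<^bsub>C\<^esub> v)"
       "(s \<ominus>\<^bsub>C\<^esub> x \<otimes>\<^bsub>C\<^esub> (v \<otimes>\<^bsub>C\<^esub> a)) \<ominus>\<^bsub>C\<^esub> (x \<otimes>\<^bsub>C\<^esub> a) \<otimes>\<^bsub>C\<^esub> v =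
        s \<ominus>\<^bsub>C\<^esub> x \<otimes>\<^bsub>C\<^esub> (v \<otimes>\<^bsub>C\<^esub> a \<ominus>\<^bsub>C\<^esub> \<ominus>\<^bsub>C\<^esub> (a \<otimes>\<^bsub>C\<^esub> v))"
    if "s \<in> carrier C" "x \<in> carrier C" "v \<in> carrier C" "a \<in> carrier C" for s x v a
    using that by algebra+
  note ids = this[OF _ c(2,1,3)]
  have "polar v x \<odot>\<^bsub>C\<^esub> wd w \<in> carrier C" using c v by simp
  then have eq: "supercommutator v (Suc ?n) (wd (x # w)) =
      polar v x \<odot>\<^bsub>C\<^esub> wd w \<ominus>\<^bsub>C\<^esub> \<iota> x \<otimes>\<^bsub>C\<^esub> supercommutator v ?n (wd w)"
    unfolding supercommutator_def signed_def foldr.simps o_apply \<iota>_swap[OF v c(4,3)]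
    by (cases "even ?n") (simp_all only: ids even_Suc if_True if_False simp_thms)
  have "wd w \<in> filtered_part (Suc ?n)"
    unfolding filtered_part_def using Cons
    by (intro Cl.lin_span_incl[OF filtered_words] imageI) auto
  moreover have "\<iota> x \<otimes>\<^bsub>C\<^esub> supercommutator v ?n (wd w) \<in> filtered_part (Suc ?n)"
    unfolding filtered_part_def
    by (rule \<iota>_mult_lin_span[OF _ _ c(4) _ Cons.IH[unfolded filtered_part_def]])
      (use c(4) in auto)
  ultimately show ?case
    unfolding length_Cons eq a_minus_def filtered_part_def using c v
    by (intro Cl.lin_span_add[OF filtered_words] Cl.lin_span_smult[OF filtered_words]
        Cl.lin_span_uminus[OF filtered_words]) simp_all
qed

lemma supercommutator_filtered:
  assumes v: "v \<in> carrier V" and a: "a \<in> filtered_part (Suc m)"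
  shows "supercommutator v m a \<in> filtered_part m"
  unfolding filtered_part_def[of m]
proof (rule lin_span_map[where h = "supercommutator v m", OF Cl.module_axioms Cl.module_axioms
      filtered_words filtered_words _ _ _ _ a[unfolded filtered_part_def]])
  fix x assume "x \<in> wd ` {w \<in> words. length w < Suc m \<and> odd (length w + Suc m)}"
  then obtain w where "w \<in> words" "length w < Suc m" "odd (length w + Suc m)" "x = wd w" by blast
  then have w: "w \<in> words" "length w \<le> m" "even (length w + m)" "x = wd w" by auto
  then have "supercommutator v m x = supercommutator v (length w) (wd w)"
    unfolding supercommutator_def signed_def by simp
  then show "supercommutator v m x \<in> lin_span R C (wd ` {w \<in> words. length w < m \<and> odd (length w + m)})"
    using supercommutator_wd[OF v w(1)] filtered_part_mono[OF w(2,3)]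
    unfolding filtered_part_def[of m] by auto
qed (simp_all add: supercommutator_linear[OF v])

lemma induced_supercommutator:
  assumes v: "v \<in> carrier V" and a: "a \<in> filtered_part (Suc m)" and \<Phi>: "clifford_functional \<Phi>"
  shows "induced \<Phi> (supercommutator v m a) = induced (contract R (polar v) \<Phi>) a"
proof (rule Cl.linear_forms_eq_on_span[OF _ _ filtered_words _ a[unfolded filtered_part_def]])
  note lin = linear_formD[OF induced_linear[OF \<Phi>]]
  show "linear_form R C (\<lambda>a. induced \<Phi> (supercommutator v m a))"
    by (simp add: linear_form_def supercommutator_linear[OF v] lin)
  note cf = clifford_functional_contract[OF polar_linear_right[OF v] \<Phi>]
  show "linear_form R C (induced (contract R (polar v) \<Phi>))"
    by (rule induced_linear[OF cf])
  fix x assume "x \<in> wd ` {w \<in> words. length w < Suc m \<and> odd (length w + Suc m)}"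
  then obtain w where "w \<in> words" "odd (length w + Suc m)" "x = wd w" by blast
  then have w: "w \<in> words" "even (length w + m)" "x = wd w" by auto
  note neg = Cl.linear_form_uminus[OF induced_linear[OF \<Phi>]]
  have "induced \<Phi> (\<iota> v \<otimes>\<^bsub>C\<^esub> wd w) = \<Phi> (v # w)" "induced \<Phi> (wd w \<otimes>\<^bsub>C\<^esub> \<iota> v) = \<Phi> (w @ [v])"
    using induced_wd[OF \<Phi>, of "v # w"] induced_wd[OF \<Phi>, of "w @ [v]"] v w wd_snoc[of w v] by auto
  then have "induced \<Phi> (supercommutator v m x) = \<Phi> (v # w) \<ominus> signed R (length w) (\<Phi> (w @ [v]))"
    using v w by (auto simp: supercommutator_def signed_def a_minus_def lin neg)
  also have "\<dots> = induced (contract R (polar v) \<Phi>) x"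
    using clifford_functional_supercommutator[OF \<Phi> v w(1)] w cf by (simp add: induced_wd)
  finally show "induced \<Phi> (supercommutator v m x) = induced (contract R (polar v) \<Phi>) x" .
qed

text \<open>Non-degeneracy enters here. Although the forms \<open>\<langle>v, \<cdot>\<rangle>\<close> need not contain the coordinate functions,
the values of the contractions with the coordinate functions are the coefficients of a vector
orthogonal to all of \<open>V\<close>, and therefore vanish.\<close>

lemma scalar_if_supercommutators_vanish:
  assumes nd: "non_degenerate R V q" and a: "a \<in> filtered_part (Suc m)"
    and zero: "\<And>v. v \<in> carrier V \<Longrightarrow> supercommutator v m a = \<zero>\<^bsub>C\<^esub>"
  shows "\<exists>r\<in>carrier R. a = r \<odot>\<^bsub>C\<^esub> \<one>\<^bsub>C\<^esub>"
proof (rule scalar_if_contractions_vanish[OF subset_refl])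
  have ac: "a \<in> carrier C"
    using a Cl.lin_span_subset[OF filtered_words] unfolding filtered_part_def by blast
  then show "a \<in> word_span B" using carrier_word_span by simp
  fix \<Phi> c assume \<Phi>: "clifford_functional \<Phi>" and c: "c \<in> B"
  let ?e = "\<lambda>b. induced (contract R (coord b) \<Phi>) a"
  define x where "x = (\<Oplus>\<^bsub>V\<^esub>b\<in>B. ?e b \<odot>\<^bsub>V\<^esub> b)"
  have e: "?e b \<in> carrier R" if "b \<in> B" for b
    using that ac \<Phi> by (intro linear_formD(1)[OF induced_linear] clifford_functional_contract coord_linear)
  have xc: "x \<in> carrier V" unfolding x_def using e by (intro M.finsum_closed) auto
  have "polar x v = \<zero>" if v: "v \<in> carrier V" for v
  proof -
    have "polar x v = polar v x" by (rule polar_commute[OF xc v])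
    also have "\<dots> = (\<Oplus>b\<in>B. ?e b \<otimes> polar v b)"
      unfolding x_def using v e finite_B B_carrier by (intro linear_form_sum polar_linear_right) auto
    also have "\<dots> = (\<Oplus>b\<in>B. polar v b \<otimes> ?e b)"
      using v e by (intro R.finsum_cong') (auto simp: R.m_comm)
    also have "\<dots> = induced (contract R (polar v) \<Phi>) a"
      using induced_contract_expand[OF polar_linear_right[OF v] \<Phi> ac] by simp
    also have "\<dots> = induced \<Phi> \<zero>\<^bsub>C\<^esub>"
      using induced_supercommutator[OF v a \<Phi>] zero[OF v] by simp
    also have "\<dots> = \<zero>" using Cl.linear_form_zero[OF induced_linear[OF \<Phi>]] .
    finally show ?thesis .
  qed
  then have "x = \<zero>\<^bsub>V\<^esub>" using nd xc unfolding non_degenerate_def by blast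
  then show "?e c = \<zero>" using basis_independent[of ?e c] e c unfolding x_def by blast
qed

text \<open>For \<open>a\<close> in \<open>K\<close>, the supercommutators of \<open>a\<close> lie in \<open>K\<close> and in the previous part, so they are
zero by induction. Then \<open>a\<close> is a scalar, and \<open>K\<close> contains no scalars except zero.\<close>

lemma ideal_meets_filtered_part_trivially:
  assumes nd: "non_degenerate R V q" and K: "ideal K C"
    and scalars: "K \<inter> scalars R C \<subseteq> {\<zero>\<^bsub>C\<^esub>}"
  shows "K \<inter> filtered_part m \<subseteq> {\<zero>\<^bsub>C\<^esub>}"
proof (induction m)
  case 0
  have "a = \<zero>\<^bsub>C\<^esub>" if "a \<in> lin_span R C {}" for a
    using that by induction auto
  then show ?case by (auto simp: filtered_part_def)
next
  case (Suc m)
  interpret K: ideal K C by fact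
  show ?case
  proof
    fix a assume a: "a \<in> K \<inter> filtered_part (Suc m)"
    have "supercommutator v m a = \<zero>\<^bsub>C\<^esub>" if v: "v \<in> carrier V" for v
    proof -
      have "\<iota> v \<otimes>\<^bsub>C\<^esub> a \<in> K" "a \<otimes>\<^bsub>C\<^esub> \<iota> v \<in> K"
        using a v by (auto intro: K.I_l_closed K.I_r_closed)
      then have "supercommutator v m a \<in> K"
        unfolding supercommutator_def signed_def a_minus_def by auto
      then show ?thesis using supercommutator_filtered[OF v, of a m] a Suc by blast
    qed
    then obtain r where "r \<in> carrier R" "a = r \<odot>\<^bsub>C\<^esub> \<one>\<^bsub>C\<^esub>"
      using scalar_if_supercommutators_vanish[OF nd, of a m] a by blast
    then have "a \<in> scalars R C" unfolding scalars_def by blast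
    then show "a \<in> {\<zero>\<^bsub>C\<^esub>}" using a scalars by blast
  qed
qed

end


section \<open>Clifford functionals and the free algebra\<close>

definition pairing ::
  "('r, 'm) ring_scheme \<Rightarrow> ('v list \<Rightarrow> 'r) \<Rightarrow> ('v list \<Rightarrow> 'r) \<Rightarrow> 'r" where
  "pairing R \<Phi> f = (\<Oplus>\<^bsub>R\<^esub>w\<in>{w. f w \<noteq> \<zero>\<^bsub>R\<^esub>}. f w \<otimes>\<^bsub>R\<^esub> \<Phi> w)"

lemma letter_eq_word_monomial: "letter R v = word_monomial R [v]"
  by (simp add: letter_def word_monomial_def)

context quadratic_space
begin

abbreviation F where "F \<equiv> free_algebra R (carrier V)"
abbreviation T where "T \<equiv> tensor_algebra R V"
abbreviation Clf where "Clf \<equiv> clifford_algebra R V q"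
abbreviation monomial where "monomial \<equiv> word_monomial R"

sublocale F: assoc_algebra R F
  by (rule R.free_algebra_assoc_algebra)

lemma pairing_superset:
  assumes \<Phi>: "word_functional \<Phi>" and f: "f \<in> carrier F"
    and S: "finite S" "S \<subseteq> words" "{w. f w \<noteq> \<zero>} \<subseteq> S"
  shows "pairing R \<Phi> f = (\<Oplus>w\<in>S. f w \<otimes> \<Phi> w)"
  unfolding pairing_def
  using S f \<Phi>
  by (intro R.add.finprod_mono_neutral_cong_left)
    (auto simp: R.free_algebra_carrier word_functional_def subset_iff)

lemma pairing_linear:
  assumes \<Phi>: "word_functional \<Phi>" shows "linear_form R F (pairing R \<Phi>)"
  unfolding linear_form_def
proof (intro conjI ballI)
  have mem: "f w \<otimes> \<Phi> w \<in> carrier R" if "f \<in> carrier F" "w \<in> words" for f w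
    using that \<Phi> by (auto simp: R.free_algebra_carrier word_functional_def)
  show "pairing R \<Phi> \<in> carrier F \<rightarrow> carrier R"
  proof
    fix f assume f: "f \<in> carrier F"
    then show "pairing R \<Phi> f \<in> carrier R"
      unfolding pairing_def using mem[OF f]
      by (intro R.finsum_closed) (auto simp: R.free_algebra_carrier)
  qed
  fix f g assume f: "f \<in> carrier F" and g: "g \<in> carrier F"
  let ?S = "{w. f w \<noteq> \<zero>} \<union> {w. g w \<noteq> \<zero>}"
  have S: "finite ?S" "?S \<subseteq> words" using f g by (auto simp: R.free_algebra_carrier)
  have fg: "f \<oplus>\<^bsub>F\<^esub> g \<in> carrier F" using f g by simp
  have "pairing R \<Phi> (f \<oplus>\<^bsub>F\<^esub> g) = (\<Oplus>w\<in>?S. (f \<oplus>\<^bsub>F\<^esub> g) w \<otimes> \<Phi> w)"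
    using S f g by (intro pairing_superset \<Phi> fg) (auto simp: R.free_algebra_simps)
  also have "\<dots> = (\<Oplus>w\<in>?S. f w \<otimes> \<Phi> w \<oplus> g w \<otimes> \<Phi> w)"
  proof (rule R.finsum_cong'[OF refl])
    fix w assume "w \<in> ?S"
    then have "w \<in> words" using S by blast
    then show "(f \<oplus>\<^bsub>F\<^esub> g) w \<otimes> \<Phi> w = f w \<otimes> \<Phi> w \<oplus> g w \<otimes> \<Phi> w"
      using f g \<Phi> by (simp add: R.free_algebra_simps R.free_algebra_carrier word_functional_def R.l_distr)
  qed (use S mem f g in blast)
  also have "\<dots> = (\<Oplus>w\<in>?S. f w \<otimes> \<Phi> w) \<oplus> (\<Oplus>w\<in>?S. g w \<otimes> \<Phi> w)"
    using S mem f g by (intro R.finsum_addf) blast+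
  also have "\<dots> = pairing R \<Phi> f \<oplus> pairing R \<Phi> g"
    using S pairing_superset[OF \<Phi> f, of ?S] pairing_superset[OF \<Phi> g, of ?S] by auto
  finally show "pairing R \<Phi> (f \<oplus>\<^bsub>F\<^esub> g) = pairing R \<Phi> f \<oplus> pairing R \<Phi> g" .
next
  fix a f assume a: "a \<in> carrier R" and f: "f \<in> carrier F"
  let ?S = "{w. f w \<noteq> \<zero>}"
  have S: "finite ?S" "?S \<subseteq> words" using f by (auto simp: R.free_algebra_carrier)
  have \<Phi>c: "\<Phi> w \<in> carrier R" if "w \<in> ?S" for w
    using that S \<Phi> unfolding word_functional_def by blast
  have fc: "f w \<in> carrier R" for w using f by (simp add: R.free_algebra_carrier)
  have "pairing R \<Phi> (a \<odot>\<^bsub>F\<^esub> f) = (\<Oplus>w\<in>?S. (a \<odot>\<^bsub>F\<^esub> f) w \<otimes> \<Phi> w)"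
    using S a by (intro pairing_superset[OF \<Phi> F.smult_closed[OF a f]]) (auto simp: R.free_algebra_simps)
  also have "\<dots> = (\<Oplus>w\<in>?S. a \<otimes> (f w \<otimes> \<Phi> w))"
    using a \<Phi>c fc by (intro R.finsum_cong') (auto simp: R.free_algebra_simps R.m_assoc)
  also have "\<dots> = a \<otimes> pairing R \<Phi> f"
    unfolding pairing_def using a S \<Phi>c fc by (subst R.finsum_rdistr) auto
  finally show "pairing R \<Phi> (a \<odot>\<^bsub>F\<^esub> f) = a \<otimes> pairing R \<Phi> f" .
qed

lemma pairing_monomial:
  assumes \<Phi>: "word_functional \<Phi>" and u: "u \<in> words"
  shows "pairing R \<Phi> (monomial u) = \<Phi> u"
proof -
  have "pairing R \<Phi> (monomial u) = (\<Oplus>w\<in>{u}. monomial u w \<otimes> \<Phi> w)"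
    using u by (intro pairing_superset \<Phi> R.word_monomial_carrier) (auto simp: word_monomial_def)
  also have "\<dots> = \<Phi> u"
    using word_functionalD[OF \<Phi> u] by (simp add: word_monomial_def)
  finally show ?thesis .
qed

lemma monomial_closed [simp]: "u \<in> words \<Longrightarrow> monomial u \<in> carrier F"
  by (rule R.word_monomial_carrier)

lemma monomials_carrier: "X \<subseteq> words \<Longrightarrow> monomial ` X \<subseteq> carrier F"
  using monomial_closed by blast

lemma F_spanned: "f \<in> carrier F \<Longrightarrow> f \<in> lin_span R F (monomial ` words)"
  using R.free_algebra_spanned[of f "carrier V"]
    lin_span_mono[of "monomial ` {w. f w \<noteq> \<zero>}" "monomial ` words" R F]
  unfolding R.free_algebra_carrier by blast

lemma linear_forms_eq_on_monomials:
  assumes "linear_form R F \<alpha>" "linear_form R F \<gamma>" "\<And>w. w \<in> words \<Longrightarrow> \<alpha> (monomial w) = \<gamma> (monomial w)"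
    "f \<in> carrier F"
  shows "\<alpha> f = \<gamma> f"
  using assms(3)
  by (intro F.linear_forms_eq_on_span[OF assms(1,2) monomials_carrier[OF subset_refl] _ F_spanned[OF assms(4)]])
    blast

text \<open>Every relation of the Clifford algebra lies in this ideal; hence Clifford functionals
descend to the Clifford algebra.\<close>

definition annihilator :: "('c list \<Rightarrow> 'a) set" where
  "annihilator = {f \<in> carrier F. \<forall>\<Phi>. clifford_functional \<Phi> \<longrightarrow> pairing R \<Phi> f = \<zero>}"

lemma annihilatorI:
  "\<lbrakk>f \<in> carrier F; \<And>\<Phi>. clifford_functional \<Phi> \<Longrightarrow> pairing R \<Phi> f = \<zero>\<rbrakk> \<Longrightarrow> f \<in> annihilator"
  unfolding annihilator_def by blast

lemma annihilatorD:
  "f \<in> annihilator \<Longrightarrow> f \<in> carrier F"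
  "\<lbrakk>f \<in> annihilator; clifford_functional \<Phi>\<rbrakk> \<Longrightarrow> pairing R \<Phi> f = \<zero>"
  unfolding annihilator_def by auto

lemma pairing_clifford_linear: "clifford_functional \<Phi> \<Longrightarrow> linear_form R F (pairing R \<Phi>)"
  by (rule pairing_linear[OF clifford_functional_word_functional])

lemma pairing_clifford_monomial:
  "\<lbrakk>clifford_functional \<Phi>; u \<in> words\<rbrakk> \<Longrightarrow> pairing R \<Phi> (monomial u) = \<Phi> u"
  by (rule pairing_monomial[OF clifford_functional_word_functional])

lemma pairing_mult_monomial:
  assumes \<Phi>: "clifford_functional \<Phi>" and u: "u \<in> words" and f: "f \<in> carrier F"
  shows "pairing R \<Phi> (monomial u \<otimes>\<^bsub>F\<^esub> f) = pairing R (\<lambda>w. \<Phi> (u @ w)) f"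
    and "pairing R \<Phi> (f \<otimes>\<^bsub>F\<^esub> monomial u) = pairing R (\<lambda>w. \<Phi> (w @ u)) f"
proof -
  note lin = linear_formD[OF pairing_clifford_linear[OF \<Phi>]]
  note app = clifford_functional_append[OF \<Phi> u] clifford_functional_append_right[OF \<Phi> u]
  show "pairing R \<Phi> (monomial u \<otimes>\<^bsub>F\<^esub> f) = pairing R (\<lambda>w. \<Phi> (u @ w)) f"
  proof (rule linear_forms_eq_on_monomials[OF _ pairing_clifford_linear[OF app(1)] _ f])
    show "linear_form R F (\<lambda>f. pairing R \<Phi> (monomial u \<otimes>\<^bsub>F\<^esub> f))"
      unfolding linear_form_def using u
      by (simp add: lin F.r_distr F.smult_mult_right del: in_lists_conv_set)
    show "pairing R \<Phi> (monomial u \<otimes>\<^bsub>F\<^esub> monomial w) = pairing R (\<lambda>w. \<Phi> (u @ w)) (monomial w)"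
      if w: "w \<in> words" for w
      using u w \<Phi> app
      by (simp add: R.word_monomial_append pairing_clifford_monomial)
  qed
  show "pairing R \<Phi> (f \<otimes>\<^bsub>F\<^esub> monomial u) = pairing R (\<lambda>w. \<Phi> (w @ u)) f"
  proof (rule linear_forms_eq_on_monomials[OF _ pairing_clifford_linear[OF app(2)] _ f])
    show "linear_form R F (\<lambda>f. pairing R \<Phi> (f \<otimes>\<^bsub>F\<^esub> monomial u))"
      unfolding linear_form_def using u
      by (simp add: lin F.l_distr F.smult_mult_left del: in_lists_conv_set)
    show "pairing R \<Phi> (monomial w \<otimes>\<^bsub>F\<^esub> monomial u) = pairing R (\<lambda>w. \<Phi> (w @ u)) (monomial w)"
      if w: "w \<in> words" for w
      using u w \<Phi> app
      by (simp add: R.word_monomial_append pairing_clifford_monomial)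
  qed
qed

text \<open>Multiplication by a word turns a Clifford functional into a translated one, which is again a Clifford functional.\<close>

lemma annihilator_ideal: "ideal annihilator F"
proof (rule idealI[OF F.ring_axioms])
  note lin = linear_formD[OF pairing_clifford_linear]
  have zero_form: "linear_form R F (\<lambda>_. \<zero>)" by (simp add: linear_form_def)
  show "subgroup annihilator (add_monoid F)"
  proof (rule F.add.subgroupI)
    show "annihilator \<subseteq> carrier F" using annihilatorD(1) by blast
    have "\<zero>\<^bsub>F\<^esub> \<in> annihilator"
      by (rule annihilatorI) (simp_all add: F.linear_form_zero pairing_clifford_linear)
    then show "annihilator \<noteq> {}" by blast
    fix f assume f: "f \<in> annihilator"
    show "\<ominus>\<^bsub>F\<^esub> f \<in> annihilator"
      using f by (intro annihilatorI)
        (simp_all add: annihilatorD F.linear_form_uminus pairing_clifford_linear)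
    fix g assume g: "g \<in> annihilator"
    show "f \<oplus>\<^bsub>F\<^esub> g \<in> annihilator"
      using f g by (intro annihilatorI) (simp_all add: annihilatorD lin)
  qed
  fix f g assume f: "f \<in> annihilator" and g: "g \<in> carrier F"
  have fc: "f \<in> carrier F" using annihilatorD(1)[OF f] .
  show "g \<otimes>\<^bsub>F\<^esub> f \<in> annihilator"
  proof (rule annihilatorI)
    fix \<Phi> assume \<Phi>: "clifford_functional \<Phi>"
    show "pairing R \<Phi> (g \<otimes>\<^bsub>F\<^esub> f) = \<zero>"
    proof (rule linear_forms_eq_on_monomials[OF _ zero_form _ g])
      show "linear_form R F (\<lambda>g. pairing R \<Phi> (g \<otimes>\<^bsub>F\<^esub> f))"
        unfolding linear_form_def using fc \<Phi> by (simp add: lin F.l_distr F.smult_mult_left)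
      show "pairing R \<Phi> (monomial u \<otimes>\<^bsub>F\<^esub> f) = \<zero>" if "u \<in> words" for u
        using pairing_mult_monomial(1)[OF \<Phi> that fc]
          annihilatorD(2)[OF f clifford_functional_append[OF \<Phi> that]] by simp
    qed
  qed (use fc g in simp)
  show "f \<otimes>\<^bsub>F\<^esub> g \<in> annihilator"
  proof (rule annihilatorI)
    fix \<Phi> assume \<Phi>: "clifford_functional \<Phi>"
    show "pairing R \<Phi> (f \<otimes>\<^bsub>F\<^esub> g) = \<zero>"
    proof (rule linear_forms_eq_on_monomials[OF _ zero_form _ g])
      show "linear_form R F (\<lambda>g. pairing R \<Phi> (f \<otimes>\<^bsub>F\<^esub> g))"
        unfolding linear_form_def using fc \<Phi> by (simp add: lin F.r_distr F.smult_mult_right)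
      show "pairing R \<Phi> (f \<otimes>\<^bsub>F\<^esub> monomial u) = \<zero>" if "u \<in> words" for u
        using pairing_mult_monomial(2)[OF \<Phi> that fc]
          annihilatorD(2)[OF f clifford_functional_append_right[OF \<Phi> that]] by simp
    qed
  qed (use fc g in simp)
qed

lemma minus_self: "x \<in> carrier R \<Longrightarrow> x \<ominus> x = \<zero>"
  by (simp add: a_minus_def R.r_neg)

lemma pairing_minus:
  "\<lbrakk>clifford_functional \<Phi>; f \<in> carrier F; g \<in> carrier F\<rbrakk> \<Longrightarrow>
    pairing R \<Phi> (f \<ominus>\<^bsub>F\<^esub> g) = pairing R \<Phi> f \<ominus> pairing R \<Phi> g"
  by (simp add: a_minus_def linear_formD[OF pairing_clifford_linear] F.linear_form_uminus
      pairing_clifford_linear)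

definition linearity_relations :: "('c list \<Rightarrow> 'a) set" where
  "linearity_relations =
     {letter R (v \<oplus>\<^bsub>V\<^esub> w) \<ominus>\<^bsub>F\<^esub> (letter R v \<oplus>\<^bsub>F\<^esub> letter R w) | v w. v \<in> carrier V \<and> w \<in> carrier V} \<union>
     {letter R (a \<odot>\<^bsub>V\<^esub> v) \<ominus>\<^bsub>F\<^esub> (a \<odot>\<^bsub>F\<^esub> letter R v) | a v. a \<in> carrier R \<and> v \<in> carrier V}"

lemma linearity_ideal_eq: "linearity_ideal R V = Idl\<^bsub>F\<^esub> linearity_relations"
  by (simp add: linearity_ideal_def linearity_relations_def Let_def)

lemma letter_closed [simp]: "v \<in> carrier V \<Longrightarrow> letter R v \<in> carrier F"
  by (simp add: letter_eq_word_monomial)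

lemma pairing_letter: "\<lbrakk>clifford_functional \<Phi>; v \<in> carrier V\<rbrakk> \<Longrightarrow> pairing R \<Phi> (letter R v) = \<Phi> [v]"
  by (simp add: letter_eq_word_monomial pairing_clifford_monomial)

lemma linearity_relations_annihilated: "linearity_relations \<subseteq> annihilator"
proof
  fix f assume "f \<in> linearity_relations"
  then consider (add) v w where "f = letter R (v \<oplus>\<^bsub>V\<^esub> w) \<ominus>\<^bsub>F\<^esub> (letter R v \<oplus>\<^bsub>F\<^esub> letter R w)"
      "v \<in> carrier V" "w \<in> carrier V"
    | (smult) a v where "f = letter R (a \<odot>\<^bsub>V\<^esub> v) \<ominus>\<^bsub>F\<^esub> (a \<odot>\<^bsub>F\<^esub> letter R v)"
      "a \<in> carrier R" "v \<in> carrier V"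
    unfolding linearity_relations_def by blast
  then show "f \<in> annihilator"
  proof cases
    case add
    show ?thesis
    proof (rule annihilatorI)
      show "f \<in> carrier F" using add by simp
      fix \<Phi> assume \<Phi>: "clifford_functional \<Phi>"
      have "\<Phi> [v] \<in> carrier R" "\<Phi> [w] \<in> carrier R"
        using add word_functionalD[OF clifford_functional_word_functional[OF \<Phi>]] by auto
      then show "pairing R \<Phi> f = \<zero>"
        using add \<Phi> clifford_at_frontD(2)[OF clifford_functional_at_front[OF \<Phi>] add(2,3), of "[]"]
        by (simp add: pairing_minus linear_formD[OF pairing_clifford_linear] pairing_letter minus_self)
    qed
  next
    case smult
    show ?thesis
    proof (rule annihilatorI)
      show "f \<in> carrier F" using smult by simp
      fix \<Phi> assume \<Phi>: "clifford_functional \<Phi>"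
      have "\<Phi> [v] \<in> carrier R"
        using smult word_functionalD[OF clifford_functional_word_functional[OF \<Phi>]] by auto
      then show "pairing R \<Phi> f = \<zero>"
        using smult \<Phi> clifford_at_frontD(3)[OF clifford_functional_at_front[OF \<Phi>] smult(2,3), of "[]"]
        by (simp add: pairing_minus linear_formD[OF pairing_clifford_linear] pairing_letter minus_self)
    qed
  qed
qed

lemma linearity_ideal_ideal: "ideal (linearity_ideal R V) F"
  unfolding linearity_ideal_eq
  using linearity_relations_annihilated annihilatorD(1) by (intro F.genideal_ideal) blast

lemma linearity_ideal_annihilated: "linearity_ideal R V \<subseteq> annihilator"
  unfolding linearity_ideal_eq
  by (rule F.genideal_minimal[OF annihilator_ideal linearity_relations_annihilated])


section \<open>The Clifford algebra as a quotient of the free algebra\<close>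

abbreviation proj_T :: "('c list \<Rightarrow> 'a) \<Rightarrow> ('c list \<Rightarrow> 'a) set" where
  "proj_T \<equiv> (\<lambda>f. linearity_ideal R V +>\<^bsub>F\<^esub> f)"

lemma T_eq: "T = alg_quot F (linearity_ideal R V)"
  by (simp add: tensor_algebra_def)

lemma T_algebra: "assoc_algebra R T"
  and proj_T_hom: "proj_T \<in> alg_hom R F T"
  and proj_T_surj: "proj_T ` carrier F = carrier T"
  and proj_T_kernel: "f \<in> carrier F \<Longrightarrow> proj_T f = \<zero>\<^bsub>T\<^esub> \<longleftrightarrow> f \<in> linearity_ideal R V"
  unfolding T_eq using F.quotient_projection[OF linearity_ideal_ideal] by auto

sublocale T: assoc_algebra R T
  by (rule T_algebra)

definition clifford_relation :: "'c \<Rightarrow> 'c list \<Rightarrow> 'a" where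
  "clifford_relation x = monomial [x, x] \<ominus>\<^bsub>F\<^esub> q x \<odot>\<^bsub>F\<^esub> monomial []"

lemma clifford_relation_annihilated:
  assumes x: "x \<in> carrier V" shows "clifford_relation x \<in> annihilator"
proof (rule annihilatorI)
  have c: "monomial [x, x] \<in> carrier F" "monomial [] \<in> carrier F" using x by auto
  then show "clifford_relation x \<in> carrier F" using x by (simp add: clifford_relation_def)
  fix \<Phi> assume \<Phi>: "clifford_functional \<Phi>"
  have "\<Phi> [] \<in> carrier R"
    using word_functionalD[OF clifford_functional_word_functional[OF \<Phi>]] by auto
  then show "pairing R \<Phi> (clifford_relation x) = \<zero>"
    using x c \<Phi> clifford_at_frontD(4)[OF clifford_functional_at_front[OF \<Phi>] x, of "[]"]
    by (simp add: clifford_relation_def pairing_minus linear_formD[OF pairing_clifford_linear]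
        pairing_clifford_monomial minus_self)
qed

lemma clifford_ideal_eq:
  "clifford_ideal R V q = Idl\<^bsub>T\<^esub> (proj_T ` clifford_relation ` carrier V)"
proof -
  have "tensor_incl R V x \<otimes>\<^bsub>T\<^esub> tensor_incl R V x \<ominus>\<^bsub>T\<^esub> (q x \<odot>\<^bsub>T\<^esub> \<one>\<^bsub>T\<^esub>) = proj_T (clifford_relation x)"
    if x: "x \<in> carrier V" for x
  proof -
    have c: "monomial [x] \<in> carrier F" "monomial [x, x] \<in> carrier F" "monomial [] \<in> carrier F"
      using x by auto
    have "tensor_incl R V x \<otimes>\<^bsub>T\<^esub> tensor_incl R V x = proj_T (monomial [x, x])"
      using c alg_homD(2)[OF proj_T_hom c(1) c(1)] R.word_monomial_append[where u = "[x]" and v = "[x]"]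
      by (simp add: tensor_incl_def letter_eq_word_monomial)
    moreover have "q x \<odot>\<^bsub>T\<^esub> \<one>\<^bsub>T\<^esub> = proj_T (q x \<odot>\<^bsub>F\<^esub> monomial [])"
      using x c alg_homD(4,5)[OF proj_T_hom] by (simp add: R.free_algebra_simps)
    ultimately show ?thesis
      using x c alg_hom_minus[OF proj_T_hom F.module_axioms T.module_axioms]
      by (simp add: clifford_relation_def)
  qed
  then have "{tensor_incl R V x \<otimes>\<^bsub>T\<^esub> tensor_incl R V x \<ominus>\<^bsub>T\<^esub> (q x \<odot>\<^bsub>T\<^esub> \<one>\<^bsub>T\<^esub>) | x. x \<in> carrier V} =
      proj_T ` clifford_relation ` carrier V"
    by (auto simp: image_iff)
  then show ?thesis unfolding clifford_ideal_def Let_def by simp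
qed

lemma clifford_relations_carrier: "proj_T ` clifford_relation ` carrier V \<subseteq> carrier T"
  using clifford_relation_annihilated annihilatorD(1) alg_homD(1)[OF proj_T_hom] by blast

lemma clifford_ideal_ideal: "ideal (clifford_ideal R V q) T"
  unfolding clifford_ideal_eq using clifford_relations_carrier by (rule T.genideal_ideal)

text \<open>The image of the annihilator under the surjection onto the tensor algebra is an ideal that contains
the generators.\<close>

lemma clifford_ideal_annihilated: "clifford_ideal R V q \<subseteq> proj_T ` annihilator"
  unfolding clifford_ideal_eq
  using alg_hom_image_ideal[OF proj_T_hom F.assoc_algebra_axioms T.assoc_algebra_axioms proj_T_surj
      annihilator_ideal] clifford_relation_annihilated
  by (intro T.genideal_minimal) blast+

abbreviation proj_Cl :: "('c list \<Rightarrow> 'a) \<Rightarrow> ('c list \<Rightarrow> 'a) set set" where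
  "proj_Cl f \<equiv> clifford_ideal R V q +>\<^bsub>T\<^esub> proj_T f"

lemma Cl_eq: "Clf = alg_quot T (clifford_ideal R V q)"
  by (simp add: clifford_algebra_def)

lemma Cl_algebra: "assoc_algebra R Clf"
  unfolding Cl_eq by (rule T.quotient_projection[OF clifford_ideal_ideal])

sublocale Clf: assoc_algebra R Clf
  by (rule Cl_algebra)

lemma proj_Cl_hom: "proj_Cl \<in> alg_hom R F Clf"
  using alg_hom_comp[OF proj_T_hom T.quotient_projection(2)[OF clifford_ideal_ideal]]
  unfolding Cl_eq by (simp add: comp_def)

lemma proj_Cl_surj: "proj_Cl ` carrier F = carrier Clf"
  using T.quotient_projection(3)[OF clifford_ideal_ideal] proj_T_surj
  unfolding Cl_eq by (metis image_image)

text \<open>An element of the kernel agrees with an element of the annihilator up to linearity relations,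
which lie in the annihilator themselves.\<close>

lemma proj_Cl_kernel_annihilated:
  assumes f: "f \<in> carrier F" and zero: "proj_Cl f = \<zero>\<^bsub>Clf\<^esub>"
  shows "f \<in> annihilator"
proof -
  interpret N: ideal annihilator F by (rule annihilator_ideal)
  have "proj_T f \<in> clifford_ideal R V q"
    using zero T.quotient_projection(4)[OF clifford_ideal_ideal alg_homD(1)[OF proj_T_hom f]]
    unfolding Cl_eq by simp
  then obtain g where g: "g \<in> annihilator" "proj_T f = proj_T g"
    using clifford_ideal_annihilated by blast
  have gc: "g \<in> carrier F" using g by simp
  have "proj_T (f \<ominus>\<^bsub>F\<^esub> g) = \<zero>\<^bsub>T\<^esub>"
    using alg_hom_minus[OF proj_T_hom F.module_axioms T.module_axioms f gc] g
      alg_homD(1)[OF proj_T_hom gc] by (simp add: a_minus_def T.M.r_neg)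
  then have "f \<ominus>\<^bsub>F\<^esub> g \<in> annihilator"
    using proj_T_kernel[of "f \<ominus>\<^bsub>F\<^esub> g"] f gc linearity_ideal_annihilated by auto
  then have "(f \<ominus>\<^bsub>F\<^esub> g) \<oplus>\<^bsub>F\<^esub> g \<in> annihilator" using g by simp
  then show ?thesis using f gc by (simp add: a_minus_def F.M.a_assoc F.M.l_neg)
qed

lemma clifford_functional_descends:
  assumes \<Phi>: "clifford_functional \<Phi>"
  shows "\<exists>\<psi>. linear_form R Clf \<psi> \<and> (\<forall>f\<in>carrier F. \<psi> (proj_Cl f) = pairing R \<Phi> f)"
proof -
  note lin = linear_formD[OF pairing_clifford_linear[OF \<Phi>]]
  note hom = alg_homD[OF proj_Cl_hom]
  define \<psi> where "\<psi> t = pairing R \<Phi> (SOME f. f \<in> carrier F \<and> proj_Cl f = t)" for t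
  have \<psi>: "\<psi> (proj_Cl f) = pairing R \<Phi> f" if f: "f \<in> carrier F" for f
  proof -
    define g where "g = (SOME g. g \<in> carrier F \<and> proj_Cl g = proj_Cl f)"
    have g: "g \<in> carrier F" "proj_Cl g = proj_Cl f"
      using someI[of "\<lambda>g. g \<in> carrier F \<and> proj_Cl g = proj_Cl f" f] f unfolding g_def by auto
    have "proj_Cl (g \<ominus>\<^bsub>F\<^esub> f) = \<zero>\<^bsub>Clf\<^esub>"
      using alg_hom_minus[OF proj_Cl_hom F.module_axioms Clf.module_axioms g(1) f] g(2) hom(1)[OF f]
      by (simp add: a_minus_def Clf.M.r_neg)
    then have "pairing R \<Phi> (g \<ominus>\<^bsub>F\<^esub> f) = \<zero>"
      using proj_Cl_kernel_annihilated f g \<Phi> by (intro annihilatorD(2)) auto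
    then have "pairing R \<Phi> g = pairing R \<Phi> f"
      using f g \<Phi> by (simp add: pairing_minus lin R.minus_eq R.add.inv_solve_right')
    then show ?thesis unfolding \<psi>_def g_def[symmetric] .
  qed
  have "linear_form R Clf \<psi>"
    unfolding linear_form_def proj_Cl_surj[symmetric]
  proof (intro conjI ballI)
    show "\<psi> \<in> proj_Cl ` carrier F \<rightarrow> carrier R" using \<psi> lin(1) by auto
    fix x y assume "x \<in> proj_Cl ` carrier F" "y \<in> proj_Cl ` carrier F"
    then obtain f g where "f \<in> carrier F" "g \<in> carrier F" "x = proj_Cl f" "y = proj_Cl g" by blast
    then show "\<psi> (x \<oplus>\<^bsub>Clf\<^esub> y) = \<psi> x \<oplus> \<psi> y"
      using \<psi>[of "f \<oplus>\<^bsub>F\<^esub> g"] by (simp add: hom(3) \<psi> lin)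
  next
    fix a x assume "a \<in> carrier R" "x \<in> proj_Cl ` carrier F"
    then obtain f where "a \<in> carrier R" "f \<in> carrier F" "x = proj_Cl f" by blast
    then show "\<psi> (a \<odot>\<^bsub>Clf\<^esub> x) = a \<otimes> \<psi> x"
      using \<psi>[of "a \<odot>\<^bsub>F\<^esub> f"] by (simp add: hom(5) \<psi> lin)
  qed
  then show ?thesis using \<psi> by blast
qed

definition clifford_incl :: "'c \<Rightarrow> ('c list \<Rightarrow> 'a) set set" where
  "clifford_incl x = proj_Cl (letter R x)"

lemma proj_Cl_monomial:
  assumes "w \<in> words"
  shows "proj_Cl (monomial w) = word_product Clf clifford_incl w"
  using assms
proof (induction rule: lists.induct)
  case Nil
  then show ?case using alg_homD(4)[OF proj_Cl_hom] by (simp add: R.free_algebra_simps)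
next
  case (Cons x w)
  have "proj_Cl (monomial [x] \<otimes>\<^bsub>F\<^esub> monomial w) = proj_Cl (monomial [x]) \<otimes>\<^bsub>Clf\<^esub> proj_Cl (monomial w)"
    using Cons by (intro alg_homD(2)[OF proj_Cl_hom]) auto
  then show ?case
    using Cons by (simp add: R.word_monomial_append clifford_incl_def letter_eq_word_monomial)
qed

lemma proj_Cl_relation:
  "x \<in> carrier V \<Longrightarrow> proj_Cl (clifford_relation x) = \<zero>\<^bsub>Clf\<^esub>"
  using T.quotient_projection(4)[OF clifford_ideal_ideal, of "proj_T (clifford_relation x)"]
    T.genideal_self[OF clifford_relations_carrier] clifford_relations_carrier
  unfolding Cl_eq clifford_ideal_eq by blast

lemma proj_Cl_linearity:
  assumes "f \<in> linearity_relations" shows "proj_Cl f = \<zero>\<^bsub>Clf\<^esub>"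
proof -
  have fc: "f \<in> carrier F" using assms linearity_relations_annihilated annihilatorD(1) by blast
  have "f \<in> linearity_ideal R V"
    unfolding linearity_ideal_eq
    using F.genideal_self[of linearity_relations] assms linearity_relations_annihilated annihilatorD(1)
    by blast
  then have "proj_T f = \<zero>\<^bsub>T\<^esub>" using proj_T_kernel[OF fc] by simp
  then show ?thesis
    using alg_hom_zero[OF T.quotient_projection(2)[OF clifford_ideal_ideal] T.module_axioms]
      Clf.module_axioms unfolding Cl_eq by simp
qed

lemma proj_Cl_eqI:
  assumes "f \<in> carrier F" "g \<in> carrier F" "proj_Cl (f \<ominus>\<^bsub>F\<^esub> g) = \<zero>\<^bsub>Clf\<^esub>"
  shows "proj_Cl f = proj_Cl g"
  using assms alg_hom_minus[OF proj_Cl_hom F.module_axioms Clf.module_axioms]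
    alg_homD(1)[OF proj_Cl_hom] by (simp add: Clf.M.minus_eq Clf.M.add.inv_solve_right')

lemma clifford_presentation:
  assumes B: "is_basis R V B"
  shows "clifford_presentation R V q B Clf clifford_incl"
proof -
  note hom = alg_homD[OF proj_Cl_hom]
  have based: "based_quadratic_space R V q B"
    by (intro based_quadratic_space.intro quadratic_space_axioms based_quadratic_space_axioms.intro B)
  show ?thesis
  proof (intro clifford_presentation.intro based Clf.assoc_algebra_axioms clifford_presentation_axioms.intro)
    fix x assume x: "x \<in> carrier V"
    show "clifford_incl x \<in> carrier Clf" using x by (simp add: clifford_incl_def hom)
    have "proj_Cl (monomial [x, x]) = proj_Cl (q x \<odot>\<^bsub>F\<^esub> monomial [])"
      using x proj_Cl_relation[OF x] by (intro proj_Cl_eqI) (auto simp: clifford_relation_def)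
    also have "\<dots> = q x \<odot>\<^bsub>Clf\<^esub> \<one>\<^bsub>Clf\<^esub>"
      using x hom(4) by (subst hom(5)) (auto simp: R.free_algebra_simps)
    finally show "clifford_incl x \<otimes>\<^bsub>Clf\<^esub> clifford_incl x = q x \<odot>\<^bsub>Clf\<^esub> \<one>\<^bsub>Clf\<^esub>"
      using x hom(2)[of "letter R x" "letter R x"]
      by (simp add: clifford_incl_def letter_eq_word_monomial R.word_monomial_append)
  next
    fix x y assume xy: "x \<in> carrier V" "y \<in> carrier V"
    have "letter R (x \<oplus>\<^bsub>V\<^esub> y) \<ominus>\<^bsub>F\<^esub> (letter R x \<oplus>\<^bsub>F\<^esub> letter R y) \<in> linearity_relations"
      using xy unfolding linearity_relations_def by blast
    then have "proj_Cl (letter R (x \<oplus>\<^bsub>V\<^esub> y)) = proj_Cl (letter R x \<oplus>\<^bsub>F\<^esub> letter R y)"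
      using xy by (intro proj_Cl_eqI proj_Cl_linearity) auto
    then show "clifford_incl (x \<oplus>\<^bsub>V\<^esub> y) = clifford_incl x \<oplus>\<^bsub>Clf\<^esub> clifford_incl y"
      using xy hom(3)[of "letter R x" "letter R y"] by (simp add: clifford_incl_def)
  next
    fix a x assume ax: "a \<in> carrier R" "x \<in> carrier V"
    have "letter R (a \<odot>\<^bsub>V\<^esub> x) \<ominus>\<^bsub>F\<^esub> (a \<odot>\<^bsub>F\<^esub> letter R x) \<in> linearity_relations"
      using ax unfolding linearity_relations_def by blast
    then have "proj_Cl (letter R (a \<odot>\<^bsub>V\<^esub> x)) = proj_Cl (a \<odot>\<^bsub>F\<^esub> letter R x)"
      using ax by (intro proj_Cl_eqI proj_Cl_linearity) auto
    then show "clifford_incl (a \<odot>\<^bsub>V\<^esub> x) = a \<odot>\<^bsub>Clf\<^esub> clifford_incl x"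
      using ax hom(5)[of a "letter R x"] by (simp add: clifford_incl_def)
  next
    have img: "(\<lambda>w. word_product Clf clifford_incl w) ` words = proj_Cl ` monomial ` words"
      unfolding image_image using proj_Cl_monomial by (intro image_cong) auto
    show "carrier Clf = lin_span R Clf ((\<lambda>w. word_product Clf clifford_incl w) ` words)"
      unfolding img
    proof
      show "carrier Clf \<subseteq> lin_span R Clf (proj_Cl ` monomial ` words)"
        unfolding proj_Cl_surj[symmetric]
        using alg_hom_lin_span[OF proj_Cl_hom F.module_axioms Clf.module_axioms
            monomials_carrier[OF subset_refl] F_spanned] by blast
      show "lin_span R Clf (proj_Cl ` monomial ` words) \<subseteq> carrier Clf"
        using monomials_carrier hom(1) by (intro Clf.lin_span_subset) auto
    qed
  next
    fix \<Phi> assume \<Phi>: "clifford_functional \<Phi>"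
    obtain \<psi> where \<psi>: "linear_form R Clf \<psi>" "\<And>f. f \<in> carrier F \<Longrightarrow> \<psi> (proj_Cl f) = pairing R \<Phi> f"
      using clifford_functional_descends[OF \<Phi>] by blast
    have "\<psi> (word_product Clf clifford_incl w) = \<Phi> w" if "w \<in> words" for w
      using \<psi>(2)[OF monomial_closed[OF that]] pairing_clifford_monomial[OF \<Phi> that] proj_Cl_monomial[OF that]
      by simp
    then show "\<exists>\<psi>. linear_form R Clf \<psi> \<and>
        (\<forall>w\<in>words. \<psi> (word_product Clf clifford_incl w) = \<Phi> w)"
      using \<psi>(1) by blast
  qed
qed

lemma clifford_part_eq:
  "clifford_part R V q i = proj_Cl ` {f \<in> carrier F. \<forall>w. f w \<noteq> \<zero> \<longrightarrow> length w mod 2 = i}"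
  unfolding clifford_part_def tensor_part_def Let_def image_image ..

lemma clifford_part_decomposition:
  assumes "a \<in> carrier Clf"
  obtains a0 a1 where "a0 \<in> clifford_part R V q 0" "a1 \<in> clifford_part R V q 1"
    "a = a0 \<oplus>\<^bsub>Clf\<^esub> a1"
proof -
  obtain f where f: "f \<in> carrier F" "a = proj_Cl f" using assms proj_Cl_surj by blast
  define g where "g i w = (if length w mod 2 = i then f w else \<zero>)" for i w
  have g: "g i \<in> carrier F" for i
    using f by (intro R.free_algebra_carrierI[where B = "{w. f w \<noteq> \<zero>}"])
      (auto simp: g_def R.free_algebra_carrier)
  have "f = g 0 \<oplus>\<^bsub>F\<^esub> g 1"
    using f(1) by (auto simp: g_def R.free_algebra_simps R.free_algebra_carrier fun_eq_iff)
  then have "a = proj_Cl (g 0) \<oplus>\<^bsub>Clf\<^esub> proj_Cl (g 1)"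
    using f g alg_homD(3)[OF proj_Cl_hom] by simp
  moreover have "proj_Cl (g i) \<in> clifford_part R V q i" for i
    unfolding clifford_part_eq
  proof (intro imageI CollectI conjI allI impI g)
    show "g i w \<noteq> \<zero> \<Longrightarrow> length w mod 2 = i" for w by (simp add: g_def split: if_splits)
  qed
  ultimately show ?thesis using that by blast
qed

text \<open>An element has finite support, so its words are bounded in length, and the bound can be chosen with the right parity.\<close>

lemma clifford_part_filtered:
  assumes a: "a \<in> clifford_part R V q i"
  shows "\<exists>m. a \<in> lin_span R Clf ((\<lambda>w. word_product Clf clifford_incl w) `
    {w \<in> words. length w < m \<and> odd (length w + m)})"
proof -
  obtain f where f: "f \<in> carrier F" "\<And>w. f w \<noteq> \<zero> \<Longrightarrow> length w mod 2 = i" "a = proj_Cl f"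
    using a unfolding clifford_part_eq by blast
  let ?supp = "{w. f w \<noteq> \<zero>}"
  have supp: "finite ?supp" "?supp \<subseteq> words" using f by (auto simp: R.free_algebra_carrier)
  then obtain N where N: "\<And>w. f w \<noteq> \<zero> \<Longrightarrow> length w \<le> N"
    using finite_imageI[of ?supp length] unfolding finite_nat_set_iff_bounded_le by blast
  let ?X = "\<lambda>m. {w \<in> words. length w < m \<and> odd (length w + m)}"
  have "?supp \<subseteq> ?X (2 * N + i + 1)"
  proof
    fix w assume w: "w \<in> ?supp"
    then have "even (length w + i)" using f(2)[of w] by (auto simp: even_iff_mod_2_eq_zero mod_simps)
    moreover have "length w < 2 * N + i + 1" using w N[of w] by simp
    ultimately show "w \<in> ?X (2 * N + i + 1)" using w supp by auto
  qed
  then have "lin_span R Clf (word_product Clf clifford_incl ` ?supp) \<subseteq>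
      lin_span R Clf (word_product Clf clifford_incl ` ?X (2 * N + i + 1))"
    by (intro lin_span_mono image_mono)
  moreover have "proj_Cl ` monomial ` ?supp = word_product Clf clifford_incl ` ?supp"
    unfolding image_image using supp(2) proj_Cl_monomial by (intro image_cong refl) blast
  moreover have "a \<in> lin_span R Clf (proj_Cl ` monomial ` ?supp)"
    unfolding f(3)
    by (rule alg_hom_lin_span[OF proj_Cl_hom F.module_axioms Clf.module_axioms
          monomials_carrier[OF supp(2)] R.free_algebra_spanned[OF f(1)]])
  ultimately have "a \<in> lin_span R Clf (word_product Clf clifford_incl ` ?X (2 * N + i + 1))"
    by (simp only: subset_iff)
  then show ?thesis by (rule exI)
qed

end


section \<open>Injectivity\<close>

theorem theorem2p7:
  fixes R :: "('r, 'm) ring_scheme"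
    and V :: "('r, 'v, 'n) module_scheme"
    and q :: "'v \<Rightarrow> 'r"
    and A :: "('r, 'a, 'k) module_scheme"
    and G :: "nat \<Rightarrow> 'a set"
    and \<phi> :: "('v list \<Rightarrow> 'r) set set \<Rightarrow> 'a"
  assumes "quadratic_space R V q"
    and "non_degenerate R V q"
    and "z2_graded_algebra R A G"
    and "\<phi> \<in> graded_alg_hom R (clifford_algebra R V q) (clifford_part R V q) A G"
    and "a_kernel (clifford_algebra R V q) A \<phi> \<inter> scalars R (clifford_algebra R V q)
           = {\<zero>\<^bsub>clifford_algebra R V q\<^esub>}"
  shows "inj_on \<phi> (carrier (clifford_algebra R V q))"
proof -
  interpret quadratic_space R V q by fact
  interpret A: z2_graded_algebra R A G by fact
  obtain B where B: "is_basis R V B" using finite_basis by blast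
  interpret P: clifford_presentation R V q B Clf clifford_incl
    by (rule clifford_presentation[OF B])
  have hom: "\<phi> \<in> alg_hom R Clf A" and graded: "\<And>i. i < 2 \<Longrightarrow> \<phi> ` clifford_part R V q i \<subseteq> G i"
    using assms(4) by (auto simp: graded_alg_hom_def)
  have \<phi>_ring_hom: "ring_hom_ring Clf A \<phi>"
  proof (rule ring_hom_ringI2[OF Clf.ring_axioms A.ring_axioms])
    show "\<phi> \<in> ring_hom Clf A" using hom by (simp add: alg_hom_def)
  qed
  let ?K = "a_kernel Clf A \<phi>"
  have kernelI: "x \<in> ?K" if "x \<in> carrier Clf" "\<phi> x = \<zero>\<^bsub>A\<^esub>" for x
    using that by (simp add: a_kernel_def')
  have homogeneous: "x = \<zero>\<^bsub>Clf\<^esub>"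
    if x: "x \<in> clifford_part R V q i" "x \<in> carrier Clf" "\<phi> x = \<zero>\<^bsub>A\<^esub>" for x i
  proof -
    obtain m where "x \<in> P.filtered_part m"
      using clifford_part_filtered[OF x(1)] unfolding P.filtered_part_def by blast
    then show ?thesis
      using P.ideal_meets_filtered_part_trivially[OF assms(2) ring_hom_ring.kernel_is_ideal[OF \<phi>_ring_hom], of m]
        assms(5) kernelI[OF x(2,3)] by blast
  qed
  have "?K = {\<zero>\<^bsub>Clf\<^esub>}"
  proof
    show "?K \<subseteq> {\<zero>\<^bsub>Clf\<^esub>}"
    proof
      fix a assume "a \<in> ?K"
      then have a: "a \<in> carrier Clf" "\<phi> a = \<zero>\<^bsub>A\<^esub>" by (auto simp: a_kernel_def')
      obtain a0 a1 where parts: "a0 \<in> clifford_part R V q 0" "a1 \<in> clifford_part R V q 1"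
        and sum: "a = a0 \<oplus>\<^bsub>Clf\<^esub> a1"
        by (rule clifford_part_decomposition[OF a(1)])
      have c: "a0 \<in> carrier Clf" "a1 \<in> carrier Clf"
        using parts alg_homD(1)[OF proj_Cl_hom] unfolding clifford_part_eq by auto
      have G: "\<phi> a0 \<in> G 0" "\<phi> a1 \<in> G 1" using parts graded[of 0] graded[of 1] by auto
      have \<phi>c: "\<phi> a0 \<in> carrier A" "\<phi> a1 \<in> carrier A" using c alg_homD(1)[OF hom] by auto
      \<comment> \<open>The images of the two parts are opposite to each other and lie in different parts of \<open>A\<close>.\<close>
      have \<phi>sum: "\<phi> a0 \<oplus>\<^bsub>A\<^esub> \<phi> a1 = \<zero>\<^bsub>A\<^esub>" using a(2) c alg_homD(3)[OF hom] by (simp add: sum)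
      then have "\<phi> a0 = \<ominus>\<^bsub>A\<^esub> \<phi> a1" using \<phi>c by (simp add: A.minus_equality)
      then have "\<phi> a0 \<in> G 1"
        using G(2) A.submoduleE(3)[OF A.part_submodule[of 1]] by simp
      then have "\<phi> a0 = \<zero>\<^bsub>A\<^esub>" using G(1) A.parts_disjoint by blast
      moreover from this have "\<phi> a1 = \<zero>\<^bsub>A\<^esub>" using \<phi>sum \<phi>c by simp
      ultimately have "a0 = \<zero>\<^bsub>Clf\<^esub>" "a1 = \<zero>\<^bsub>Clf\<^esub>" using homogeneous parts c by auto
      then show "a \<in> {\<zero>\<^bsub>Clf\<^esub>}" by (simp add: sum)
    qed
  qed (use assms(5) in blast)
  then show ?thesis by (rule ring_hom_ring.trivial_ker_imp_inj[OF \<phi>_ring_hom])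
qed

end
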